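(* Consider the stationary Sampled Moran Genealogy Process with population size $n$, event rate $\mu$, and sampling times $t_1<t_2<\cdots$. Let $k\ge1$, let $\mathbf{G}_k$ be the observed genealogy of the first $k$ samples, and write $\mathrm{live}(\mathbf{G}_k)=\{e_1,\dots,e_q\}$ with $e_1<\dots<e_q$. Then, for real $a$, \[ -\log\Pr(A_{k+1}<a\mid\mathbf{G}_k)=\int_a^\infty\frac{\ell_k(t)}{\binom n2}\mu\,dt+\sum_{\{j:\,a\le e_j\}}\log\frac{n-\ell_k(e_j)}{n-\ell_k(e_j)-1}, \] \[ -\log\Pr(A_{k+1}\le a\mid\mathbf{G}_k)=\int_a^\infty\frac{\ell_k(t)}{\binom n2}\mu\,dt+\sum_{\{j:\,a< e_j\}}\log\frac{n-\ell_k(e_j)}{n-\ell_k(e_j)-1}, \] \[ -\log\Pr(A_{k+1}=a\mid\mathbf{G}_k)=\begin{cases}\log(n-\ell_k(a))-\log\Pr(A_{k+1}\le a), & a\in\mathrm{live}(\mathbf{G}_k),\\ 0,& a\notin\mathrm{live}(\mathbf{G}_k).\end{cases} \] Moreover, the conditional distribution of $A_{k+1}$ given $\mathbf{G}_k$ is \[ f_{A_{k+1}\mid\mathbf{G}_k}(a)\,da=\Pr(A_{k+1}\le a\mid\mathbf{G}_k)\left(\mu\frac{\ell_k(a)}{\binom n2}\,da+\frac{\mathbf 1\{a\in\mathrm{live}(\mathbf{G}_k)\}}{n-\ell_k(a)}\,dn\right), \] where $da$ is Lebesgue measure and $dn$ counting measure on $\mathbb{R}$.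
   Context: Fix an integer $n\ge2$, $\mu>0$ and deterministic sampling times $t_1<t_2<\cdots$. A population of constant size $n$ evolves under Moran dynamics: events occur at rate $\mu$; at each, an ordered pair of distinct individuals is chosen uniformly at random, the first dies and the second gives birth to one offspring. Stationary: the population has evolved under these dynamics from the infinite past (the genealogy of the population at some time before $t_1$ is drawn from the stationary distribution of the genealogy process). At each time $t_i$ one living individual, chosen uniformly at random, is sampled (sampling does not alter the population). Each individual has a unique ancestral lineage going back in time. The observed genealogy $\mathbf{G}_k$ is the genealogy (tree with times) formed by the ancestral lineages of samples $1,\dots,k$, sample $i$'s lineage traced back from $t_i$. For $j\ge2$, the attachment time $A_j$ (with realized value $a_j$, $a_j\le t_{j-1}$) is the most recent time $s$ at which the ancestor at time $s$ of sample $j$ coincides with the ancestor-or-self at time $s$ of some sample $i<j$ with $t_i\ge s$; almost surely either $a_j=t_i$ for some $i<j$ (direct descent: sample $j$ descends from sample $i$ itself) or $a_j$ is not a sample time (a branch point). Sample $i\le k$ is dead in $\mathbf{G}_k$ if $a_j=t_i$ for some $j$ with $i<j\le k$, and live otherwise; $\mathrm{live}(\mathbf{G}_k)$ is the set of sample times of live samples. The branch points of $\mathbf{G}_k$ are the $a_j$, $2\le j\le k$, that are not sample times. The lineage-count function is $\ell_k(t)=|\{e\in\mathrm{live}(\mathbf{G}_k):e>t\}|-|\{\text{branch points }b\text{ of }\mathbf{G}_k: b>t\}|$ (right-continuous; the number of lineages of $\mathbf{G}_k$ at time $t$).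
   Formalization: In the third formula, for a not in live(G_k) the value −log Pr(A_{k+1}=a | G_k)=0 (probability 1) is false and is corrected to Pr(A_{k+1}=a | G_k)=0; there Pr(A_{k+1}≤a) is read as conditional on G_k; the −log formulas are stated in exponentiated form. *)

theory Defs
  imports "HOL-Probability.Probability"
begin

text \<open>
Two-sided construction of the stationary Sampled Moran Genealogy Process.
Individuals occupy slots 0..n-1.  Moran events form a homogeneous Poisson process of
rate mu on the whole real line; the m-th event (m :: int) occurs at time evt_time E m and
carries a uniformly random ordered pair (d,p) of distinct slots: the individual in slot d
dies and slot d receives an offspring of the individual in slot p.  Sample i (i >= 1) is
taken at time t i and is the individual in slot X i, X i uniform on slots.
All these ingredients are independent.

The Poisson process on the real line is generated by i.i.d. Exp(mu) variables E :: int => real: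
points after 0 are E 0, E 0 + E 1, ...; points before 0 are - E (-1), - E (-1) - E (-2), ...
\<close>

type_synonym omega = "(int \<Rightarrow> real) \<times> ((int \<Rightarrow> nat \<times> nat) \<times> (nat \<Rightarrow> nat))"

definition moran_pairs :: "nat \<Rightarrow> (nat \<times> nat) set" where
  "moran_pairs n = {(d, p). d < n \<and> p < n \<and> d \<noteq> p}"

definition smgp_space :: "nat \<Rightarrow> real \<Rightarrow> omega measure" where
  "smgp_space n mu =
     (PiM UNIV (\<lambda>_::int. density lborel (\<lambda>x. ennreal (exponential_density mu x))))
     \<Otimes>\<^sub>M ((PiM UNIV (\<lambda>_::int. measure_pmf (pmf_of_set (moran_pairs n))))
     \<Otimes>\<^sub>M (PiM UNIV (\<lambda>_::nat. measure_pmf (pmf_of_set {..<n}))))"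

definition evt_time :: "omega \<Rightarrow> int \<Rightarrow> real" where
  "evt_time \<omega> m =
     (if m \<ge> 0 then (\<Sum>j\<in>{0..m}. fst \<omega> j) else - (\<Sum>j\<in>{m..-1}. fst \<omega> j))"

definition evt_mark :: "omega \<Rightarrow> int \<Rightarrow> nat \<times> nat" where
  "evt_mark \<omega> m = fst (snd \<omega>) m"

definition sample_slot :: "omega \<Rightarrow> nat \<Rightarrow> nat" where
  "sample_slot \<omega> i = snd (snd \<omega>) i"

definition back_step :: "nat \<times> nat \<Rightarrow> nat \<Rightarrow> nat" where
  "back_step e y = (if y = fst e then snd e else y)"

definition events_in :: "omega \<Rightarrow> real \<Rightarrow> real \<Rightarrow> int list" where
  "events_in \<omega> s u = sorted_list_of_set {m. s < evt_time \<omega> m \<and> evt_time \<omega> m \<le> u}"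

definition anc_slot :: "(nat \<Rightarrow> real) \<Rightarrow> omega \<Rightarrow> nat \<Rightarrow> real \<Rightarrow> nat" where
  "anc_slot t \<omega> i s =
     foldr (\<lambda>m y. back_step (evt_mark \<omega> m) y) (events_in \<omega> s (t i)) (sample_slot \<omega> i)"

definition meet_time :: "(nat \<Rightarrow> real) \<Rightarrow> omega \<Rightarrow> nat \<Rightarrow> nat \<Rightarrow> real" where
  "meet_time t \<omega> i j =
     Sup {s. s \<le> min (t i) (t j) \<and> anc_slot t \<omega> i s = anc_slot t \<omega> j s}"

definition attach :: "(nat \<Rightarrow> real) \<Rightarrow> omega \<Rightarrow> nat \<Rightarrow> real" where
  "attach t \<omega> j = Max ((\<lambda>i. meet_time t \<omega> i j) ` {1..<j})"

text \<open>Observed genealogy G_k of samples 1..k, encoded by the matrix of pairwise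
  lineage-meeting times (this determines the labelled tree with times and vice versa).\<close>
definition genealogy :: "(nat \<Rightarrow> real) \<Rightarrow> nat \<Rightarrow> omega \<Rightarrow> nat \<times> nat \<Rightarrow> real" where
  "genealogy t k \<omega> ij =
     (if fst ij \<in> {1..k} \<and> snd ij \<in> {1..k} then meet_time t \<omega> (fst ij) (snd ij) else 0)"

definition genealogy_algebra :: "nat \<Rightarrow> real \<Rightarrow> (nat \<Rightarrow> real) \<Rightarrow> nat \<Rightarrow> omega measure" where
  "genealogy_algebra n mu t k =
     vimage_algebra (space (smgp_space n mu)) (genealogy t k) (PiM UNIV (\<lambda>_::nat \<times> nat. borel))"

definition dead :: "(nat \<Rightarrow> real) \<Rightarrow> nat \<Rightarrow> omega \<Rightarrow> nat \<Rightarrow> bool" where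
  "dead t k \<omega> i = (\<exists>j. i < j \<and> j \<le> k \<and> attach t \<omega> j = t i)"

definition live :: "(nat \<Rightarrow> real) \<Rightarrow> nat \<Rightarrow> omega \<Rightarrow> real set" where
  "live t k \<omega> = {t i | i. 1 \<le> i \<and> i \<le> k \<and> \<not> dead t k \<omega> i}"

definition branch_points :: "(nat \<Rightarrow> real) \<Rightarrow> nat \<Rightarrow> omega \<Rightarrow> real set" where
  "branch_points t k \<omega> =
     {attach t \<omega> j | j. 2 \<le> j \<and> j \<le> k \<and> attach t \<omega> j \<notin> {t i | i. 1 \<le> i}}"

definition lineages :: "(nat \<Rightarrow> real) \<Rightarrow> nat \<Rightarrow> omega \<Rightarrow> real \<Rightarrow> real" where
  "lineages t k \<omega> s =
     real (card {e \<in> live t k \<omega>. e > s}) - real (card {b \<in> branch_points t k \<omega>. b > s})"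

text \<open>Explicit formulas for Pr(A_{k+1} < a | G_k) and Pr(A_{k+1} <= a | G_k),
  written in exponentiated form of the paper's -log formulas.\<close>
definition prob_lt :: "nat \<Rightarrow> real \<Rightarrow> (nat \<Rightarrow> real) \<Rightarrow> nat \<Rightarrow> omega \<Rightarrow> real \<Rightarrow> real" where
  "prob_lt n mu t k \<omega> a =
     exp (- (LINT s:{a..}|lborel. lineages t k \<omega> s / real (n choose 2) * mu))
     * (\<Prod>e\<in>{e \<in> live t k \<omega>. a \<le> e}.
          (real n - lineages t k \<omega> e - 1) / (real n - lineages t k \<omega> e))"

definition prob_le :: "nat \<Rightarrow> real \<Rightarrow> (nat \<Rightarrow> real) \<Rightarrow> nat \<Rightarrow> omega \<Rightarrow> real \<Rightarrow> real" where
  "prob_le n mu t k \<omega> a =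
     exp (- (LINT s:{a..}|lborel. lineages t k \<omega> s / real (n choose 2) * mu))
     * (\<Prod>e\<in>{e \<in> live t k \<omega>. a < e}.
          (real n - lineages t k \<omega> e - 1) / (real n - lineages t k \<omega> e))"

end

theory Submission
  imports Defs
begin

text \<open>
  Followed backwards in time, the slots of the ancestors form a Markov chain that is exchangeable in the
  slots, so only the partition of the samples by common ancestor matters. As long as sample \<open>k + 1\<close> has met
  none of the \<open>l\<close> lineages of the genealogy, it meets one of them at rate \<open>l \<mu> / (n choose 2)\<close>, and at the
  time of a live sample it is that sample with probability \<open>1 / (n - l)\<close>. So if an event \<open>D\<close> only requires
  certain pairs among the first \<open>k\<close> samples to have distinct ancestors at given times (such events generate
  the genealogy), then the probability of \<open>D\<close> without a meeting at or after \<open>a\<close> is the expectation over \<open>D\<close> of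
  the Feynman-Kac weight \<open>exp (- \<integral> l \<mu> / (n choose 2)) \<Prod> (n - l - 1) / (n - l)\<close>.

  On a finite grid of times both sides are iterated averages over independent Poisson numbers of events.
  They differ by \<open>O(\<delta>\<^sup>2)\<close> per step of length \<open>\<delta>\<close>, hence agree in the limit. The distribution
  function of the attachment time then determines its law.
\<close>

section \<open>Averaging over events and samples\<close>

lemma card_moran_pairs: "card (moran_pairs n) = n * (n - 1)"
proof -
  have eq: "moran_pairs n = Sigma {..<n} (\<lambda>d. {..<n} - {d})"
    by (auto simp: moran_pairs_def)
  show ?thesis
    unfolding eq by (subst card_SigmaI) auto
qed

lemma finite_moran_pairs [simp]: "finite (moran_pairs n)"
  by (rule finite_subset[of _ "{..<n} \<times> {..<n}"]) (auto simp: moran_pairs_def)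

lemma bij_extend_finite:
  assumes "finite A" "B \<subseteq> A" "C \<subseteq> A" "bij_betw h B C"
  shows "\<exists>g. bij_betw g A A \<and> (\<forall>b\<in>B. g b = h b)"
proof -
  have "card B = card C" using assms by (simp add: bij_betw_same_card)
  then have "card (A - B) = card (A - C)"
    using assms by (simp add: card_Diff_subset finite_subset)
  then obtain h' where h': "bij_betw h' (A - B) (A - C)"
    using assms by (metis finite_Diff finite_same_card_bij)
  define g where "g = (\<lambda>x. if x \<in> B then h x else h' x)"
  have g1: "bij_betw g B C" using assms(4) by (subst bij_betw_cong[of _ _ h]) (auto simp: g_def)
  have g2: "bij_betw g (A - B) (A - C)" using h' by (subst bij_betw_cong[of _ _ h']) (auto simp: g_def)
  have "bij_betw g (B \<union> (A - B)) (C \<union> (A - C))"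
    by (rule bij_betw_combine[OF g1 g2]) auto
  then have "bij_betw g A A" using assms by (simp add: Un_absorb1)
  then show ?thesis by (intro exI[of _ g]) (auto simp: g_def)
qed

lemma abs_sum_diff_le:
  fixes f h :: "'a \<Rightarrow> real"
  assumes "\<And>b. b \<in> A \<Longrightarrow> \<bar>f b - h b\<bar> \<le> e"
  shows "\<bar>sum f A - sum h A\<bar> \<le> real (card A) * e"
proof -
  have "\<bar>sum f A - sum h A\<bar> = \<bar>\<Sum>b\<in>A. f b - h b\<bar>" by (simp add: sum_subtractf)
  also have "\<dots> \<le> (\<Sum>b\<in>A. \<bar>f b - h b\<bar>)" by (rule sum_abs)
  also have "\<dots> \<le> (\<Sum>b\<in>A. e)" by (intro sum_mono assms)
  finally show ?thesis by simp
qed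

fun sq_gaps :: "real list \<Rightarrow> real" where
  "sq_gaps (s # s' # ts) = (s - s')\<^sup>2 + sq_gaps (s' # ts)"
| "sq_gaps _ = 0"

lemma sq_gaps_nonneg: "0 \<le> sq_gaps ts"
  by (induction ts rule: sq_gaps.induct) auto

locale smgp =
  fixes n :: nat and mu :: real and t :: "nat \<Rightarrow> real" and k :: nat
  assumes n2: "2 \<le> n" and mu_pos: "0 < mu"
    and t_incr: "\<And>i. 1 \<le> i \<Longrightarrow> t i < t (Suc i)"
begin

lemma t_less: "1 \<le> i \<Longrightarrow> i < j \<Longrightarrow> t i < t j"
proof (induction j)
  case (Suc j)
  then show ?case using t_incr[of j] by (cases "i = j") auto
qed simp

lemma t_less_iff: "1 \<le> i \<Longrightarrow> 1 \<le> j \<Longrightarrow> t i < t j \<longleftrightarrow> i < j"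
  by (metis less_irrefl linorder_neqE_nat order_less_trans t_less)

lemma t_eq_iff: "1 \<le> i \<Longrightarrow> 1 \<le> j \<Longrightarrow> t i = t j \<longleftrightarrow> i = j"
  by (metis less_irrefl linorder_neqE_nat t_less)

definition valid :: "(nat \<Rightarrow> nat) \<Rightarrow> bool" where
  "valid x \<longleftrightarrow> (\<forall>i. x i < n)"

definition event_avg :: "((nat \<Rightarrow> nat) \<Rightarrow> real) \<Rightarrow> (nat \<Rightarrow> nat) \<Rightarrow> real" where
  "event_avg f x = (\<Sum>b\<in>moran_pairs n. f (\<lambda>i. back_step b (x i))) / real (n * (n - 1))"

definition slot_upd :: "real \<Rightarrow> nat \<Rightarrow> (nat \<Rightarrow> nat) \<Rightarrow> nat \<Rightarrow> nat" where
  "slot_upd s y x = (\<lambda>i. if 1 \<le> i \<and> i \<le> Suc k \<and> t i = s then y else x i)"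

definition sample_avg :: "real \<Rightarrow> ((nat \<Rightarrow> nat) \<Rightarrow> real) \<Rightarrow> (nat \<Rightarrow> nat) \<Rightarrow> real" where
  "sample_avg s f x = (\<Sum>y<n. f (slot_upd s y x)) / real n"

definition poisson_avg :: "real \<Rightarrow> ((nat \<Rightarrow> nat) \<Rightarrow> real) \<Rightarrow> (nat \<Rightarrow> nat) \<Rightarrow> real" where
  "poisson_avg r f x = measure_pmf.expectation (poisson_pmf r) (\<lambda>c. (event_avg ^^ c) f x)"

definition smp_ge :: "real \<Rightarrow> nat set" where "smp_ge s = {i \<in> {1..k}. s \<le> t i}"
definition smp_gt :: "real \<Rightarrow> nat set" where "smp_gt s = {i \<in> {1..k}. s < t i}"

text \<open>The chain is exchangeable in the slots, so only the partition of the samples by common slot matters.\<close>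

definition same_kernel :: "nat set \<Rightarrow> (nat \<Rightarrow> nat) \<Rightarrow> (nat \<Rightarrow> nat) \<Rightarrow> bool" where
  "same_kernel A x y \<longleftrightarrow> (\<forall>i\<in>A. \<forall>j\<in>A. (x i = x j) = (y i = y j))"

definition kernel_inv :: "nat set \<Rightarrow> ((nat \<Rightarrow> nat) \<Rightarrow> real) \<Rightarrow> bool" where
  "kernel_inv A f \<longleftrightarrow> (\<forall>x y. valid x \<longrightarrow> valid y \<longrightarrow> same_kernel A x y \<longrightarrow> f x = f y)"

definition unit_bdd :: "((nat \<Rightarrow> nat) \<Rightarrow> real) \<Rightarrow> bool" where
  "unit_bdd f \<longleftrightarrow> (\<forall>x. valid x \<longrightarrow> 0 \<le> f x \<and> f x \<le> 1)"

lemma finite_smp_ge [simp]: "finite (smp_ge s)" "finite (smp_gt s)"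
  by (auto simp: smp_ge_def smp_gt_def)

lemma nn_pos: "0 < real (n * (n - 1))" "0 < real n"
  using n2 by auto

lemma valid_back: "valid x \<Longrightarrow> b \<in> moran_pairs n \<Longrightarrow> valid (\<lambda>i. back_step b (x i))"
  by (auto simp: valid_def back_step_def moran_pairs_def)

lemma valid_slot_upd: "valid x \<Longrightarrow> y < n \<Longrightarrow> valid (slot_upd s y x)"
  by (auto simp: valid_def slot_upd_def)

lemma avg_unit:
  fixes f :: "'a \<Rightarrow> real"
  assumes "\<And>a. a \<in> A \<Longrightarrow> 0 \<le> f a \<and> f a \<le> 1" "card A = m" "0 < m"
  shows "0 \<le> sum f A / real m \<and> sum f A / real m \<le> 1"
proof -
  have "sum f A \<le> (\<Sum>a\<in>A. 1)" by (intro sum_mono) (use assms in auto)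
  then show ?thesis using assms by (auto simp: field_simps intro!: sum_nonneg)
qed

lemma unit_bdd_event_avg: "unit_bdd f \<Longrightarrow> unit_bdd (event_avg f)"
  unfolding unit_bdd_def event_avg_def
  using avg_unit[of "moran_pairs n" _ "n * (n - 1)"] n2 valid_back card_moran_pairs[of n] nn_pos
  by auto

lemma unit_bdd_event_avg_pow: "unit_bdd f \<Longrightarrow> unit_bdd ((event_avg ^^ c) f)"
  by (induction c) (auto intro: unit_bdd_event_avg)

lemma unit_bdd_sample_avg: "unit_bdd f \<Longrightarrow> unit_bdd (sample_avg s f)"
  unfolding unit_bdd_def sample_avg_def
  using avg_unit[of "{..<n}" _ n] n2 valid_slot_upd by auto

lemma integrable_event_avg_pow:
  assumes "unit_bdd f" "valid x"
  shows "integrable (measure_pmf p) (\<lambda>c. (event_avg ^^ c) f x)"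
  by (rule measure_pmf.integrable_const_bound[of _ 1])
     (use unit_bdd_event_avg_pow[OF assms(1)] assms(2) in \<open>auto simp: unit_bdd_def\<close>)

lemma unit_bdd_poisson_avg: "unit_bdd f \<Longrightarrow> unit_bdd (poisson_avg r f)"
  unfolding poisson_avg_def
  by (subst unit_bdd_def, intro allI impI conjI integral_nonneg
        measure_pmf.integral_le_const integrable_event_avg_pow)
     (use unit_bdd_event_avg_pow in \<open>auto simp: unit_bdd_def\<close>)

lemma poisson_avg_approx:
  assumes f: "unit_bdd f" and x: "valid x" and r: "0 < r"
  shows "\<bar>poisson_avg r f x - exp (-r) * (f x + r * event_avg f x)\<bar> \<le> r\<^sup>2"
proof -
  let ?p = "poisson_pmf r"
  let ?g = "\<lambda>c. (event_avg ^^ c) f x"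
  have g: "0 \<le> ?g c" "?g c \<le> 1" for c
    using unit_bdd_event_avg_pow[OF f, of c] x by (auto simp: unit_bdd_def)
  have int: "integrable (measure_pmf ?p) (\<lambda>c. ?g c * indicator A c)" for A
    by (rule measure_pmf.integrable_const_bound[of _ 1])
       (use g in \<open>auto simp: indicator_def\<close>)
  have inti: "integrable (measure_pmf ?p) (\<lambda>c. indicator A c :: real)" for A
    by (rule measure_pmf.integrable_const_bound[of _ 1]) (auto simp: indicator_def)
  have single: "measure_pmf.expectation ?p (\<lambda>c. ?g c * indicator {j} c) = ?g j * pmf ?p j" for j
    by (subst integral_measure_pmf[of "{j}"]) (auto simp: indicator_def)
  have "poisson_avg r f x = measure_pmf.expectation ?p
      (\<lambda>c. ?g c * indicator {0} c + (?g c * indicator {1} c + ?g c * indicator {2..} c))"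
    unfolding poisson_avg_def
    by (intro Bochner_Integration.integral_cong refl)
       (auto simp: indicator_def not_le less_2_cases_iff)
  also have "\<dots> = ?g 0 * pmf ?p 0 + (?g 1 * pmf ?p 1
       + measure_pmf.expectation ?p (\<lambda>c. ?g c * indicator {2..} c))"
    by (simp only: Bochner_Integration.integral_add[OF int Bochner_Integration.integrable_add[OF int int]]
          Bochner_Integration.integral_add[OF int int] single)
  finally have eq: "poisson_avg r f x = exp (-r) * (f x + r * event_avg f x)
       + measure_pmf.expectation ?p (\<lambda>c. ?g c * indicator {2..} c)" (is "_ = _ + ?rest")
    using r by (simp add: algebra_simps)
  have "?rest \<le> measure_pmf.expectation ?p (\<lambda>c. indicator {2..} c)"
    by (rule integral_mono[OF int inti]) (use g in \<open>auto simp: indicator_def\<close>)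
  also have "\<dots> = measure_pmf.prob ?p {2..}" by simp
  also have "\<dots> = measure_pmf.prob ?p (UNIV - {0,1})" by (rule arg_cong[where f = "measure_pmf.prob ?p"]) auto
  also have "\<dots> = 1 - measure_pmf.prob ?p {0,1}"
    using measure_pmf.prob_compl[of "{0,1}" ?p] by simp
  also have "measure_pmf.prob ?p {0,1} = exp (-r) * (1 + r)"
    using r by (simp add: measure_measure_pmf_finite algebra_simps)
  also have "1 - exp (-r) * (1 + r) \<le> r\<^sup>2"
  proof -
    have "(1 - r) * (1 + r) \<le> exp (-r) * (1 + r)"
      using exp_ge_add_one_self[of "-r"] r by (intro mult_right_mono) auto
    then show ?thesis by (simp add: algebra_simps power2_eq_square)
  qed
  finally have "?rest \<le> r\<^sup>2" .
  moreover have "0 \<le> ?rest" by (rule Bochner_Integration.integral_nonneg) (use g in auto)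
  ultimately show ?thesis using eq by simp
qed

lemma same_kernel_perm:
  assumes "valid x" "valid y" "same_kernel A x y"
  obtains \<pi> where "bij_betw \<pi> {..<n} {..<n}" "\<And>i. i \<in> A \<Longrightarrow> y i = \<pi> (x i)"
proof -
  define h where "h v = y (SOME i. i \<in> A \<and> x i = v)" for v
  have h: "h (x i) = y i" if "i \<in> A" for i
  proof -
    have "\<exists>j. j \<in> A \<and> x j = x i" using that by blast
    from someI_ex[OF this] show ?thesis
      using that assms(3) unfolding h_def same_kernel_def by metis
  qed
  have "bij_betw h (x ` A) (y ` A)"
    unfolding bij_betw_def
  proof
    show "inj_on h (x ` A)"
      using assms(3) h unfolding same_kernel_def inj_on_def by (metis (no_types, lifting) imageE)
    show "h ` x ` A = y ` A" using h by (auto simp: image_image)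
  qed
  from bij_extend_finite[of "{..<n}", OF _ _ _ this]
  obtain g where g: "bij_betw g {..<n} {..<n}" "\<forall>b\<in>x ` A. g b = h b"
    using assms(1,2) by (auto simp: valid_def)
  with h show ?thesis by (intro that[of g]) auto
qed

lemma kernel_inv_event_avg:
  assumes "kernel_inv A f"
  shows "kernel_inv A (event_avg f)"
  unfolding kernel_inv_def
proof (intro allI impI)
  fix x y assume x: "valid x" and y: "valid y" and e: "same_kernel A x y"
  from same_kernel_perm[OF x y e] obtain p where p: "bij_betw p {..<n} {..<n}"
    and px: "\<And>i. i \<in> A \<Longrightarrow> y i = p (x i)" by blast
  have pinj: "p a = p b \<longleftrightarrow> a = b" if "a < n" "b < n" for a b
    using p that by (auto simp: bij_betw_def inj_on_def)
  have pran: "p a < n" if "a < n" for a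
    using p that by (auto simp: bij_betw_def)
  have bij: "bij_betw (map_prod p p) (moran_pairs n) (moran_pairs n)"
  proof (rule bij_betwI')
    fix a b assume "a \<in> moran_pairs n" "b \<in> moran_pairs n"
    then show "(map_prod p p a = map_prod p p b) = (a = b)"
      by (auto simp: moran_pairs_def pinj)
  next
    fix a assume "a \<in> moran_pairs n"
    then show "map_prod p p a \<in> moran_pairs n" by (auto simp: moran_pairs_def pinj pran)
  next
    fix c assume c: "c \<in> moran_pairs n"
    then obtain u v where "c = (u, v)" "u < n" "v < n" "u \<noteq> v" by (auto simp: moran_pairs_def)
    moreover have "\<exists>u'<n. u = p u'" "\<exists>v'<n. v = p v'"
      using p calculation by (auto simp: bij_betw_def set_eq_iff image_iff)
    ultimately show "\<exists>a\<in>moran_pairs n. c = map_prod p p a" by (force simp: moran_pairs_def)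
  qed
  have "(\<Sum>b\<in>moran_pairs n. f (\<lambda>i. back_step b (y i)))
      = (\<Sum>b\<in>moran_pairs n. f (\<lambda>i. back_step (map_prod p p b) (y i)))"
    by (rule sum.reindex_bij_betw[OF bij, symmetric])
  also have "\<dots> = (\<Sum>b\<in>moran_pairs n. f (\<lambda>i. back_step b (x i)))"
  proof (rule sum.cong[OF refl])
    fix b assume b: "b \<in> moran_pairs n"
    have lt: "back_step b (x i) < n" for i using valid_back[OF x b] by (simp add: valid_def)
    have "fst b < n" using b by (auto simp: moran_pairs_def)
    then have key: "back_step (map_prod p p b) (y i) = p (back_step b (x i))" if "i \<in> A" for i
      using px[OF that] x pinj by (auto simp: back_step_def valid_def)
    have "map_prod p p b \<in> moran_pairs n" using bij b by (auto simp: bij_betw_def)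
    then have "valid (\<lambda>i. back_step (map_prod p p b) (y i))" by (intro valid_back y)
    moreover have "same_kernel A (\<lambda>i. back_step (map_prod p p b) (y i)) (\<lambda>i. back_step b (x i))"
      unfolding same_kernel_def using key lt pinj by metis
    ultimately show "f (\<lambda>i. back_step (map_prod p p b) (y i)) = f (\<lambda>i. back_step b (x i))"
      using assms valid_back[OF x b] unfolding kernel_inv_def by blast
  qed
  finally show "event_avg f x = event_avg f y" by (simp add: event_avg_def)
qed

lemma kernel_inv_event_avg_pow: "kernel_inv A f \<Longrightarrow> kernel_inv A ((event_avg ^^ c) f)"
  by (induction c) (auto intro: kernel_inv_event_avg)

lemma kernel_inv_poisson_avg: "kernel_inv A f \<Longrightarrow> kernel_inv A (poisson_avg r f)"
proof -
  assume "kernel_inv A f"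
  then have "(event_avg ^^ c) f x = (event_avg ^^ c) f y" if "valid x" "valid y" "same_kernel A x y" for c x y
    using kernel_inv_event_avg_pow[of A f c] that unfolding kernel_inv_def by blast
  then show ?thesis unfolding kernel_inv_def poisson_avg_def by simp
qed

lemma smp_ge_eq_smp_gt_Un: "smp_ge s = smp_gt s \<union> {i \<in> {1..k}. t i = s}"
  by (auto simp: smp_ge_def smp_gt_def)

lemma kernel_inv_sample_avg:
  assumes f: "kernel_inv (smp_ge s) f"
  shows "kernel_inv (smp_gt s) (sample_avg s f)"
  unfolding kernel_inv_def
proof (intro allI impI)
  fix x y assume x: "valid x" and y: "valid y" and e: "same_kernel (smp_gt s) x y"
  from same_kernel_perm[OF x y e] obtain p where p: "bij_betw p {..<n} {..<n}"
    and px: "\<And>i. i \<in> smp_gt s \<Longrightarrow> y i = p (x i)" by blast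
  have pinj: "p a = p b \<longleftrightarrow> a = b" if "a < n" "b < n" for a b
    using p that by (auto simp: bij_betw_def inj_on_def)
  have pran: "p a < n" if "a < n" for a
    using p that by (auto simp: bij_betw_def)
  have "(\<Sum>v<n. f (slot_upd s v y)) = (\<Sum>v<n. f (slot_upd s (p v) y))"
    by (rule sum.reindex_bij_betw[OF p, symmetric])
  also have "\<dots> = (\<Sum>v<n. f (slot_upd s v x))"
  proof (rule sum.cong[OF refl])
    fix v assume v: "v \<in> {..<n}"
    have lt: "slot_upd s v x i < n" for i using valid_slot_upd[OF x] v by (auto simp: valid_def)
    have key: "slot_upd s (p v) y i = p (slot_upd s v x i)" if "i \<in> smp_ge s" for i
      using that px by (auto simp: slot_upd_def smp_ge_eq_smp_gt_Un smp_gt_def)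
    have "same_kernel (smp_ge s) (slot_upd s (p v) y) (slot_upd s v x)"
      unfolding same_kernel_def using key lt pinj by metis
    then show "f (slot_upd s (p v) y) = f (slot_upd s v x)"
      using f v pran valid_slot_upd[OF x, of v s] valid_slot_upd[OF y, of "p v" s] unfolding kernel_inv_def by auto
  qed
  finally show "sample_avg s f x = sample_avg s f y" by (simp add: sample_avg_def)
qed

definition rate :: real where "rate = 2 * mu / real (n * (n - 1))"

definition separate :: "real \<Rightarrow> (nat \<Rightarrow> nat) \<Rightarrow> bool" where
  "separate s x \<longleftrightarrow> x (Suc k) \<notin> x ` smp_ge s"

text \<open>The events that merge \<open>q\<close> with a lineage of \<open>A\<close> are the \<open>2 M\<close> ordered pairs made of the slot of \<open>q\<close>
  and one of the \<open>M\<close> slots occupied by \<open>A\<close>; they leave the partition of \<open>A\<close> unchanged.\<close>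

lemma event_avg_compare:
  assumes F: "\<And>x. valid x \<Longrightarrow> x q \<in> x ` A \<Longrightarrow> F x = 0"
    and FH: "\<And>x. valid x \<Longrightarrow> x q \<notin> x ` A \<Longrightarrow> \<bar>F x - H x\<bar> \<le> e"
    and H: "kernel_inv A H" and A: "finite A" "q \<notin> A"
    and x: "valid x" "x q \<notin> x ` A"
  shows "\<bar>event_avg F x - (event_avg H x - 2 * real (card (x ` A)) / real (n * (n - 1)) * H x)\<bar> \<le> e"
proof -
  define Bad where "Bad = {x q} \<times> x ` A \<union> x ` A \<times> {x q}"
  let ?S = "\<lambda>b i. back_step b (x i)"
  have ne: "x i \<noteq> x q" if "i \<in> A" for i using x(2) that by (metis imageI)
  have Bad: "Bad \<subseteq> moran_pairs n" using x ne by (auto simp: Bad_def moran_pairs_def valid_def)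
  have cB: "card Bad = 2 * card (x ` A)" unfolding Bad_def
    using x A by (subst card_Un_disjoint) (auto simp: card_cartesian_product)
  have fB: "finite Bad" using A by (auto simp: Bad_def)
  have e0: "0 \<le> e" using FH[OF x] by linarith
  have bad: "F (?S b) = 0" "H (?S b) = H x" if "b \<in> Bad" for b
  proof -
    have bm: "b \<in> moran_pairs n" using that Bad by auto
    have "?S b q \<in> ?S b ` A"
      using that x unfolding Bad_def by (auto simp: back_step_def image_iff)
    then show "F (?S b) = 0" by (intro F valid_back x bm)
    have "same_kernel A (?S b) x"
      using that x unfolding Bad_def same_kernel_def by (auto simp: back_step_def image_iff)
    then show "H (?S b) = H x" using H valid_back[OF x(1) bm] x unfolding kernel_inv_def by blast
  qed
  have good: "\<bar>F (?S b) - H (?S b)\<bar> \<le> e" if "b \<in> moran_pairs n - Bad" for b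
  proof (intro FH valid_back x)
    show bm: "b \<in> moran_pairs n" using that by simp
    show "?S b q \<notin> ?S b ` A"
      using that x bm unfolding Bad_def
      by (cases b) (auto simp: back_step_def image_iff moran_pairs_def split: if_splits)
  qed
  have sF: "(\<Sum>b\<in>moran_pairs n. F (?S b)) = (\<Sum>b\<in>moran_pairs n - Bad. F (?S b))"
    using bad Bad by (intro sum.mono_neutral_right) auto
  have sH: "(\<Sum>b\<in>moran_pairs n. H (?S b))
      = (\<Sum>b\<in>moran_pairs n - Bad. H (?S b)) + 2 * real (card (x ` A)) * H x"
    using bad cB by (subst sum.subset_diff[OF Bad]) auto
  have "\<bar>(\<Sum>b\<in>moran_pairs n - Bad. F (?S b)) - (\<Sum>b\<in>moran_pairs n - Bad. H (?S b))\<bar>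
      \<le> real (card (moran_pairs n - Bad)) * e"
    by (rule abs_sum_diff_le) (use good in auto)
  also have "\<dots> \<le> real (n * (n - 1)) * e"
    using e0 card_mono[of "moran_pairs n" "moran_pairs n - Bad"] unfolding card_moran_pairs
    by (intro mult_right_mono) (auto simp del: of_nat_mult)
  finally have le: "\<bar>(\<Sum>b\<in>moran_pairs n. F (?S b))
      - ((\<Sum>b\<in>moran_pairs n. H (?S b)) - 2 * real (card (x ` A)) * H x)\<bar> \<le> real (n * (n - 1)) * e"
    using sF sH by simp
  have "event_avg F x - (event_avg H x - 2 * real (card (x ` A)) / real (n * (n - 1)) * H x)
     = ((\<Sum>b\<in>moran_pairs n. F (?S b))
      - ((\<Sum>b\<in>moran_pairs n. H (?S b)) - 2 * real (card (x ` A)) * H x)) / real (n * (n - 1))"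
    unfolding event_avg_def by (simp add: diff_divide_distrib del: of_nat_mult)
  then show ?thesis using le nn_pos by (simp add: abs_divide divide_le_eq mult.commute del: of_nat_mult)
qed

lemma poisson_avg_compare:
  assumes F: "\<And>x. valid x \<Longrightarrow> x q \<in> x ` A \<Longrightarrow> F x = 0"
    and FH: "\<And>x. valid x \<Longrightarrow> x q \<notin> x ` A \<Longrightarrow> \<bar>F x - H x\<bar> \<le> e"
    and H: "kernel_inv A H" and A: "finite A" "q \<notin> A"
    and x: "valid x" "x q \<notin> x ` A" and bdd: "unit_bdd F" "unit_bdd H" and d: "0 < d"
  shows "\<bar>poisson_avg (mu * d) F x - exp (- (rate * d * real (card (x ` A)))) * poisson_avg (mu * d) H x\<bar>
          \<le> e + 4 * mu\<^sup>2 * d\<^sup>2"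
proof -
  define r where "r = mu * d"
  define M where "M = real (card (x ` A))"
  define z where "z = rate * d * M"
  have r0: "0 \<le> r" and r1: "0 < r" using d mu_pos by (simp_all add: r_def)
  have M0: "0 \<le> M" by (simp add: M_def)
  have "x i \<noteq> x q" if "i \<in> A" for i using x(2) that by (metis imageI)
  then have "x ` A \<subseteq> {..<n} - {x q}" using x by (auto simp: valid_def)
  then have "card (x ` A) \<le> n - 1"
    using card_mono[of "{..<n} - {x q}" "x ` A"] x by (simp add: valid_def)
  then have Mn: "M \<le> real (n - 1)" by (simp add: M_def)
  have z0: "0 \<le> z" using d mu_pos M0 by (simp add: z_def rate_def)
  have zr: "z \<le> r"
  proof -
    have "z = r * (2 * M / real (n * (n - 1)))" by (simp add: z_def r_def rate_def)
    also have "2 * M \<le> real (n * (n - 1))"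
      using mult_mono[of 2 "real n" M "real (n - 1)"] n2 Mn M0 by (simp del: of_nat_diff)
    then have "r * (2 * M / real (n * (n - 1))) \<le> r * 1"
      using nn_pos by (intro mult_left_mono r0) (simp add: divide_le_eq del: of_nat_mult)
    finally show ?thesis by simp
  qed
  have e0: "0 \<le> e" using FH[OF x] by linarith
  have H01: "0 \<le> H x" "H x \<le> 1" and BH: "0 \<le> event_avg H x" "event_avg H x \<le> 1"
    using bdd(2) unit_bdd_event_avg[OF bdd(2)] x by (auto simp: unit_bdd_def)
  have rz: "r * (2 * M / real (n * (n - 1))) = z" by (simp add: z_def r_def rate_def)
  have "\<bar>event_avg F x - (event_avg H x - 2 * M / real (n * (n - 1)) * H x)\<bar> \<le> e"
    unfolding M_def by (rule event_avg_compare[OF F FH H A x])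
  then have "r * \<bar>event_avg F x - (event_avg H x - 2 * M / real (n * (n - 1)) * H x)\<bar> \<le> r * e"
    using r0 by (rule mult_left_mono)
  moreover have "r * (event_avg F x - (event_avg H x - 2 * M / real (n * (n - 1)) * H x))
      = r * event_avg F x - (r * event_avg H x - z * H x)"
    unfolding rz[symmetric] by (simp add: algebra_simps)
  ultimately have b1: "\<bar>r * event_avg F x - (r * event_avg H x - z * H x)\<bar> \<le> r * e"
    using r0 by (metis abs_mult abs_of_nonneg)
  have b2: "\<bar>F x - H x\<bar> \<le> e" using FH[OF x] .
  have "\<bar>(F x + r * event_avg F x) - (H x + r * event_avg H x - z * H x)\<bar> \<le> (1 + r) * e"
    using b1 b2 by (simp add: algebra_simps)
  then have "exp (-r) * \<bar>(F x + r * event_avg F x) - (H x + r * event_avg H x - z * H x)\<bar>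
      \<le> exp (-r) * ((1 + r) * e)" by (intro mult_left_mono) auto
  also have "exp (-r) * ((1 + r) * e) \<le> e"
  proof -
    have "exp (-r) * (1 + r) \<le> exp (-r) * exp r"
      using exp_ge_add_one_self[of r] by (intro mult_left_mono) auto
    then have "exp (-r) * (1 + r) \<le> 1" by (simp add: exp_minus)
    then show ?thesis using mult_right_mono[OF _ e0, of "exp (-r) * (1 + r)" 1] by (simp add: mult.assoc)
  qed
  finally have c1: "\<bar>exp (-r) * (F x + r * event_avg F x) - exp (-r) * (H x + r * event_avg H x - z * H x)\<bar> \<le> e"
    by (simp add: abs_mult flip: right_diff_distrib)
  have ez: "1 - z \<le> exp (-z)" using exp_ge_add_one_self[of "-z"] by simp
  have ez2: "exp (-z) \<le> 1 - z + z\<^sup>2"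
  proof (cases "z \<le> 1")
    case True
    have "exp (-z) * (1 + z) \<le> 1"
      using mult_left_mono[OF exp_ge_add_one_self[of z], of "exp (-z)"] by (simp add: exp_minus)
    then have "exp (-z) \<le> 1 / (1 + z)" using z0 by (simp add: field_simps)
    also have "1 \<le> (1 - z + z\<^sup>2) * (1 + z)" using z0 by (simp add: algebra_simps power2_eq_square)
    then have "1 / (1 + z) \<le> 1 - z + z\<^sup>2" using z0 by (simp add: divide_le_eq)
    finally show ?thesis .
  next
    case False
    then have "z * 1 \<le> z * z" by (intro mult_left_mono) auto
    then have "1 \<le> 1 - z + z\<^sup>2" by (simp add: power2_eq_square)
    moreover have "exp (-z) \<le> 1" using z0 by simp
    ultimately show ?thesis by linarith
  qed
  have "\<bar>(H x + r * event_avg H x - z * H x) - exp (-z) * (H x + r * event_avg H x)\<bar>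
      = \<bar>(1 - exp (-z)) * (r * event_avg H x) - (exp (-z) - (1 - z)) * H x\<bar>"
    by (simp add: algebra_simps)
  also have "\<dots> \<le> r\<^sup>2 + r\<^sup>2"
  proof -
    have p1: "0 \<le> (1 - exp (-z)) * (r * event_avg H x)" using z0 r0 BH by simp
    have "(1 - exp (-z)) * (r * event_avg H x) \<le> r * (r * 1)"
      using ez zr z0 r0 BH by (intro mult_mono mult_left_mono) auto
    then have p2: "(1 - exp (-z)) * (r * event_avg H x) \<le> r\<^sup>2" by (simp add: power2_eq_square)
    have q1: "0 \<le> (exp (-z) - (1 - z)) * H x" using ez H01 by simp
    have "(exp (-z) - (1 - z)) * H x \<le> z\<^sup>2 * 1"
      using ez2 H01 by (intro mult_mono) auto
    also have "z\<^sup>2 \<le> r\<^sup>2" using zr z0 by (intro power_mono) auto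
    finally have q2: "(exp (-z) - (1 - z)) * H x \<le> r\<^sup>2" by simp
    show ?thesis using p1 p2 q1 q2 by linarith
  qed
  finally have "exp (-r) * \<bar>(H x + r * event_avg H x - z * H x) - exp (-z) * (H x + r * event_avg H x)\<bar> \<le> 1 * (r\<^sup>2 + r\<^sup>2)"
    using r0 by (intro mult_mono) auto
  then have c2: "\<bar>exp (-r) * (H x + r * event_avg H x - z * H x) - exp (-z) * (exp (-r) * (H x + r * event_avg H x))\<bar> \<le> 2 * r\<^sup>2"
  proof -
    have "exp (-r) * (H x + r * event_avg H x - z * H x) - exp (-z) * (exp (-r) * (H x + r * event_avg H x))
      = exp (-r) * ((H x + r * event_avg H x - z * H x) - exp (-z) * (H x + r * event_avg H x))"
      by (simp add: algebra_simps)
    moreover assume "exp (-r) * \<bar>(H x + r * event_avg H x - z * H x) - exp (-z) * (H x + r * event_avg H x)\<bar> \<le> 1 * (r\<^sup>2 + r\<^sup>2)"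
    ultimately show ?thesis by (simp add: abs_mult)
  qed
  have "\<bar>poisson_avg r H x - exp (-r) * (H x + r * event_avg H x)\<bar> \<le> r\<^sup>2"
    by (rule poisson_avg_approx[OF bdd(2) x(1) r1])
  then have "exp (-z) * \<bar>poisson_avg r H x - exp (-r) * (H x + r * event_avg H x)\<bar> \<le> 1 * r\<^sup>2"
    using z0 by (intro mult_mono) auto
  then have c3: "\<bar>exp (-z) * poisson_avg r H x - exp (-z) * (exp (-r) * (H x + r * event_avg H x))\<bar> \<le> r\<^sup>2"
    by (simp add: abs_mult flip: right_diff_distrib)
  have c4: "\<bar>poisson_avg r F x - exp (-r) * (F x + r * event_avg F x)\<bar> \<le> r\<^sup>2"
    by (rule poisson_avg_approx[OF bdd(1) x(1) r1])
  have "\<bar>poisson_avg r F x - exp (-z) * poisson_avg r H x\<bar> \<le> e + 4 * r\<^sup>2"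
    using c1 c2 c3 c4 by linarith
  then show ?thesis by (simp add: r_def z_def M_def power_mult_distrib)
qed

text \<open>Grids are listed backwards in time. \<open>G s s'\<close> weighs the configuration held from \<open>s\<close> down to the next
  grid time \<open>s'\<close>, and \<open>C s\<close> the configuration right after the sample at \<open>s\<close> has been added.\<close>

fun chain_val :: "(real \<Rightarrow> real \<Rightarrow> (nat \<Rightarrow> nat) \<Rightarrow> real) \<Rightarrow> (real \<Rightarrow> (nat \<Rightarrow> nat) \<Rightarrow> real)
    \<Rightarrow> real list \<Rightarrow> (nat \<Rightarrow> nat) \<Rightarrow> real" where
  "chain_val G C [] x = 1"
| "chain_val G C [s] x = G s s x"
| "chain_val G C (s # s' # ts) x
    = G s s' x * poisson_avg (mu * (s - s')) (sample_avg s' (\<lambda>x. C s' x * chain_val G C (s' # ts) x)) x"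

lemma chain_val_fun: "chain_val G C [] = (\<lambda>_. 1)" "chain_val G C [s] = G s s"
  by auto

text \<open>\<open>sep_weight\<close> is the indicator that sample \<open>k + 1\<close> has met no other sample; \<open>kill_weight\<close> and
  \<open>live_weight\<close> are its conditional probability given the partition of the first \<open>k\<close> samples.\<close>

definition sep_weight :: "(real \<Rightarrow> (nat \<Rightarrow> nat) \<Rightarrow> real) \<Rightarrow> real \<Rightarrow> real \<Rightarrow> real \<Rightarrow> (nat \<Rightarrow> nat) \<Rightarrow> real" where
  "sep_weight g a s s' x = g s x * (if a \<le> s then of_bool (separate s x) else 1)"

definition kill_weight :: "(real \<Rightarrow> (nat \<Rightarrow> nat) \<Rightarrow> real) \<Rightarrow> real \<Rightarrow> real \<Rightarrow> real \<Rightarrow> (nat \<Rightarrow> nat) \<Rightarrow> real" where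
  "kill_weight g a s s' x = g s x * (if a < s then exp (- (rate * (s - s') * real (card (x ` smp_ge s)))) else 1)"

text \<open>\<open>x ` smp_ge s \<noteq> x ` smp_gt s\<close> says that some sample is taken at time \<open>s\<close> and that it is live.\<close>

definition live_weight :: "real \<Rightarrow> real \<Rightarrow> (nat \<Rightarrow> nat) \<Rightarrow> real" where
  "live_weight a s x = (if a \<le> s \<and> x ` smp_ge s \<noteq> x ` smp_gt s
     then (real n - real (card (x ` smp_gt s)) - 1) / (real n - real (card (x ` smp_gt s))) else 1)"

abbreviation no_weight :: "real \<Rightarrow> (nat \<Rightarrow> nat) \<Rightarrow> real" where "no_weight \<equiv> \<lambda>_ _. 1"

definition grid :: "real list \<Rightarrow> bool" where
  "grid ts \<longleftrightarrow> ts \<noteq> [] \<and> sorted_wrt (>) ts \<and> (\<forall>i\<in>{1..Suc k}. t i \<in> set ts \<or> hd ts < t i)"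

definition invariant_test :: "(real \<Rightarrow> (nat \<Rightarrow> nat) \<Rightarrow> real) \<Rightarrow> bool" where
  "invariant_test g \<longleftrightarrow> (\<forall>s. kernel_inv (smp_ge s) (g s) \<and> unit_bdd (g s))"

lemma grid_ConsD:
  assumes "grid (s # s' # ts)"
  shows "grid (s' # ts)" "s' < s" "smp_gt s' = smp_ge s"
proof -
  show "grid (s' # ts)" using assms by (force simp: grid_def)
  show *: "s' < s" using assms by (auto simp: grid_def)
  have "s \<le> t i" if "i \<in> {1..k}" "s' < t i" for i
  proof -
    have "t i \<in> set (s # s' # ts) \<or> s < t i" using assms that by (auto simp: grid_def)
    moreover have "u < s'" if "u \<in> set ts" for u using assms that by (auto simp: grid_def)
    ultimately show ?thesis using that by force
  qed
  then show "smp_gt s' = smp_ge s" using * by (force simp: smp_ge_def smp_gt_def)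
qed

lemma card_image_smp_ge: "x (Suc k) \<notin> x ` A \<Longrightarrow> valid x \<Longrightarrow> finite A \<Longrightarrow> card (x ` A) < n"
proof -
  assume a: "x (Suc k) \<notin> x ` A" "valid x" "finite A"
  have "x ` A \<subset> {..<n}" using a by (auto simp: valid_def)
  then show ?thesis using psubset_card_mono[of "{..<n}"] by simp
qed

lemma kernel_inv_mult: "kernel_inv A f \<Longrightarrow> kernel_inv A h \<Longrightarrow> kernel_inv A (\<lambda>x. f x * h x)"
  unfolding kernel_inv_def by metis

lemma unit_bdd_mult: "unit_bdd f \<Longrightarrow> unit_bdd h \<Longrightarrow> unit_bdd (\<lambda>x. f x * h x)"
  unfolding unit_bdd_def by (auto simp: mult_le_one)

lemma same_kernel_card: 
  assumes "same_kernel A x y" "finite A" shows "card (x ` A) = card (y ` A)"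
proof -
  define h where "h v = y (SOME i. i \<in> A \<and> x i = v)" for v
  have h: "h (x i) = y i" if "i \<in> A" for i
  proof -
    have "\<exists>j. j \<in> A \<and> x j = x i" using that by blast
    from someI_ex[OF this] show ?thesis
      using that assms(1) unfolding h_def same_kernel_def by metis
  qed
  have "bij_betw h (x ` A) (y ` A)"
    unfolding bij_betw_def
  proof
    show "inj_on h (x ` A)"
      using assms(1) h unfolding same_kernel_def inj_on_def by (metis (no_types, lifting) imageE)
    show "h ` x ` A = y ` A" using h by (auto simp: image_image)
  qed
  then show ?thesis by (rule bij_betw_same_card)
qed

lemma same_kernel_mono: "same_kernel A x y \<Longrightarrow> B \<subseteq> A \<Longrightarrow> same_kernel B x y"
  unfolding same_kernel_def by blast

lemma kernel_inv_live_weight: "kernel_inv (smp_ge s) (live_weight a s)"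
  unfolding kernel_inv_def
proof (intro allI impI)
  fix x y assume e: "same_kernel (smp_ge s) x y"
  have sub: "smp_gt s \<subseteq> smp_ge s" by (auto simp: smp_ge_eq_smp_gt_Un)
  have c: "card (x ` smp_gt s) = card (y ` smp_gt s)"
    by (intro same_kernel_card same_kernel_mono[OF e sub]) simp
  have imp: "v ` smp_ge s = v ` smp_gt s \<longleftrightarrow> (\<forall>i\<in>smp_ge s. \<exists>j\<in>smp_gt s. v i = v j)" for v :: "nat \<Rightarrow> nat"
    using sub by (auto simp: set_eq_iff image_iff)
  have "(x ` smp_ge s = x ` smp_gt s) = (y ` smp_ge s = y ` smp_gt s)"
    unfolding imp using e sub unfolding same_kernel_def by blast
  with c show "live_weight a s x = live_weight a s y" by (simp add: live_weight_def)
qed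

lemma unit_bdd_live_weight: "unit_bdd (live_weight a s)"
  unfolding unit_bdd_def
proof (intro allI impI)
  fix x assume v: "valid x"
  show "0 \<le> live_weight a s x \<and> live_weight a s x \<le> 1"
  proof (cases "x ` smp_ge s = x ` smp_gt s")
    case False
    have "x ` smp_gt s \<subset> {..<n}" using False v by (auto simp: smp_ge_eq_smp_gt_Un valid_def)
    then have "card (x ` smp_gt s) < n" using psubset_card_mono[of "{..<n}"] by simp
    then show ?thesis by (auto simp: live_weight_def divide_le_eq_1)
  qed (auto simp: live_weight_def)
qed

lemma invariant_test_sep_weight: "invariant_test g \<Longrightarrow> unit_bdd (sep_weight g a s s')"
  unfolding invariant_test_def sep_weight_def unit_bdd_def by auto

lemma rate_pos: "0 < rate"
  using mu_pos nn_pos by (simp add: rate_def)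

lemma invariant_test_kill_weight: assumes "invariant_test g" "s' \<le> s"
  shows "unit_bdd (kill_weight g a s s')" "kernel_inv (smp_ge s) (kill_weight g a s s')"
proof -
  show "unit_bdd (kill_weight g a s s')" unfolding kill_weight_def
    by (intro unit_bdd_mult) (use assms rate_pos in \<open>auto simp: invariant_test_def unit_bdd_def\<close>)
  show "kernel_inv (smp_ge s) (kill_weight g a s s')" unfolding kill_weight_def
    by (intro kernel_inv_mult) (use assms same_kernel_card[OF _ finite_smp_ge(1)] in \<open>auto simp: invariant_test_def kernel_inv_def\<close>)
qed

lemma unit_bdd_one: "unit_bdd (\<lambda>_. 1)" by (auto simp: unit_bdd_def)

lemma unit_bdd_chain_val:
  assumes "\<And>s s'. s' \<le> s \<Longrightarrow> unit_bdd (G s s')" "\<And>s. unit_bdd (C s)" "sorted_wrt (>) ts"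
  shows "unit_bdd (chain_val G C ts)"
  using assms(3)
proof (induction ts rule: induct_list012)
  case (3 s s' ts)
  show ?case unfolding chain_val.simps
    by (intro unit_bdd_mult unit_bdd_poisson_avg unit_bdd_sample_avg assms) (use 3 assms in auto)
qed (use assms(1,2) in \<open>auto simp: unit_bdd_one chain_val_fun simp del: chain_val.simps\<close>)

lemma kernel_inv_VR:
  assumes "invariant_test g" "grid ts"
  shows "kernel_inv (smp_ge (hd ts)) (chain_val (kill_weight g a) (live_weight a) ts)"
  using assms(2)
proof (induction ts rule: induct_list012)
  case (3 s s' ts)
  note D = grid_ConsD[OF 3(3)]
  have "kernel_inv (smp_ge s') (chain_val (kill_weight g a) (live_weight a) (s' # ts))" using 3(2) D(1) by simp
  then have "kernel_inv (smp_ge s) (sample_avg s' (\<lambda>x. live_weight a s' x * chain_val (kill_weight g a) (live_weight a) (s' # ts) x))"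
    unfolding D(3)[symmetric] by (intro kernel_inv_sample_avg kernel_inv_mult kernel_inv_live_weight)
  then show ?case using invariant_test_kill_weight[OF assms(1), of s' s] D(2)
    unfolding chain_val.simps list.sel by (intro kernel_inv_mult kernel_inv_poisson_avg) auto
qed (use invariant_test_kill_weight[OF assms(1)] in \<open>auto simp: grid_def chain_val_fun simp del: chain_val.simps\<close>)

lemma chain_val_cong:
  assumes "grid ts" "\<And>s s' x. s \<in> set ts \<Longrightarrow> G s s' x = G' s s' x" "\<And>s x. s \<in> set (tl ts) \<Longrightarrow> C s x = C' s x"
  shows "chain_val G C ts = chain_val G' C' ts"
  using assms
proof (induction ts rule: induct_list012)
  case (3 s s' ts)
  have "chain_val G C (s' # ts) = chain_val G' C' (s' # ts)"
    by (rule 3(2)) (use 3 grid_ConsD[OF 3(3)] in auto)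
  moreover have "C s' = C' s'" using 3(5)[of s'] by auto
  ultimately show ?case using 3(4)[of s] by (intro ext) auto
qed auto

lemma sample_avg_compare:
  assumes h: "kernel_inv (smp_ge s) h"
    and f0: "\<And>x. valid x \<Longrightarrow> \<not> separate s x \<Longrightarrow> f x = 0"
    and fh: "\<And>x. valid x \<Longrightarrow> separate s x \<Longrightarrow> \<bar>f x - h x\<bar> \<le> e" and e: "0 \<le> e"
    and as: "a \<le> s" and x: "valid x" "x (Suc k) \<notin> x ` smp_gt s"
  shows "\<bar>sample_avg s f x - sample_avg s (\<lambda>x. live_weight a s x * h x) x\<bar> \<le> e"
proof (cases "\<exists>i\<in>{1..k}. t i = s")
  case False
  then have JJ: "smp_ge s = smp_gt s" by (auto simp: smp_ge_eq_smp_gt_Un)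
  have sp: "separate s (slot_upd s y x)" if "y < n" for y
  proof (cases "t (Suc k) = s")
    case True
    then have "smp_gt s = {}" using t_less[of _ "Suc k"] by (force simp: smp_gt_def)
    then show ?thesis by (simp add: separate_def JJ)
  next
    case F: False
    then have "slot_upd s y x = x" using False by (auto simp: slot_upd_def fun_eq_iff le_Suc_eq)
    then show ?thesis using x by (simp add: separate_def JJ)
  qed
  have "\<bar>(\<Sum>y<n. f (slot_upd s y x)) - (\<Sum>y<n. live_weight a s (slot_upd s y x) * h (slot_upd s y x))\<bar> \<le> real (card {..<n}) * e"
    by (rule abs_sum_diff_le) (use fh sp valid_slot_upd x in \<open>auto simp: live_weight_def JJ\<close>)
  then show ?thesis unfolding sample_avg_def using nn_pos
    by (simp add: diff_divide_distrib[symmetric] abs_divide divide_le_eq mult.commute)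
next
  case True
  then obtain i where i: "i \<in> {1..k}" "t i = s" by blast
  let ?u = "\<lambda>y. slot_upd s y x"
  let ?q = "x (Suc k)"
  define M where "M = card (x ` smp_gt s)"
  have ui: "?u y i = y" for y using i by (simp add: slot_upd_def)
  have uo: "?u y j = x j" if "j \<noteq> i" for j y
    using i that t_eq_iff[of i j] by (auto simp: slot_upd_def)
  have iJ: "i \<notin> smp_gt s" "smp_ge s = insert i (smp_gt s)" using i t_eq_iff
    by (auto simp: smp_ge_eq_smp_gt_Un smp_gt_def) 
  have uJ: "?u y j = x j" if "j \<in> smp_gt s" for j y using uo iJ(1) that by metis
  have im: "?u y ` smp_gt s = x ` smp_gt s" for y using uo iJ(1) by (intro image_cong refl) metis
  have imJ: "?u y ` smp_ge s = insert y (x ` smp_gt s)" for y using iJ im ui by simp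
  have q: "?u y (Suc k) = ?q" for y using uo i by auto
  have qn: "?q < n" using x by (simp add: valid_def)
  have sp: "separate s (?u y) \<longleftrightarrow> y \<noteq> ?q" for y unfolding separate_def q imJ using x by auto
  have vu: "valid (?u y)" if "y < n" for y using valid_slot_upd x that by auto
  have Mn: "M < n" unfolding M_def by (rule card_image_smp_ge[OF x(2,1)]) simp
  have xJ: "x ` smp_gt s \<subseteq> {..<n}" using x by (auto simp: valid_def)
  have hc: "h (?u y) = h (?u ?q)" if "y < n" "y \<notin> x ` smp_gt s" for y
  proof -
    have "same_kernel (smp_ge s) (?u y) (?u ?q)"
      unfolding same_kernel_def iJ(2) using that x(2) ui by (auto simp: image_iff uJ)
    then show ?thesis using h vu that qn unfolding kernel_inv_def by blast
  qed
  have CR1: "live_weight a s (?u y) = (if y \<in> x ` smp_gt s then 1 else (real n - real M - 1) / (real n - real M))" for y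
    unfolding live_weight_def imJ im M_def[symmetric] using as by (auto simp: insert_absorb)
  let ?R = "\<Sum>y<n. live_weight a s (?u y) * h (?u y)"
  have "?R = (\<Sum>y\<in>{..<n} - x ` smp_gt s. live_weight a s (?u y) * h (?u y)) + (\<Sum>y\<in>x ` smp_gt s. live_weight a s (?u y) * h (?u y))"
    by (rule sum.subset_diff[OF xJ]) simp
  also have "(\<Sum>y\<in>{..<n} - x ` smp_gt s. live_weight a s (?u y) * h (?u y))
     = (\<Sum>y\<in>{..<n} - x ` smp_gt s. (real n - real M - 1) / (real n - real M) * h (?u ?q))"
    by (rule sum.cong[OF refl]) (use hc in \<open>auto simp: CR1\<close>)
  also have "\<dots> = (real n - real M - 1) * h (?u ?q)"
    using Mn xJ by (simp add: card_Diff_subset M_def finite_subset[OF xJ] of_nat_diff)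
  also have "\<dots> = (\<Sum>y\<in>{..<n} - x ` smp_gt s - {?q}. h (?u y))"
  proof -
    have "(\<Sum>y\<in>{..<n} - x ` smp_gt s - {?q}. h (?u y)) = (\<Sum>y\<in>{..<n} - x ` smp_gt s - {?q}. h (?u ?q))"
      by (rule sum.cong[OF refl]) (use hc in auto)
    also have "\<dots> = real (n - M - 1) * h (?u ?q)"
      using x qn xJ by (simp add: card_Diff_subset M_def finite_subset[OF xJ])
    finally show ?thesis using Mn by (simp add: of_nat_diff)
  qed
  also have "(\<Sum>y\<in>x ` smp_gt s. live_weight a s (?u y) * h (?u y)) = (\<Sum>y\<in>x ` smp_gt s. h (?u y))"
    by (rule sum.cong[OF refl]) (auto simp: CR1)
  also have "(\<Sum>y\<in>{..<n} - x ` smp_gt s - {?q}. h (?u y)) + (\<Sum>y\<in>x ` smp_gt s. h (?u y))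
     = (\<Sum>y\<in>{..<n} - {?q}. h (?u y))"
  proof -
    have s: "x ` smp_gt s \<subseteq> {..<n} - {?q}" using xJ x(2) by blast
    have d: "{..<n} - x ` smp_gt s - {?q} = {..<n} - {?q} - x ` smp_gt s" by auto
    show ?thesis unfolding d by (rule sum.subset_diff[OF s, symmetric]) simp
  qed
  finally have R: "?R = (\<Sum>y\<in>{..<n} - {?q}. h (?u y))" .
  have L: "(\<Sum>y<n. f (?u y)) = (\<Sum>y\<in>{..<n} - {?q}. f (?u y))"
    using f0 vu sp by (intro sum.mono_neutral_right) auto
  have "\<bar>(\<Sum>y<n. f (?u y)) - ?R\<bar> \<le> real (card ({..<n} - {?q})) * e"
    unfolding R L by (rule abs_sum_diff_le) (use fh sp vu in auto)
  also have "\<dots> \<le> real n * e" using e by (intro mult_right_mono) (auto intro: order_trans[OF card_Diff1_le])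
  finally show ?thesis unfolding sample_avg_def using nn_pos
    by (simp add: diff_divide_distrib[symmetric] abs_divide divide_le_eq mult.commute)
qed

lemma chain_val_nonsep: "a \<le> hd ts \<Longrightarrow> ts \<noteq> [] \<Longrightarrow> \<not> separate (hd ts) x \<Longrightarrow> chain_val (sep_weight g a) C ts x = 0"
  by (induction ts rule: induct_list012) (auto simp: sep_weight_def)

text \<open>A grid step of length \<open>\<delta>\<close> costs an error \<open>O(\<delta>\<^sup>2)\<close>; the sampling steps are exact.\<close>

theorem chain_val_compare:
  assumes g: "invariant_test g"
  shows "grid ts \<Longrightarrow> a \<in> set ts \<Longrightarrow> valid x \<Longrightarrow> separate (hd ts) x \<Longrightarrow>
    \<bar>chain_val (sep_weight g a) no_weight ts x - chain_val (kill_weight g a) (live_weight a) ts x\<bar> \<le> 4 * mu\<^sup>2 * sq_gaps ts"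
proof (induction ts arbitrary: x rule: induct_list012)
  case (3 s s' ts)
  note D = grid_ConsD[OF 3(3)]
  have bddL: "unit_bdd (chain_val (sep_weight g a) no_weight (s' # ts))"
    by (rule unit_bdd_chain_val) (use invariant_test_sep_weight[OF g] unit_bdd_one D(1) in \<open>auto simp: grid_def\<close>)
  have bddR: "unit_bdd (chain_val (kill_weight g a) (live_weight a) (s' # ts))"
    by (rule unit_bdd_chain_val) (use invariant_test_kill_weight[OF g] unit_bdd_live_weight D(1) in \<open>auto simp: grid_def\<close>)
  show ?case
  proof (cases "a = s")
    case True
    have lt: "u < a" if "u \<in> set (s' # ts)" for u
      using 3(3) that True by (auto simp: grid_def)
    have "chain_val (sep_weight g a) no_weight (s' # ts) = chain_val (kill_weight g a) (live_weight a) (s' # ts)"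
      by (rule chain_val_cong[OF D(1)]) (use lt in \<open>force simp: sep_weight_def kill_weight_def live_weight_def\<close>)+
    moreover have "live_weight a s' = (\<lambda>_. 1)" using lt[of s'] by (auto simp: live_weight_def)
    moreover have "sep_weight g a s s' x = kill_weight g a s s' x" using True 3(6) by (simp add: sep_weight_def kill_weight_def)
    ultimately have "chain_val (sep_weight g a) no_weight (s # s' # ts) x = chain_val (kill_weight g a) (live_weight a) (s # s' # ts) x" by simp
    then show ?thesis using sq_gaps_nonneg by simp
  next
    case False
    then have a': "a \<in> set (s' # ts)" using 3(4) by auto
    have "a \<le> s'" using 3(3) a' by (auto simp: grid_def)
    then have as: "a < s" using D(2) by simp
    let ?e = "4 * mu\<^sup>2 * sq_gaps (s' # ts)"
    have e0: "0 \<le> ?e" using sq_gaps_nonneg by simp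
    define F where "F = sample_avg s' (chain_val (sep_weight g a) no_weight (s' # ts))"
    define H where "H = sample_avg s' (\<lambda>x. live_weight a s' x * chain_val (kill_weight g a) (live_weight a) (s' # ts) x)"
    have F0: "F x = 0" if "valid x" "x (Suc k) \<in> x ` smp_ge s" for x
    proof -
      have "\<not> separate s' (slot_upd s' y x)" for y
      proof -
        from that(2) obtain j where j: "j \<in> smp_ge s" "x (Suc k) = x j" by auto
        then have "j \<in> smp_gt s'" using D(3) by simp
        then have jj: "j \<in> smp_ge s'" "t j \<noteq> s'" "t (Suc k) \<noteq> s'"
          using t_less[of j "Suc k"] by (auto simp: smp_gt_def smp_ge_def)
        then have "slot_upd s' y x (Suc k) = x (Suc k)" "slot_upd s' y x j = x j" by (auto simp: slot_upd_def)
        then show ?thesis unfolding separate_def using jj(1) j(2) by (metis imageI)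
      qed
      then have "chain_val (sep_weight g a) no_weight (s' # ts) (slot_upd s' y x) = 0" for y
        using \<open>a \<le> s'\<close> by (intro chain_val_nonsep) auto
      then show ?thesis by (simp add: F_def sample_avg_def)
    qed
    have FH: "\<bar>F x - H x\<bar> \<le> ?e" if "valid x" "x (Suc k) \<notin> x ` smp_ge s" for x
      unfolding F_def H_def
    proof (rule sample_avg_compare)
      show "kernel_inv (smp_ge s') (chain_val (kill_weight g a) (live_weight a) (s' # ts))" using kernel_inv_VR[OF g D(1)] by simp
      show "chain_val (sep_weight g a) no_weight (s' # ts) x = 0" if "\<not> separate s' x" for x
        using \<open>a \<le> s'\<close> that by (intro chain_val_nonsep) auto
      show "\<bar>chain_val (sep_weight g a) no_weight (s' # ts) x - chain_val (kill_weight g a) (live_weight a) (s' # ts) x\<bar> \<le> ?e" if "valid x" "separate s' x" for x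
        using 3(2)[OF D(1) a' that(1)] that(2) by simp
    qed (use e0 \<open>a \<le> s'\<close> that D(3) in auto)
    have Hk: "kernel_inv (smp_ge s) H" unfolding H_def D(3)[symmetric]
      using kernel_inv_VR[OF g D(1)] by (intro kernel_inv_sample_avg kernel_inv_mult kernel_inv_live_weight) simp
    have xs: "x (Suc k) \<notin> x ` smp_ge s" using 3(6) by (simp add: separate_def)
    have "\<bar>poisson_avg (mu * (s - s')) F x - exp (- (rate * (s - s') * real (card (x ` smp_ge s)))) * poisson_avg (mu * (s - s')) H x\<bar>
       \<le> ?e + 4 * mu\<^sup>2 * (s - s')\<^sup>2"
    proof (rule poisson_avg_compare[OF F0 FH Hk _ _ 3(5) xs])
      show "unit_bdd F" unfolding F_def by (intro unit_bdd_sample_avg bddL)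
      show "unit_bdd H" unfolding H_def by (intro unit_bdd_sample_avg unit_bdd_mult bddR unit_bdd_live_weight)
    qed (use D(2) in \<open>auto simp: smp_ge_def\<close>)
    then have le: "\<bar>g s x * (poisson_avg (mu * (s - s')) F x - exp (- (rate * (s - s') * real (card (x ` smp_ge s)))) * poisson_avg (mu * (s - s')) H x)\<bar>
       \<le> ?e + 4 * mu\<^sup>2 * (s - s')\<^sup>2"
      by (rule order_trans[rotated])
        (use g 3(5) in \<open>auto simp: invariant_test_def unit_bdd_def abs_mult mult_left_le_one_le\<close>)
    have eq: "chain_val (sep_weight g a) no_weight (s # s' # ts) x - chain_val (kill_weight g a) (live_weight a) (s # s' # ts) x
        = g s x * (poisson_avg (mu * (s - s')) F x - exp (- (rate * (s - s') * real (card (x ` smp_ge s)))) * poisson_avg (mu * (s - s')) H x)"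
      using as 3(6) by (simp add: sep_weight_def kill_weight_def F_def H_def algebra_simps)
    show ?thesis unfolding eq using le by (simp add: algebra_simps)
  qed
qed (use g in \<open>auto simp: sep_weight_def kill_weight_def\<close>)

end

section \<open>Poisson numbers of events\<close>

lemma nn_integral_PiM_resample:
  fixes M :: "'i \<Rightarrow> 'a measure"
  assumes M: "\<And>i. prob_space (M i)" and [measurable]: "f \<in> borel_measurable (PiM UNIV M)"
  shows "(\<integral>\<^sup>+w. f w \<partial>PiM UNIV M) = (\<integral>\<^sup>+x. \<integral>\<^sup>+w. f (w(m := x)) \<partial>PiM UNIV M \<partial>M m)"
proof -
  interpret P: prob_space "PiM UNIV M" by (intro prob_space_PiM M)
  have eq: "distr (M m \<Otimes>\<^sub>M PiM UNIV M) (PiM UNIV M) (\<lambda>(x, X). X(m := x)) = PiM UNIV M"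
    using distr_pair_PiM_eq_PiM[of UNIV M m] M by simp
  have meas [measurable]: "(\<lambda>(x, X). X(m := x)) \<in> measurable (M m \<Otimes>\<^sub>M PiM UNIV M) (PiM UNIV M)"
    using measurable_fun_upd[of UNIV UNIV m "snd" "M m \<Otimes>\<^sub>M PiM UNIV M" M fst]
    by (simp add: case_prod_beta)
  have "(\<integral>\<^sup>+w. f w \<partial>PiM UNIV M) = (\<integral>\<^sup>+w. f w \<partial>distr (M m \<Otimes>\<^sub>M PiM UNIV M) (PiM UNIV M) (\<lambda>(x, X). X(m := x)))"
    by (simp only: eq)
  also have "\<dots> = (\<integral>\<^sup>+z. f ((\<lambda>(x, X). X(m := x)) z) \<partial>(M m \<Otimes>\<^sub>M PiM UNIV M))"
    by (rule nn_integral_distr) measurable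
  also have "\<dots> = (\<integral>\<^sup>+x. \<integral>\<^sup>+w. f ((\<lambda>(x, X). X(m := x)) (x, w)) \<partial>PiM UNIV M \<partial>M m)"
    by (rule P.nn_integral_fst[symmetric]) measurable
  finally show ?thesis by simp
qed

text \<open>\<open>gaps_match L y\<close>: a point process with successive gaps \<open>y\<close> has exactly \<open>c\<close> points in each of the
  consecutive intervals whose lengths and counts are listed in \<open>L\<close>.\<close>

fun gaps_match :: "(real \<times> nat) list \<Rightarrow> (nat \<Rightarrow> real) \<Rightarrow> bool" where
  "gaps_match [] y = True"
| "gaps_match ((d, 0) # L) y = (d < y 0 \<and> gaps_match L (y(0 := y 0 - d)))"
| "gaps_match ((d, Suc c) # L) y = (y 0 \<le> d \<and> gaps_match ((d - y 0, c) # L) (\<lambda>i. y (Suc i)))"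

lemma measurable_gaps_match:
  assumes "\<And>i. (\<lambda>z. y z i) \<in> borel_measurable N"
  shows "Measurable.pred N (\<lambda>z. gaps_match L (y z))"
  using assms
proof (induction L arbitrary: y)
  case (Cons a L)
  have "Measurable.pred N (\<lambda>z. gaps_match ((d z, c) # L) (y z))"
    if "d \<in> borel_measurable N" "\<And>i. (\<lambda>z. y z i) \<in> borel_measurable N" for d c y
    using that
  proof (induction c arbitrary: d y)
    case 0
    note [measurable] = 0
    have [measurable]: "Measurable.pred N (\<lambda>z. gaps_match L ((y z)(0 := y z 0 - d z)))"
      by (rule Cons.IH) (auto simp: fun_upd_def)
    show ?case by simp
  next
    case (Suc c)
    note [measurable] = Suc.prems
    have [measurable]: "Measurable.pred N (\<lambda>z. gaps_match ((d z - y z 0, c) # L) (\<lambda>i. y z (Suc i)))"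
      by (rule Suc.IH) auto
    show ?case by simp
  qed
  from this[of "\<lambda>_. fst a" y "snd a"] Cons.prems show ?case by simp
qed simp

definition poisson_weight :: "real \<Rightarrow> nat \<Rightarrow> real" where "poisson_weight r c = r ^ c / fact c * exp (- r)"

lemma poisson_weight_nonneg: "0 \<le> r \<Longrightarrow> 0 \<le> poisson_weight r c" by (simp add: poisson_weight_def)

definition partial_sum :: "(nat \<Rightarrow> real) \<Rightarrow> nat \<Rightarrow> real" where "partial_sum y j = (\<Sum>i<j. y i)"

fun counts_match :: "(real \<times> nat) list \<Rightarrow> real \<Rightarrow> (nat \<Rightarrow> real) \<Rightarrow> bool" where
  "counts_match [] u y = True"
| "counts_match ((d, c) # L) u y = (card {j. u < partial_sum y (Suc j) \<and> partial_sum y (Suc j) \<le> u + d} = c \<and> counts_match L (u + d) y)"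

lemma counts_match_shift:
  assumes "\<And>j. partial_sum y' (Suc j) = partial_sum y (Suc j) - d"
  shows "counts_match L (u + d) y = counts_match L u y'"
  using assms
proof (induction L u y' arbitrary: y rule: counts_match.induct)
  case (2 e c L u y')
  have "counts_match L (u + d + e) y = counts_match L (u + e) y'"
    using 2(1)[OF 2(2)] by (simp add: algebra_simps)
  moreover have "{j. u + d < partial_sum y (Suc j) \<and> partial_sum y (Suc j) \<le> u + d + e} =
     {j. u < partial_sum y' (Suc j) \<and> partial_sum y' (Suc j) \<le> u + e}" using 2(2) by auto
  ultimately show ?case by simp
qed simp

lemma partial_sum_Suc_shift: "partial_sum y (Suc j) = y 0 + partial_sum (\<lambda>i. y (Suc i)) j"
  unfolding partial_sum_def by (rule sum.lessThan_Suc_shift)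

lemma counts_match_shift_Suc:
  assumes "0 \<le> u" "\<forall>(d, c)\<in>set L. 0 \<le> d"
  shows "counts_match L (u + y 0) y = counts_match L u (\<lambda>i. y (Suc i))"
  using assms
proof (induction L u y rule: counts_match.induct)
  case (2 e c L u y)
  have "counts_match L (u + y 0 + e) y = counts_match L (u + e) (\<lambda>i. y (Suc i))"
    using 2 by (simp add: algebra_simps)
  moreover have "{j. u + y 0 < partial_sum y (Suc j) \<and> partial_sum y (Suc j) \<le> u + y 0 + e} =
     Suc ` {j. u < partial_sum (\<lambda>i. y (Suc i)) (Suc j) \<and> partial_sum (\<lambda>i. y (Suc i)) (Suc j) \<le> u + e}" (is "?A = Suc ` ?B")
  proof (intro equalityI subsetI)
    fix j assume j: "j \<in> ?A"
    have "j \<noteq> 0"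
    proof
      assume "j = 0"
      with j 2(2) show False by (simp add: partial_sum_def)
    qed
    then obtain i where "j = Suc i" by (cases j) auto
    with j show "j \<in> Suc ` ?B" by (auto simp: partial_sum_Suc_shift[of y "Suc i"])
  qed (auto simp: partial_sum_Suc_shift[of y "Suc _"])
  ultimately show ?case by (simp add: card_image)
qed simp

lemma partial_sum_pos_ge: "(\<And>i. 0 < y i) \<Longrightarrow> y 0 \<le> partial_sum y (Suc j)"
  unfolding partial_sum_Suc_shift by (simp add: partial_sum_def sum_nonneg less_imp_le)

lemma gaps_match_iff_counts_match:
  assumes "\<And>i. 0 < y i" "\<And>v. finite {j. partial_sum y (Suc j) \<le> v}" "\<forall>(d, c)\<in>set L. 0 \<le> d"
  shows "gaps_match L y \<longleftrightarrow> counts_match L 0 y"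
  using assms
proof (induction L y rule: gaps_match.induct)
  case (2 d L y)
  have fin: "finite {j. 0 < partial_sum y (Suc j) \<and> partial_sum y (Suc j) \<le> d}"
    by (rule finite_subset[OF _ 2(3)[of d]]) auto
  have e: "card {j. 0 < partial_sum y (Suc j) \<and> partial_sum y (Suc j) \<le> d} = 0 \<longleftrightarrow> d < y 0"
  proof -
    have "(\<forall>j. \<not> (0 < partial_sum y (Suc j) \<and> partial_sum y (Suc j) \<le> d)) \<longleftrightarrow> d < y 0"
    proof
      assume "\<forall>j. \<not> (0 < partial_sum y (Suc j) \<and> partial_sum y (Suc j) \<le> d)"
      from this[rule_format, of 0] 2(2)[of 0] show "d < y 0" by (simp add: partial_sum_def)
    qed (use partial_sum_pos_ge[of y] 2(2) in \<open>auto simp: not_le intro: less_le_trans\<close>)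
    then show ?thesis using fin by (auto simp: card_eq_0_iff)
  qed
  show ?case
  proof (cases "d < y 0")
    case True
    let ?y = "y(0 := y 0 - d)"
    have ps: "partial_sum ?y (Suc j) = partial_sum y (Suc j) - d" for j
      by (simp add: partial_sum_Suc_shift)
    have "gaps_match L ?y = counts_match L 0 ?y"
    proof (rule 2(1))
      show "0 < ?y i" for i using 2(2) True by auto
      have "{j. partial_sum ?y (Suc j) \<le> v} = {j. partial_sum y (Suc j) \<le> v + d}" for v using ps by auto
      then show "finite {j. partial_sum ?y (Suc j) \<le> v}" for v using 2(3)[of "v + d"] by simp
    qed (use 2 in auto)
    also have "\<dots> = counts_match L (0 + d) y" using counts_match_shift[of ?y y d L 0] ps by simp
    finally show ?thesis using True e by simp
  qed (use e in auto)
next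
  case (3 d c L y)
  let ?y = "\<lambda>i. y (Suc i)"
  have y0: "0 < y 0" using 3(2) .
  show ?case
  proof (cases "y 0 \<le> d")
    case True
    have fin: "finite {j. partial_sum ?y (Suc j) \<le> v}" for v
    proof -
      have "Suc ` {j. partial_sum ?y (Suc j) \<le> v} \<subseteq> {j. partial_sum y (Suc j) \<le> v + y 0}"
        by (auto simp: partial_sum_Suc_shift[of y "Suc _"])
      from finite_subset[OF this 3(3)] show ?thesis by (rule finite_imageD) simp
    qed
    have "gaps_match ((d - y 0, c) # L) ?y = counts_match ((d - y 0, c) # L) 0 ?y"
      by (rule 3(1)) (use 3 True fin in auto)
    also have "\<dots> = (card {j. 0 < partial_sum ?y (Suc j) \<and> partial_sum ?y (Suc j) \<le> d - y 0} = c \<and> counts_match L d y)"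
      using counts_match_shift_Suc[of "d - y 0" L y] True 3(4) by simp
    also have "card {j. 0 < partial_sum ?y (Suc j) \<and> partial_sum ?y (Suc j) \<le> d - y 0} = c \<longleftrightarrow>
       card {j. 0 < partial_sum y (Suc j) \<and> partial_sum y (Suc j) \<le> d} = Suc c"
    proof -
      have "{j. 0 < partial_sum y (Suc j) \<and> partial_sum y (Suc j) \<le> d}
        = insert 0 (Suc ` {j. 0 < partial_sum ?y (Suc j) \<and> partial_sum ?y (Suc j) \<le> d - y 0})" (is "?A = insert 0 (Suc ` ?B)")
      proof (intro equalityI subsetI)
        fix j assume j: "j \<in> ?A"
        have "0 < partial_sum ?y (Suc i)" for i
          using partial_sum_pos_ge[of ?y i] 3(2)[of "Suc 0"] 3(2) by (auto intro: less_le_trans)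
        with j show "j \<in> insert 0 (Suc ` ?B)"
          by (cases j) (auto simp: partial_sum_Suc_shift[of y "Suc _"])
      qed (use True y0 in \<open>auto simp: partial_sum_Suc_shift[of y "Suc _"]\<close>, simp_all add: partial_sum_def)
      moreover have "finite ?B" by (rule finite_subset[OF _ fin[of "d - y 0"]]) auto
      ultimately show ?thesis by (simp add: card_image)
    qed
    finally show ?thesis using True by simp
  next
    case False
    then have "{j. 0 < partial_sum y (Suc j) \<and> partial_sum y (Suc j) \<le> d} = {}"
      using partial_sum_pos_ge[of y] 3(2) by (auto dest: order_trans)
    then have "card {j. 0 < partial_sum y (Suc j) \<and> partial_sum y (Suc j) \<le> d} = 0" by (simp only: card.empty)
    then show ?thesis using False by simp
  qed
qed simp

lemma measurable_sorted_list_of_Collect: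
  fixes P :: "'z \<Rightarrow> int \<Rightarrow> bool"
  assumes [measurable]: "\<And>m. Measurable.pred N (\<lambda>z. P z m)"
  shows "(\<lambda>z. sorted_list_of_set {m. P z m}) \<in> measurable N (count_space UNIV)"
proof -
  have eq: "sorted_list_of_set {m. P z m} = l \<longleftrightarrow>
      (\<exists>l'. (\<forall>m. P z m \<longleftrightarrow> m \<in> set l') \<and> sorted_list_of_set (set l') = l) \<or>
      ((\<forall>l'. \<not> (\<forall>m. P z m \<longleftrightarrow> m \<in> set l')) \<and> l = [])" for z l
  proof (cases "finite {m. P z m}")
    case True
    then obtain l' where l': "set l' = {m. P z m}" using finite_list by blast
    have "\<And>l''. (\<forall>m. P z m \<longleftrightarrow> m \<in> set l'') \<longleftrightarrow> set l'' = {m. P z m}" by auto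
    then show ?thesis using l' by metis
  next
    case False
    then have "\<not> (\<forall>m. P z m \<longleftrightarrow> m \<in> set l')" for l' by (metis List.finite_set mem_Collect_eq set_eqI)
    then show ?thesis using False by auto
  qed
  have "{z \<in> space N. sorted_list_of_set {m. P z m} = l} \<in> sets N" for l
    unfolding eq by measurable
  then show ?thesis
    by (intro measurable_count_space_eq2_countable[THEN iffD2])
       (auto simp: vimage_def Int_def conj_commute)
qed

lemma measurable_comp2_countable:
  fixes f :: "'z \<Rightarrow> 'a::countable" and g :: "'z \<Rightarrow> 'b::countable"
  assumes "f \<in> measurable N (count_space UNIV)" "g \<in> measurable N (count_space UNIV)"
  shows "(\<lambda>z. h (f z) (g z)) \<in> measurable N (count_space UNIV)"
  by (rule measurable_compose_countable[OF _ assms(1)], rule measurable_compose_countable[OF _ assms(2)]) simp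

lemma poisson_weight_sums: "poisson_weight r sums 1"
proof -
  have "(\<lambda>c. exp (- r) * (r ^ c /\<^sub>R fact c)) sums (exp (- r) * exp r)"
    by (intro sums_mult exp_converges)
  then show ?thesis by (simp add: poisson_weight_def[abs_def] exp_minus field_simps)
qed

lemma gaps_match_exceeds: "gaps_match ((v, c) # L) y \<Longrightarrow> \<exists>j. v < partial_sum y (Suc j)"
proof (induction c arbitrary: v y)
  case 0
  then show ?case by (intro exI[of _ 0]) (simp add: partial_sum_def)
next
  case (Suc c)
  then have "gaps_match ((v - y 0, c) # L) (\<lambda>i. y (Suc i))" by simp
  from Suc.IH[OF this] obtain j where "v - y 0 < partial_sum (\<lambda>i. y (Suc i)) (Suc j)" by blast
  then show ?case by (intro exI[of _ "Suc j"]) (simp add: partial_sum_Suc_shift[of y "Suc j"])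
qed

lemma gaps_match_unique: "gaps_match [(v, c)] y \<Longrightarrow> gaps_match [(v, c')] y \<Longrightarrow> c = c'"
proof (induction c arbitrary: v y c')
  case 0 then show ?case by (cases c') auto
next
  case (Suc c)
  then show ?case by (cases c') auto
qed

lemma partial_sum_mono: "(\<And>i. 0 < y i) \<Longrightarrow> i \<le> j \<Longrightarrow> partial_sum y i \<le> partial_sum y j"
  unfolding partial_sum_def by (intro sum_mono2) (auto simp: less_imp_le)

fun gaps :: "real list \<Rightarrow> real list" where
  "gaps (s # s' # ts) = (s - s') # gaps (s' # ts)"
| "gaps _ = []"

lemma length_gaps [simp]: "length (gaps ts) = length ts - 1"
  by (induction ts rule: gaps.induct) auto

lemma gaps_append: "gaps (ps @ s # ns) = gaps (ps @ [s]) @ gaps (s # ns)"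
  by (induction ps rule: induct_list012) auto

lemma sum_gaps: "ts \<noteq> [] \<Longrightarrow> sum_list (gaps ts) = hd ts - last ts"
  by (induction ts rule: gaps.induct) auto

lemma gaps_pos: "sorted_wrt (>) ts \<Longrightarrow> d \<in> set (gaps ts) \<Longrightarrow> 0 < d"
  by (induction ts rule: gaps.induct) auto

lemma counts_match_append: "counts_match (L @ L') u y \<longleftrightarrow> counts_match L u y \<and> counts_match L' (u + sum_list (map fst L)) y"
  by (induction L u y rule: counts_match.induct) (auto simp: add.assoc)

lemma integral_pair_pmf_unit:
  fixes f :: "'a \<Rightarrow> 'b \<Rightarrow> real"
  assumes "\<And>a b. a \<in> set_pmf p \<Longrightarrow> b \<in> set_pmf q \<Longrightarrow> 0 \<le> f a b \<and> f a b \<le> 1"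
  shows "measure_pmf.expectation (pair_pmf p q) (\<lambda>(a, b). f a b)
    = measure_pmf.expectation p (\<lambda>a. measure_pmf.expectation q (f a))"
proof -
  have iq: "integrable (measure_pmf q) (f a)" if "a \<in> set_pmf p" for a
    by (rule measure_pmf.integrable_const_bound[of _ 1]) (use assms that in \<open>auto simp: AE_measure_pmf_iff\<close>)
  have q01: "0 \<le> measure_pmf.expectation q (f a) \<and> measure_pmf.expectation q (f a) \<le> 1" if "a \<in> set_pmf p" for a
    using assms that by (auto intro!: integral_nonneg_AE measure_pmf.integral_le_const iq simp: AE_measure_pmf_iff)
  have "ennreal (measure_pmf.expectation (pair_pmf p q) (\<lambda>(a, b). f a b)) = (\<integral>\<^sup>+x. ennreal ((\<lambda>(a, b). f a b) x) \<partial>pair_pmf p q)"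
    by (rule nn_integral_eq_integral[symmetric])
       (use assms in \<open>auto intro!: measure_pmf.integrable_const_bound[of _ 1] simp: AE_measure_pmf_iff\<close>)
  also have "\<dots> = (\<integral>\<^sup>+a. \<integral>\<^sup>+b. ennreal (f a b) \<partial>q \<partial>p)"
    by (subst nn_integral_pair_pmf') simp
  also have "\<dots> = (\<integral>\<^sup>+a. ennreal (measure_pmf.expectation q (f a)) \<partial>p)"
    by (rule nn_integral_cong_AE)
       (use assms iq in \<open>auto intro!: nn_integral_eq_integral simp: AE_measure_pmf_iff\<close>)
  also have "\<dots> = ennreal (measure_pmf.expectation p (\<lambda>a. measure_pmf.expectation q (f a)))"
    by (rule nn_integral_eq_integral)
       (use q01 in \<open>auto intro!: measure_pmf.integrable_const_bound[of _ 1] simp: AE_measure_pmf_iff\<close>)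
  finally show ?thesis
    using assms q01 by (subst (asm) ennreal_inj) (auto intro!: integral_nonneg_AE simp: AE_measure_pmf_iff)
qed

context smgp begin

definition EXP :: "real measure" where
  "EXP = density lborel (\<lambda>x. ennreal (exponential_density mu x))"

definition ME :: "(int \<Rightarrow> real) measure" where "ME = PiM UNIV (\<lambda>_. EXP)"

lemma prob_EXP: "prob_space EXP"
  unfolding EXP_def by (rule prob_space_exponential_density[OF mu_pos])

lemma sets_EXP [measurable_cong, simp]: "sets EXP = sets borel"
  by (simp add: EXP_def)

lemma space_EXP [simp]: "space EXP = UNIV"
  by (simp add: EXP_def)

sublocale ME: prob_space ME
  unfolding ME_def by (intro prob_space_PiM prob_EXP)

lemma space_ME [simp]: "space ME = UNIV"
  by (auto simp: ME_def space_PiM)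

lemma measurable_ME_coord [measurable]: "(\<lambda>E. E m) \<in> borel_measurable ME"
proof -
  have "(\<lambda>E. E m) \<in> measurable ME EXP" unfolding ME_def by measurable
  then show ?thesis by (simp cong: measurable_cong_sets)
qed

lemma nn_integral_ME_resample:
  "f \<in> borel_measurable ME \<Longrightarrow> (\<integral>\<^sup>+E. f E \<partial>ME) = (\<integral>\<^sup>+x. \<integral>\<^sup>+E. f (E(m := x)) \<partial>ME \<partial>EXP)"
  unfolding ME_def by (rule nn_integral_PiM_resample[OF prob_EXP])

lemma measurable_ME_slot_upd:
  assumes [measurable]: "f \<in> borel_measurable ME"
  shows "(\<lambda>(x, E). f (E(m := x))) \<in> borel_measurable (EXP \<Otimes>\<^sub>M ME)"
proof -
  have "(\<lambda>(x, X). X(m := x)) \<in> measurable (EXP \<Otimes>\<^sub>M ME) ME"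
    unfolding ME_def
    using measurable_fun_upd[of UNIV UNIV m "snd" "EXP \<Otimes>\<^sub>M PiM UNIV (\<lambda>_. EXP)" "\<lambda>_. EXP" fst]
    by (simp add: case_prod_beta)
  from measurable_compose[OF this assms] show ?thesis by (simp add: case_prod_beta)
qed

lemma measurable_ME_inner:
  assumes "f \<in> borel_measurable ME"
  shows "(\<lambda>x. \<integral>\<^sup>+E. f (E(m := x)) \<partial>ME) \<in> borel_measurable borel"
proof -
  have "(\<lambda>x. \<integral>\<^sup>+E. f (E(m := x)) \<partial>ME) \<in> borel_measurable EXP"
    by (rule ME.borel_measurable_nn_integral) (use measurable_ME_slot_upd[OF assms] in simp)
  then show ?thesis by (simp cong: measurable_cong_sets)
qed

lemma nn_integral_EXP: "h \<in> borel_measurable borel \<Longrightarrow>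
   (\<integral>\<^sup>+x. h x \<partial>EXP) = (\<integral>\<^sup>+x. ennreal (exponential_density mu x) * h x \<partial>lborel)"
  unfolding EXP_def by (subst nn_integral_density) auto

lemma EXP_memoryless:
  assumes [measurable]: "h \<in> borel_measurable borel" and d: "0 \<le> d"
  shows "(\<integral>\<^sup>+x. (if d < x then h (x - d) else 0) \<partial>EXP) = ennreal (exp (- (mu * d))) * (\<integral>\<^sup>+x. h x \<partial>EXP)"
proof -
  have "(\<integral>\<^sup>+x. (if d < x then h (x - d) else 0) \<partial>EXP)
     = (\<integral>\<^sup>+x. ennreal (exponential_density mu x) * (if d < x then h (x - d) else 0) \<partial>lborel)"
    by (rule nn_integral_EXP) measurable
  also have "\<dots> = (\<integral>\<^sup>+x. ennreal (exponential_density mu (d + x)) * (if 0 < x then h x else 0) \<partial>lborel)"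
    by (subst nn_integral_real_affine[where c = 1 and t = d]) (auto intro!: nn_integral_cong)
  also have "\<dots> = (\<integral>\<^sup>+x. ennreal (exp (- (mu * d))) * (ennreal (exponential_density mu x) * h x) \<partial>lborel)"
  proof (rule nn_integral_cong_AE)
    have "AE x in lborel. x \<noteq> (0::real)" by (rule AE_lborel_singleton)
    then show "AE x in lborel. ennreal (exponential_density mu (d + x)) * (if 0 < x then h x else 0)
      = ennreal (exp (- (mu * d))) * (ennreal (exponential_density mu x) * h x)"
    proof eventually_elim
      case (elim x)
      show ?case
      proof (cases "0 < x")
        case True
        then have "ennreal (exponential_density mu (d + x)) = ennreal (exp (- (mu * d))) * ennreal (exponential_density mu x)"
          using d mu_pos by (subst ennreal_mult[symmetric])
            (auto simp: exponential_density_def algebra_simps simp flip: exp_add)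
        then show ?thesis using True by (simp add: mult.assoc)
      qed (use elim in \<open>auto simp: exponential_density_def\<close>)
    qed
  qed
  also have "\<dots> = ennreal (exp (- (mu * d))) * (\<integral>\<^sup>+x. h x \<partial>EXP)"
    by (subst nn_integral_cmult) (auto simp: nn_integral_EXP)
  finally show ?thesis .
qed

lemma EXP_poisson_weight:
  assumes d: "0 \<le> d"
  shows "(\<integral>\<^sup>+x. (if x \<le> d then ennreal (poisson_weight (mu * (d - x)) c) else 0) \<partial>EXP) = ennreal (poisson_weight (mu * d) (Suc c))"
proof -
  define F where "F x = - exp (- (mu * d)) * (mu * (d - x)) ^ Suc c / fact (Suc c)" for x
  define f where "f x = mu * exp (- (mu * d)) * (mu * (d - x)) ^ c / fact c" for x
  have "(\<integral>\<^sup>+x. (if x \<le> d then ennreal (poisson_weight (mu * (d - x)) c) else 0) \<partial>EXP)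
     = (\<integral>\<^sup>+x. ennreal (exponential_density mu x) * (if x \<le> d then ennreal (poisson_weight (mu * (d - x)) c) else 0) \<partial>lborel)"
    unfolding poisson_weight_def by (rule nn_integral_EXP) measurable
  also have "\<dots> = (\<integral>\<^sup>+x. ennreal (f x) * indicator {0..d} x \<partial>lborel)"
  proof (rule nn_integral_cong)
    fix x
    show "ennreal (exponential_density mu x) * (if x \<le> d then ennreal (poisson_weight (mu * (d - x)) c) else 0)
       = ennreal (f x) * indicator {0..d} x"
    proof (cases "0 \<le> x \<and> x \<le> d")
      case True
      have "exponential_density mu x * poisson_weight (mu * (d - x)) c = f x"
        using True by (simp add: exponential_density_def poisson_weight_def f_def algebra_simps flip: exp_add)
      then show ?thesis using True mu_pos
        by (simp add: poisson_weight_nonneg exponential_density_nonneg flip: ennreal_mult)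
    qed (auto simp: exponential_density_def)
  qed
  also have "\<dots> = ennreal (F d - F 0)"
  proof (rule nn_integral_FTC_Icc)
    show "f \<in> borel_measurable borel" unfolding f_def by measurable
    show "DERIV F x :> f x" for x
      unfolding F_def f_def
      by (rule derivative_eq_intros refl | simp)+
  qed (use d mu_pos in \<open>auto simp: f_def\<close>)
  also have "F d - F 0 = poisson_weight (mu * d) (Suc c)" by (simp add: F_def poisson_weight_def)
  finally show ?thesis .
qed

lemma measurable_poisson_weight_EXP:
  "(\<lambda>x. if x \<le> d then ennreal (poisson_weight (mu * (d - x)) c) else 0) \<in> borel_measurable EXP"
proof -
  have "(\<lambda>x. if x \<le> d then ennreal (poisson_weight (mu * (d - x)) c) else 0) \<in> borel_measurable borel"
    unfolding poisson_weight_def by measurable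
  then show ?thesis by (simp cong: measurable_cong_sets)
qed

definition poisson_prod :: "(real \<times> nat) list \<Rightarrow> real" where
  "poisson_prod L = (\<Prod>(d, c)\<leftarrow>L. poisson_weight (mu * d) c)"

lemma poisson_prod_simps [simp]: "poisson_prod [] = 1" "poisson_prod ((d, c) # L) = poisson_weight (mu * d) c * poisson_prod L"
  by (simp_all add: poisson_prod_def)

lemma poisson_prod_nonneg: "\<forall>(d, c)\<in>set L. 0 \<le> d \<Longrightarrow> 0 \<le> poisson_prod L"
  using mu_pos by (induction L) (auto intro!: mult_nonneg_nonneg poisson_weight_nonneg)

lemma gaps_match_law:
  fixes \<sigma> :: "nat \<Rightarrow> int"
  assumes inj: "inj \<sigma>" and q [measurable]: "q \<in> borel_measurable ME"
  shows "\<forall>(d, c)\<in>set L. 0 \<le> d \<Longrightarrow> (\<And>E i x. j \<le> i \<Longrightarrow> q (E(\<sigma> i := x)) = q E) \<Longrightarrow>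
    (\<integral>\<^sup>+E. (if gaps_match L (\<lambda>i. E (\<sigma> (i + j))) then q E else 0) \<partial>ME) = ennreal (poisson_prod L) * (\<integral>\<^sup>+E. q E \<partial>ME)"
proof (induction L arbitrary: j)
  case (Cons a L)
  have mc [measurable]: "Measurable.pred ME (\<lambda>E. gaps_match L (\<lambda>i. E (\<sigma> (i + j))))" for L j
    by (rule measurable_gaps_match) measurable
  have up: "(\<lambda>i. (E(\<sigma> j := x)) (\<sigma> (i + j))) = (\<lambda>i. E (\<sigma> (i + j)))(0 := x)" for E x j
    using inj by (auto simp: fun_eq_iff dest: injD)
  have L0: "\<forall>(d, c)\<in>set L. 0 \<le> d" using Cons.prems by auto
  have key: "(\<integral>\<^sup>+E. (if gaps_match ((d, c) # L) (\<lambda>i. E (\<sigma> (i + j))) then q E else 0) \<partial>ME)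
      = ennreal (poisson_weight (mu * d) c * poisson_prod L) * (\<integral>\<^sup>+E. q E \<partial>ME)"
    if "0 \<le> d" "\<And>E i x. j \<le> i \<Longrightarrow> q (E(\<sigma> i := x)) = q E" for d c j
    using that
  proof (induction c arbitrary: d j)
    case 0
    let ?f = "\<lambda>E. if gaps_match L (\<lambda>i. E (\<sigma> (i + j))) then q E else 0"
    define h where "h z = (\<integral>\<^sup>+E. ?f (E(\<sigma> j := z)) \<partial>ME)" for z
    have [measurable]: "h \<in> borel_measurable borel" unfolding h_def
      by (rule measurable_ME_inner) measurable
    have "(\<integral>\<^sup>+E. (if gaps_match ((d, 0) # L) (\<lambda>i. E (\<sigma> (i + j))) then q E else 0) \<partial>ME)
       = (\<integral>\<^sup>+x. \<integral>\<^sup>+E. (if gaps_match ((d, 0) # L) (\<lambda>i. (E(\<sigma> j := x)) (\<sigma> (i + j))) then q (E(\<sigma> j := x)) else 0) \<partial>ME \<partial>EXP)"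
      by (rule nn_integral_ME_resample) measurable
    also have "\<dots> = (\<integral>\<^sup>+x. (if d < x then h (x - d) else 0) \<partial>EXP)"
    proof -
      have qj: "q (E(\<sigma> j := x)) = q E" for E x by (rule 0(2)) simp
      show ?thesis unfolding h_def up qj by (intro nn_integral_cong) auto
    qed
    also have "\<dots> = ennreal (exp (- (mu * d))) * (\<integral>\<^sup>+x. h x \<partial>EXP)"
      by (rule EXP_memoryless) (use 0 in auto)
    also have "(\<integral>\<^sup>+x. h x \<partial>EXP) = (\<integral>\<^sup>+E. ?f E \<partial>ME)"
      unfolding h_def by (rule nn_integral_ME_resample[symmetric]) measurable
    also have "\<dots> = ennreal (poisson_prod L) * (\<integral>\<^sup>+E. q E \<partial>ME)"
      by (rule Cons.IH[OF L0 0(2)])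
    finally show ?case using poisson_prod_nonneg[OF L0]
      by (simp add: poisson_weight_def ennreal_mult mult.assoc)
  next
    case (Suc c)
    have sh: "(\<lambda>i. ((\<lambda>i. E (\<sigma> (i + j)))(0 := x)) (Suc i)) = (\<lambda>i. E (\<sigma> (i + Suc j)))" for E x
      by auto
    have "(\<integral>\<^sup>+E. (if gaps_match ((d, Suc c) # L) (\<lambda>i. E (\<sigma> (i + j))) then q E else 0) \<partial>ME)
       = (\<integral>\<^sup>+x. \<integral>\<^sup>+E. (if gaps_match ((d, Suc c) # L) (\<lambda>i. (E(\<sigma> j := x)) (\<sigma> (i + j))) then q (E(\<sigma> j := x)) else 0) \<partial>ME \<partial>EXP)"
      by (rule nn_integral_ME_resample) measurable
    also have "\<dots> = (\<integral>\<^sup>+x. (if x \<le> d then ennreal (poisson_weight (mu * (d - x)) c) else 0)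
        * (ennreal (poisson_prod L) * (\<integral>\<^sup>+E. q E \<partial>ME)) \<partial>EXP)"
    proof (rule nn_integral_cong)
      fix x
      show "(\<integral>\<^sup>+E. (if gaps_match ((d, Suc c) # L) (\<lambda>i. (E(\<sigma> j := x)) (\<sigma> (i + j))) then q (E(\<sigma> j := x)) else 0) \<partial>ME)
        = (if x \<le> d then ennreal (poisson_weight (mu * (d - x)) c) else 0) * (ennreal (poisson_prod L) * (\<integral>\<^sup>+E. q E \<partial>ME))"
      proof (cases "x \<le> d")
        case True
        have "(\<integral>\<^sup>+E. (if gaps_match ((d - x, c) # L) (\<lambda>i. E (\<sigma> (i + Suc j))) then q E else 0) \<partial>ME)
          = ennreal (poisson_weight (mu * (d - x)) c * poisson_prod L) * (\<integral>\<^sup>+E. q E \<partial>ME)"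
          by (rule Suc.IH) (use True Suc.prems in auto)
        moreover have qj: "q (E(\<sigma> j := x)) = q E" for E x by (rule Suc.prems(2)) simp
        ultimately show ?thesis unfolding up gaps_match.simps sh qj using True poisson_prod_nonneg[OF L0]
            poisson_weight_nonneg[of "mu * (d - x)" c] mu_pos
          by (simp add: ennreal_mult mult.assoc)
      qed (unfold up, simp)
    qed
    also have "\<dots> = (\<integral>\<^sup>+x. (if x \<le> d then ennreal (poisson_weight (mu * (d - x)) c) else 0) \<partial>EXP)
         * (ennreal (poisson_prod L) * (\<integral>\<^sup>+E. q E \<partial>ME))"
      by (rule nn_integral_multc[OF measurable_poisson_weight_EXP])
    also have "\<dots> = ennreal (poisson_weight (mu * d) (Suc c)) * (ennreal (poisson_prod L) * (\<integral>\<^sup>+E. q E \<partial>ME))"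
      by (subst EXP_poisson_weight) (use Suc.prems in auto)
    finally show ?case using poisson_prod_nonneg[OF L0] poisson_weight_nonneg[of "mu * d" "Suc c"] mu_pos Suc.prems(1)
      by (simp add: ennreal_mult mult.assoc)
  qed
  from key[of "fst a" j "snd a"] Cons.prems show ?case by (cases a) auto
qed simp

definition gaps_pos_seq :: "(int \<Rightarrow> real) \<Rightarrow> nat \<Rightarrow> real" where "gaps_pos_seq E i = E (int i)"
definition gaps_neg_seq :: "(int \<Rightarrow> real) \<Rightarrow> nat \<Rightarrow> real" where "gaps_neg_seq E i = E (- 1 - int i)"

lemma AE_EXP_pos: "AE x in EXP. 0 < x"
proof -
  have "AE x in lborel. x \<noteq> (0::real)" by (rule AE_lborel_singleton)
  then show ?thesis unfolding EXP_def
    by (subst AE_density) (auto simp: exponential_density_def not_less elim!: eventually_mono split: if_splits)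
qed

lemma AE_ME_pos: "AE E in ME. \<forall>m. 0 < E m"
  unfolding AE_all_countable ME_def
  by (intro allI AE_PiM_component prob_EXP AE_EXP_pos UNIV_I)

lemma AE_ME_exceeds:
  fixes \<sigma> :: "nat \<Rightarrow> int"
  assumes inj: "inj \<sigma>" and v: "0 \<le> v"
  shows "AE E in ME. \<exists>j. v < partial_sum (\<lambda>i. E (\<sigma> i)) (Suc j)"
proof -
  define A where "A c = {E. gaps_match [(v, c)] (\<lambda>i. E (\<sigma> i))}" for c
  have [measurable]: "Measurable.pred ME (\<lambda>E. gaps_match L (\<lambda>i. E (\<sigma> i)))" for L
    by (rule measurable_gaps_match) measurable
  have Am [measurable]: "A c \<in> sets ME" for c
  proof -
    have "{E \<in> space ME. gaps_match [(v, c)] (\<lambda>i. E (\<sigma> i))} \<in> sets ME" by measurable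
    then show ?thesis by (simp add: A_def)
  qed
  have dj: "disjoint_family A"
    unfolding disjoint_family_on_def A_def using gaps_match_unique by blast
  have em: "emeasure ME (A c) = ennreal (poisson_weight (mu * v) c)" for c
  proof -
    have "emeasure ME (A c) = (\<integral>\<^sup>+E. indicator (A c) E \<partial>ME)" by simp
    also have "\<dots> = (\<integral>\<^sup>+E. (if gaps_match [(v, c)] (\<lambda>i. E (\<sigma> (i + 0))) then 1 else 0) \<partial>ME)"
      by (intro nn_integral_cong) (auto simp: A_def)
    also have "\<dots> = ennreal (poisson_prod [(v, c)]) * (\<integral>\<^sup>+E. 1 \<partial>ME)"
      by (rule gaps_match_law[OF inj]) (use v in auto)
    finally show ?thesis using ME.emeasure_space_1 by simp
  qed
  have "emeasure ME (\<Union>c. A c) = (\<Sum>c. emeasure ME (A c))"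
    by (rule suminf_emeasure[symmetric]) (use dj Am in auto)
  also have "\<dots> = ennreal 1"
    unfolding em using poisson_weight_sums[of "mu * v"] mu_pos v
    by (subst suminf_ennreal2) (auto simp: poisson_weight_nonneg sums_iff)
  finally have "emeasure ME (\<Union>c. A c) = 1" by simp
  then have "AE E in ME. E \<in> (\<Union>c. A c)"
    by (intro ME.AE_prob_1) (simp add: measure_def)
  then show ?thesis by eventually_elim (auto simp: A_def dest: gaps_match_exceeds)
qed

definition event_time :: "(int \<Rightarrow> real) \<Rightarrow> int \<Rightarrow> real" where
  "event_time E m = (if m \<ge> 0 then (\<Sum>j\<in>{0..m}. E j) else - (\<Sum>j\<in>{m..-1}. E j))"

lemma event_time_pos: "event_time E (int j) = partial_sum (gaps_pos_seq E) (Suc j)"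
proof -
  have "(\<Sum>i\<in>{0..int j}. E i) = partial_sum (gaps_pos_seq E) (Suc j)"
  proof (induction j)
    case (Suc j)
    have "{0..int (Suc j)} = insert (int (Suc j)) {0..int j}" by auto
    then show ?case using Suc by (simp add: partial_sum_def gaps_pos_seq_def)
  qed (simp add: partial_sum_def gaps_pos_seq_def)
  then show ?thesis by (simp add: event_time_def)
qed

lemma event_time_neg: "event_time E (- 1 - int j) = - partial_sum (gaps_neg_seq E) (Suc j)"
proof -
  have "(\<Sum>i\<in>{-1 - int j..-1}. E i) = partial_sum (gaps_neg_seq E) (Suc j)"
  proof (induction j)
    case (Suc j)
    have "{-1 - int (Suc j)..-1} = insert (-1 - int (Suc j)) {-1 - int j..-1}" by auto
    then show ?case using Suc by (simp add: partial_sum_def gaps_neg_seq_def)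
  qed (simp add: partial_sum_def gaps_neg_seq_def)
  then show ?thesis by (simp add: event_time_def)
qed

lemma int_cases_pn: fixes m :: int obtains j where "m = int j" | j where "m = - 1 - int j"
proof (cases "0 \<le> m")
  case True then show ?thesis using that(1)[of "nat m"] by simp
next
  case False then show ?thesis using that(2)[of "nat (- 1 - m)"] by simp
qed

lemma measurable_event_time [measurable]: "(\<lambda>E. event_time E m) \<in> borel_measurable ME"
  unfolding event_time_def by (cases "m \<ge> 0") auto

definition goodE :: "(int \<Rightarrow> real) \<Rightarrow> bool" where
  "goodE E \<longleftrightarrow> (\<forall>m. 0 < E m) \<and> (\<forall>v. finite {j. partial_sum (gaps_pos_seq E) (Suc j) \<le> v}) \<and>
     (\<forall>v. finite {j. partial_sum (gaps_neg_seq E) (Suc j) \<le> v})"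

lemma AE_partial_sum_finite:
  fixes \<sigma> :: "nat \<Rightarrow> int"
  assumes inj: "inj \<sigma>"
  shows "AE E in ME. \<forall>v. finite {j. partial_sum (\<lambda>i. E (\<sigma> i)) (Suc j) \<le> v}"
proof -
  have "AE E in ME. \<forall>N. \<exists>j. real N < partial_sum (\<lambda>i. E (\<sigma> i)) (Suc j)"
    unfolding AE_all_countable by (intro allI AE_ME_exceeds[OF inj]) simp
  with AE_ME_pos show ?thesis
  proof eventually_elim
    case (elim E)
    show ?case
    proof
      fix v :: real
      obtain N where N: "v \<le> real N" using real_arch_simple by blast
      obtain j where j: "real N < partial_sum (\<lambda>i. E (\<sigma> i)) (Suc j)" using elim by blast
      have "{j. partial_sum (\<lambda>i. E (\<sigma> i)) (Suc j) \<le> v} \<subseteq> {..j}"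
      proof
        fix i assume i: "i \<in> {j. partial_sum (\<lambda>i. E (\<sigma> i)) (Suc j) \<le> v}"
        show "i \<in> {..j}"
        proof (rule ccontr)
          assume "i \<notin> {..j}"
          then have "partial_sum (\<lambda>i. E (\<sigma> i)) (Suc j) \<le> partial_sum (\<lambda>i. E (\<sigma> i)) (Suc i)"
            using elim by (intro partial_sum_mono) auto
          with i j N show False by simp
        qed
      qed
      then show "finite {j. partial_sum (\<lambda>i. E (\<sigma> i)) (Suc j) \<le> v}" by (rule finite_subset) simp
    qed
  qed
qed

lemma AE_goodE: "AE E in ME. goodE E"
proof -
  have 1: "inj int" and 2: "inj (\<lambda>i. - 1 - int i)" by (auto simp: inj_def)
  show ?thesis using AE_ME_pos AE_partial_sum_finite[OF 1] AE_partial_sum_finite[OF 2]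
    by eventually_elim (simp add: goodE_def gaps_pos_seq_def[abs_def] gaps_neg_seq_def[abs_def])
qed

lemma AE_no_event: "AE E in ME. \<forall>m. event_time E m \<noteq> s"
  unfolding AE_all_countable
proof
  fix m :: int
  interpret P: pair_sigma_finite EXP ME
    by (intro pair_sigma_finite.intro prob_space_imp_sigma_finite prob_EXP ME.prob_space_axioms)
  let ?f = "\<lambda>E. indicator {E. event_time E m = s} E :: ennreal"
  have m [measurable]: "?f \<in> borel_measurable ME"
  proof -
    have "{E \<in> space ME. event_time E m = s} \<in> sets ME" by measurable
    then show ?thesis by simp
  qed
  have "(\<integral>\<^sup>+E. ?f E \<partial>ME) = (\<integral>\<^sup>+x. \<integral>\<^sup>+E. ?f (E(m := x)) \<partial>ME \<partial>EXP)"
    by (rule nn_integral_ME_resample[OF m])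
  also have "\<dots> = (\<integral>\<^sup>+E. \<integral>\<^sup>+x. ?f (E(m := x)) \<partial>EXP \<partial>ME)"
    by (rule P.Fubini'[symmetric]) (use measurable_ME_slot_upd[OF m] in simp)
  also have "\<dots> = (\<integral>\<^sup>+E. 0 \<partial>ME)"
  proof (rule nn_integral_cong)
    fix E
    have "\<exists>r. \<forall>x. event_time (E(m := x)) m = s \<longrightarrow> x = r"
    proof (cases "m \<ge> 0")
      case True
      then have "{0..m} = insert m {0..m - 1}" by auto
      then have "event_time (E(m := x)) m = x + (\<Sum>j\<in>{0..m - 1}. E j)" for x
        using True by (simp add: event_time_def)
      then show ?thesis by (intro exI[of _ "s - (\<Sum>j\<in>{0..m - 1}. E j)"]) auto
    next
      case False
      then have "{m..-1} = insert m {m + 1..-1}" by auto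
      then have "event_time (E(m := x)) m = - (x + (\<Sum>j\<in>{m + 1..-1}. E j))" for x
        using False by (simp add: event_time_def)
      then show ?thesis by (intro exI[of _ "- s - (\<Sum>j\<in>{m + 1..-1}. E j)"]) auto
    qed
    then obtain r where r: "\<And>x. event_time (E(m := x)) m = s \<Longrightarrow> x = r" by blast
    have "(\<integral>\<^sup>+x. ?f (E(m := x)) \<partial>EXP) \<le> (\<integral>\<^sup>+x. indicator {r} x \<partial>EXP)"
    proof (intro nn_integral_mono)
      fix x show "?f (E(m := x)) \<le> indicator {r} x"
        using r[of x] by (cases "event_time (E(m := x)) m = s") auto
    qed
    also have "\<dots> = emeasure EXP {r}" by simp
    also have "\<dots> = 0"
    proof -
      have "AE x in lborel. x \<noteq> r" by (rule AE_lborel_singleton)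
      then have "AE x in EXP. x \<notin> {r}" unfolding EXP_def by (subst AE_density) (auto elim!: eventually_mono)
      then show ?thesis by (subst (asm) AE_iff_measurable[OF _ refl]) auto
    qed
    finally show "(\<integral>\<^sup>+x. ?f (E(m := x)) \<partial>EXP) = 0" by simp
  qed
  finally have "(\<integral>\<^sup>+E. ?f E \<partial>ME) = 0" by simp
  then have "AE E in ME. ?f E = 0" by (subst (asm) nn_integral_0_iff_AE) (use m in auto)
  then show "AE E in ME. event_time E m \<noteq> s" by eventually_elim (auto simp: indicator_def split: if_splits)
qed

fun counts :: "(int \<Rightarrow> real) \<Rightarrow> real list \<Rightarrow> nat list" where
  "counts E (s # s' # ts) = card {m. s' < event_time E m \<and> event_time E m \<le> s} # counts E (s' # ts)"
| "counts E _ = []"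

lemma length_counts [simp]: "length (counts E ts) = length ts - 1"
  by (induction E ts rule: counts.induct) auto

lemma counts_append: "counts E (ps @ s # ns) = counts E (ps @ [s]) @ counts E (s # ns)"
  by (induction ps rule: induct_list012) auto

lemma event_time_sign:
  assumes "goodE E"
  shows "0 < event_time E (int j)" "event_time E (- 1 - int j) < 0"
proof -
  have y: "0 < gaps_pos_seq E i" "0 < gaps_neg_seq E i" for i using assms by (auto simp: goodE_def gaps_pos_seq_def gaps_neg_seq_def)
  show "0 < event_time E (int j)" unfolding event_time_pos using partial_sum_pos_ge[of "gaps_pos_seq E" j] y by (meson less_le_trans)
  show "event_time E (- 1 - int j) < 0" unfolding event_time_neg using partial_sum_pos_ge[of "gaps_neg_seq E" j] y(2)
    by (smt (verit))
qed

lemma events_pos: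
  assumes "goodE E" "0 \<le> s"
  shows "{m. s < event_time E m \<and> event_time E m \<le> u} = int ` {j. s < partial_sum (gaps_pos_seq E) (Suc j) \<and> partial_sum (gaps_pos_seq E) (Suc j) \<le> u}" (is "?A = int ` ?B")
proof (intro equalityI subsetI)
  fix m assume m: "m \<in> ?A"
  show "m \<in> int ` ?B"
  proof (cases m rule: int_cases_pn)
    case (1 j) then show ?thesis using m by (auto simp: event_time_pos)
  next
    case (2 j) then show ?thesis using m event_time_sign(2)[OF assms(1), of j] assms(2) by auto
  qed
qed (auto simp: event_time_pos)

lemma events_neg:
  assumes "goodE E" "u \<le> 0"
  shows "{m. s < event_time E m \<and> event_time E m \<le> u} = (\<lambda>j. - 1 - int j) ` {j. - u \<le> partial_sum (gaps_neg_seq E) (Suc j) \<and> partial_sum (gaps_neg_seq E) (Suc j) < - s}" (is "?A = ?f ` ?B")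
proof (intro equalityI subsetI)
  fix m assume m: "m \<in> ?A"
  show "m \<in> ?f ` ?B"
  proof (cases m rule: int_cases_pn)
    case (2 j) then show ?thesis using m by (auto simp: event_time_neg)
  next
    case (1 j) then show ?thesis using m event_time_sign(1)[OF assms(1), of j] assms(2) by auto
  qed
qed (auto simp: event_time_neg)

lemma counts_pos:
  assumes E: "goodE E"
  shows "sorted_wrt (>) ps \<Longrightarrow> ps \<noteq> [] \<Longrightarrow> 0 \<le> last ps \<Longrightarrow> length cs = length ps - 1 \<Longrightarrow>
    counts E ps = cs \<longleftrightarrow> counts_match (rev (zip (gaps ps) cs)) (last ps) (gaps_pos_seq E)"
proof (induction ps arbitrary: cs rule: induct_list012)
  case (3 s s' ts)
  then obtain c cs' where cs: "cs = c # cs'" by (cases cs) auto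
  have len: "length cs' = length (s' # ts) - 1" using 3 cs by simp
  have l: "last ts \<le> s'" if "ts \<noteq> []" using 3(3) that by (force simp: less_imp_le)
  then have l0: "0 \<le> s'" using 3(5) by (cases "ts = []") auto
  have "map fst (rev (zip (gaps (s' # ts)) cs')) = rev (gaps (s' # ts))"
    using len by (simp add: rev_map[symmetric])
  then have "last (s' # ts) + sum_list (map fst (rev (zip (gaps (s' # ts)) cs'))) = s'"
    using sum_gaps[of "s' # ts"] by (simp add: sum_list.rev del: last.simps)
  moreover have "counts E (s' # ts) = cs' \<longleftrightarrow> counts_match (rev (zip (gaps (s' # ts)) cs')) (last (s' # ts)) (gaps_pos_seq E)"
    by (rule 3(2)) (use 3 len in auto)
  moreover have "card {m. s' < event_time E m \<and> event_time E m \<le> s} = card {j. s' < partial_sum (gaps_pos_seq E) (Suc j) \<and> partial_sum (gaps_pos_seq E) (Suc j) \<le> s}"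
    unfolding events_pos[OF E l0] by (simp add: card_image)
  ultimately show ?case unfolding cs by (auto simp: counts_match_append)
qed auto

lemma counts_neg:
  assumes E: "goodE E"
  shows "sorted_wrt (>) (s # ns) \<Longrightarrow> s \<le> 0 \<Longrightarrow> (\<forall>u\<in>set (s # ns). \<forall>m. event_time E m \<noteq> u) \<or> s = 0 \<and> (\<forall>u\<in>set ns. \<forall>m. event_time E m \<noteq> u) \<Longrightarrow>
    length cs = length ns \<Longrightarrow>
    counts E (s # ns) = cs \<longleftrightarrow> counts_match (zip (gaps (s # ns)) cs) (- s) (gaps_neg_seq E)"
proof (induction ns arbitrary: s cs)
  case (Cons s' ts)
  then obtain c cs' where cs: "cs = c # cs'" by (cases cs) auto
  have ne: "partial_sum (gaps_neg_seq E) (Suc j) \<noteq> - s" "partial_sum (gaps_neg_seq E) (Suc j) \<noteq> - s'" for j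
  proof -
    have "event_time E (- 1 - int j) \<noteq> s" using Cons.prems(3) event_time_sign(2)[OF E, of j] by auto
    then show "partial_sum (gaps_neg_seq E) (Suc j) \<noteq> - s" unfolding event_time_neg by auto
    have "event_time E (- 1 - int j) \<noteq> s'" using Cons.prems(3) by auto
    then show "partial_sum (gaps_neg_seq E) (Suc j) \<noteq> - s'" unfolding event_time_neg by auto
  qed
  have "counts E (s' # ts) = cs' \<longleftrightarrow> counts_match (zip (gaps (s' # ts)) cs') (- s') (gaps_neg_seq E)"
    by (rule Cons.IH) (use Cons.prems cs in auto)
  moreover have "{j. - s \<le> partial_sum (gaps_neg_seq E) (Suc j) \<and> partial_sum (gaps_neg_seq E) (Suc j) < - s'}
     = {j. - s < partial_sum (gaps_neg_seq E) (Suc j) \<and> partial_sum (gaps_neg_seq E) (Suc j) \<le> - s'}"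
  proof (intro Collect_cong)
    fix j show "(- s \<le> partial_sum (gaps_neg_seq E) (Suc j) \<and> partial_sum (gaps_neg_seq E) (Suc j) < - s') =
       (- s < partial_sum (gaps_neg_seq E) (Suc j) \<and> partial_sum (gaps_neg_seq E) (Suc j) \<le> - s')"
      using ne[of j] by auto
  qed
  then have "card {m. s' < event_time E m \<and> event_time E m \<le> s} = card {j. - s < partial_sum (gaps_neg_seq E) (Suc j) \<and> partial_sum (gaps_neg_seq E) (Suc j) \<le> - s'}"
    unfolding events_neg[OF E Cons.prems(2)] by (subst card_image) (auto simp: inj_on_def)
  ultimately show ?case unfolding cs by simp
qed auto

lemma poisson_prod_append: "poisson_prod (L @ L') = poisson_prod L * poisson_prod L'"
  by (simp add: poisson_prod_def)

lemma poisson_prod_rev: "poisson_prod (rev L) = poisson_prod L"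
  by (simp add: poisson_prod_def prod_list.rev flip: rev_map)

lemma counts_law:
  assumes ts: "sorted_wrt (>) ts" "0 \<in> set ts" and len: "length cs = length ts - 1"
  shows "AE E in ME. (counts E ts = cs) = (P E)
     \<Longrightarrow> Measurable.pred ME P \<Longrightarrow> emeasure ME {E. P E} = ennreal (poisson_prod (zip (gaps ts) cs))"
proof -
  assume AEP: "AE E in ME. (counts E ts = cs) = (P E)" and Pm [measurable]: "Measurable.pred ME P"
  from ts(2) obtain ps ns where ts_eq: "ts = ps @ 0 # ns" by (meson split_list)
  define c1 where "c1 = take (length ps) cs"
  define c2 where "c2 = drop (length ps) cs"
  have l1: "length c1 = length (ps @ [0]) - 1" and l2: "length c2 = length ns"
    using len by (auto simp: c1_def c2_def ts_eq)
  have cs: "cs = c1 @ c2" by (simp add: c1_def c2_def)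
  define L1 where "L1 = rev (zip (gaps (ps @ [0])) c1)"
  define L2 where "L2 = zip (gaps (0 # ns)) c2"
  have srt: "sorted_wrt (>) (ps @ [0])" "sorted_wrt (>) (0 # ns)"
    using ts(1) by (auto simp: ts_eq sorted_wrt_append)
  have L1: "\<forall>(d, c)\<in>set L1. 0 \<le> d" and L2: "\<forall>(d, c)\<in>set L2. 0 \<le> d"
    unfolding L1_def L2_def
    using gaps_pos[OF srt(1)] gaps_pos[OF srt(2)] by (auto dest!: set_zip_leftD intro: less_imp_le)
  have mc [measurable]: "Measurable.pred ME (\<lambda>E. gaps_match L (gaps_neg_seq E))" "Measurable.pred ME (\<lambda>E. gaps_match L (gaps_pos_seq E))" for L
    by (rule measurable_gaps_match; simp add: gaps_neg_seq_def gaps_pos_seq_def)+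
  have ne: "AE E in ME. \<forall>u\<in>set ts. \<forall>m. event_time E m \<noteq> u"
    by (subst AE_finite_all) (auto intro: AE_no_event)
  have ae: "AE E in ME. P E \<longleftrightarrow> gaps_match L1 (gaps_pos_seq E) \<and> gaps_match L2 (gaps_neg_seq E)"
    using ne AE_goodE AEP
  proof eventually_elim
    case (elim E)
    have y: "0 < gaps_pos_seq E i" "0 < gaps_neg_seq E i" for i using elim by (auto simp: goodE_def gaps_pos_seq_def gaps_neg_seq_def)
    have f: "finite {j. partial_sum (gaps_pos_seq E) (Suc j) \<le> v}" "finite {j. partial_sum (gaps_neg_seq E) (Suc j) \<le> v}" for v
      using elim by (auto simp: goodE_def)
    have "counts E ts = cs \<longleftrightarrow> counts E (ps @ [0]) = c1 \<and> counts E (0 # ns) = c2"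
      unfolding ts_eq cs by (subst counts_append, subst append_eq_append_conv) (use l1 l2 in auto)
    also have "counts E (ps @ [0]) = c1 \<longleftrightarrow> counts_match L1 0 (gaps_pos_seq E)"
      using counts_pos[OF elim(2) srt(1) _ _ l1] by (simp add: L1_def)
    also have "counts E (0 # ns) = c2 \<longleftrightarrow> counts_match L2 0 (gaps_neg_seq E)"
      using counts_neg[OF elim(2) srt(2) _ _ l2] elim(1) by (simp add: L2_def ts_eq)
    finally show ?case
      using elim(3) gaps_match_iff_counts_match[OF y(1) f(1) L1] gaps_match_iff_counts_match[OF y(2) f(2) L2] by simp
  qed
  have i1: "inj int" and i2: "inj (\<lambda>i. - 1 - int i)" by (auto simp: inj_def)
  have pm: "{E. P E} \<in> sets ME"
  proof -
    have "{E \<in> space ME. P E} \<in> sets ME" by measurable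
    then show ?thesis by simp
  qed
  have "emeasure ME {E. P E} = (\<integral>\<^sup>+E. indicator {E. P E} E \<partial>ME)" using pm by simp
  also have "\<dots> = (\<integral>\<^sup>+E. (if gaps_match L1 (\<lambda>i. E (int (i + 0))) then (if gaps_match L2 (gaps_neg_seq E) then 1 else 0) else 0) \<partial>ME)"
    by (rule nn_integral_cong_AE) (use ae in eventually_elim, auto simp: gaps_pos_seq_def[abs_def])
  also have "\<dots> = ennreal (poisson_prod L1) * (\<integral>\<^sup>+E. (if gaps_match L2 (gaps_neg_seq E) then 1 else 0) \<partial>ME)"
  proof (rule gaps_match_law[OF i1 _ L1])
    fix E :: "int \<Rightarrow> real" and i :: nat and x :: real
    have "gaps_neg_seq (E(int i := x)) = gaps_neg_seq E" by (auto simp: gaps_neg_seq_def fun_eq_iff)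
    then show "(if gaps_match L2 (gaps_neg_seq (E(int i := x))) then 1 else 0) = (if gaps_match L2 (gaps_neg_seq E) then 1 else (0::ennreal))" by simp
  qed measurable
  also have "(\<integral>\<^sup>+E. (if gaps_match L2 (gaps_neg_seq E) then 1 else 0) \<partial>ME)
      = (\<integral>\<^sup>+E. (if gaps_match L2 (\<lambda>i. E (- 1 - int (i + 0))) then 1 else 0) \<partial>ME)" by (simp add: gaps_neg_seq_def[abs_def])
  also have "\<dots> = ennreal (poisson_prod L2) * (\<integral>\<^sup>+E. 1 \<partial>ME)"
    by (rule gaps_match_law[OF i2 _ L2]) auto
  also have "(\<integral>\<^sup>+E. 1 \<partial>ME) = 1" using ME.emeasure_space_1 by simp
  also have "ennreal (poisson_prod L1) * (ennreal (poisson_prod L2) * 1) = ennreal (poisson_prod L1 * poisson_prod L2)"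
    using poisson_prod_nonneg[OF L1] poisson_prod_nonneg[OF L2] by (simp add: ennreal_mult)
  also have "poisson_prod L1 * poisson_prod L2 = poisson_prod (zip (gaps ts) cs)"
    unfolding L1_def L2_def poisson_prod_rev ts_eq cs
    by (subst gaps_append, subst zip_append) (use l1 in \<open>auto simp: poisson_prod_append\<close>)
  finally show ?thesis .
qed

definition event_list :: "(int \<Rightarrow> real) \<Rightarrow> real \<Rightarrow> real \<Rightarrow> int list" where
  "event_list E s u = sorted_list_of_set {m. s < event_time E m \<and> event_time E m \<le> u}"

lemma measurable_event_list [measurable]: "(\<lambda>E. event_list E s u) \<in> measurable ME (count_space UNIV)"
  unfolding event_list_def by (rule measurable_sorted_list_of_Collect) measurable

lemma measurable_counts [measurable]: "(\<lambda>E. counts E ts) \<in> measurable ME (count_space UNIV)"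
proof (induction ts rule: induct_list012)
  case (3 s s' ts)
  have "(\<lambda>E. length (event_list E s' s)) \<in> measurable ME (count_space UNIV)" by measurable
  moreover have "length (event_list E s' s) = card {m. s' < event_time E m \<and> event_time E m \<le> s}" for E
    by (simp add: event_list_def)
  ultimately show ?case using 3(2) by (auto intro!: measurable_comp2_countable)
qed auto

fun poisson_counts :: "real list \<Rightarrow> nat list pmf" where
  "poisson_counts (s # s' # ts) = map_pmf (\<lambda>(c, cs). c # cs) (pair_pmf (poisson_pmf (mu * (s - s'))) (poisson_counts (s' # ts)))"
| "poisson_counts _ = return_pmf []"

lemma pmf_poisson_counts:
  "sorted_wrt (>) ts \<Longrightarrow> pmf (poisson_counts ts) cs = (if length cs = length ts - 1 then poisson_prod (zip (gaps ts) cs) else 0)"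
proof (induction ts arbitrary: cs rule: induct_list012)
  case (3 s s' ts)
  have r: "0 < mu * (s - s')" using 3(3) mu_pos by simp
  show ?case
  proof (cases cs)
    case Nil
    then show ?thesis by (auto simp: pmf_eq_0_set_pmf)
  next
    case (Cons c cs')
    have "pmf (poisson_counts (s # s' # ts)) cs = pmf (pair_pmf (poisson_pmf (mu * (s - s'))) (poisson_counts (s' # ts))) (c, cs')"
      unfolding Cons poisson_counts.simps
      using pmf_map_inj'[of "\<lambda>(c, cs). c # cs" _ "(c, cs')"] by (simp add: inj_def)
    then show ?thesis using 3(2)[of cs'] 3(3) r Cons by (auto simp: pmf_pair poisson_weight_def)
  qed
qed auto

lemma distr_counts:
  assumes "sorted_wrt (>) ts" "0 \<in> set ts"
  shows "distr ME (count_space UNIV) (\<lambda>E. counts E ts) = measure_pmf (poisson_counts ts)"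
proof (rule measure_eqI_countable[of _ UNIV])
  fix cs :: "nat list"
  have vi: "(\<lambda>E. counts E ts) -` {cs} = {E. counts E ts = cs}" by auto
  have P: "Measurable.pred ME (\<lambda>E. counts E ts = cs)" by measurable
  show "emeasure (distr ME (count_space UNIV) (\<lambda>E. counts E ts)) {cs} = emeasure (measure_pmf (poisson_counts ts)) {cs}"
  proof (cases "length cs = length ts - 1")
    case True
    show ?thesis
      using counts_law[OF assms True _ P] True
      by (subst emeasure_distr) (auto simp: vi emeasure_pmf_single pmf_poisson_counts[OF assms(1)])
  next
    case False
    then have "{E. counts E ts = cs} = {}" by auto
    then show ?thesis using False
      by (subst emeasure_distr) (auto simp: vi emeasure_pmf_single pmf_poisson_counts[OF assms(1)])
  qed
qed auto

lemma integral_counts: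
  fixes H :: "nat list \<Rightarrow> real"
  assumes "sorted_wrt (>) ts" "0 \<in> set ts"
  shows "(\<integral>E. H (counts E ts) \<partial>ME) = measure_pmf.expectation (poisson_counts ts) H"
  unfolding distr_counts[OF assms, symmetric] by (subst integral_distr) auto

fun chain_val_counts :: "(real \<Rightarrow> real \<Rightarrow> (nat \<Rightarrow> nat) \<Rightarrow> real) \<Rightarrow> (real \<Rightarrow> (nat \<Rightarrow> nat) \<Rightarrow> real)
    \<Rightarrow> nat list \<Rightarrow> real list \<Rightarrow> (nat \<Rightarrow> nat) \<Rightarrow> real" where
  "chain_val_counts G C (c # cs) (s # s' # ts) x
    = G s s' x * (event_avg ^^ c) (sample_avg s' (\<lambda>x. C s' x * chain_val_counts G C cs (s' # ts) x)) x"
| "chain_val_counts G C _ [s] x = G s s x"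
| "chain_val_counts G C _ _ x = 1"

lemma chain_val_counts_fun: "chain_val_counts G C cs [s] = G s s" "chain_val_counts G C cs [] = (\<lambda>_. 1)"
  by (rule ext; cases cs; simp)+

lemma unit_bdd_chain_val_counts:
  assumes "\<And>s s'. s' \<le> s \<Longrightarrow> unit_bdd (G s s')" "\<And>s. unit_bdd (C s)"
  shows "sorted_wrt (>) ts \<Longrightarrow> unit_bdd (chain_val_counts G C cs ts)"
proof (induction ts arbitrary: cs rule: induct_list012)
  case (3 s s' ts)
  show ?case
  proof (cases cs)
    case Nil then show ?thesis by (auto simp: unit_bdd_def)
  next
    case (Cons c cs')
    show ?thesis unfolding Cons chain_val_counts.simps
      by (intro unit_bdd_mult unit_bdd_event_avg_pow unit_bdd_sample_avg assms) (use 3 assms in auto)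
  qed
qed (use assms in \<open>auto simp: chain_val_counts_fun unit_bdd_one\<close>)

lemma event_avg_integral:
  assumes "\<And>c. unit_bdd (f c)" "valid x"
  shows "event_avg (\<lambda>x. measure_pmf.expectation p (\<lambda>c. f c x)) x = measure_pmf.expectation p (\<lambda>c. event_avg (f c) x)"
proof -
  have "integrable (measure_pmf p) (\<lambda>c. f c y)" if "valid y" for y
    by (rule measure_pmf.integrable_const_bound[of _ 1]) (use assms that in \<open>auto simp: unit_bdd_def\<close>)
  then show ?thesis unfolding event_avg_def
    using assms(2) by (simp add: valid_back Bochner_Integration.integral_sum del: of_nat_mult)
qed

lemma sample_avg_integral:
  assumes "\<And>c. unit_bdd (f c)" "valid x"
  shows "sample_avg s (\<lambda>x. measure_pmf.expectation p (\<lambda>c. f c x)) x = measure_pmf.expectation p (\<lambda>c. sample_avg s (f c) x)"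
proof -
  have "integrable (measure_pmf p) (\<lambda>c. f c y)" if "valid y" for y
    by (rule measure_pmf.integrable_const_bound[of _ 1]) (use assms that in \<open>auto simp: unit_bdd_def\<close>)
  then show ?thesis unfolding sample_avg_def
    using assms(2) by (simp add: valid_slot_upd Bochner_Integration.integral_sum del: of_nat_mult)
qed

lemma event_avg_cong: "(\<And>x. valid x \<Longrightarrow> f x = h x) \<Longrightarrow> valid x \<Longrightarrow> event_avg f x = event_avg h x"
  unfolding event_avg_def by (simp add: valid_back cong: sum.cong)

lemma sample_avg_cong: "(\<And>x. valid x \<Longrightarrow> f x = h x) \<Longrightarrow> valid x \<Longrightarrow> sample_avg s f x = sample_avg s h x"
  unfolding sample_avg_def by (rule arg_cong[where f = "\<lambda>z. z / real n"], rule sum.cong) (auto simp: valid_slot_upd)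

lemma event_avg_pow_cong: "(\<And>x. valid x \<Longrightarrow> f x = h x) \<Longrightarrow> valid x \<Longrightarrow> (event_avg ^^ c) f x = (event_avg ^^ c) h x"
  by (induction c arbitrary: x) (auto intro: event_avg_cong)

lemma event_avg_pow_integral:
  assumes "\<And>c. unit_bdd (f c)"
  shows "valid x \<Longrightarrow> (event_avg ^^ m) (\<lambda>x. measure_pmf.expectation p (\<lambda>c. f c x)) x = measure_pmf.expectation p (\<lambda>c. (event_avg ^^ m) (f c) x)"
proof (induction m arbitrary: x)
  case (Suc m)
  have "(event_avg ^^ Suc m) (\<lambda>x. measure_pmf.expectation p (\<lambda>c. f c x)) x
     = event_avg (\<lambda>x. measure_pmf.expectation p (\<lambda>c. (event_avg ^^ m) (f c) x)) x"
    using Suc by (auto intro: event_avg_cong)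
  also have "\<dots> = measure_pmf.expectation p (\<lambda>c. event_avg ((event_avg ^^ m) (f c)) x)"
    by (rule event_avg_integral) (use unit_bdd_event_avg_pow assms Suc in auto)
  finally show ?case by simp
qed simp

lemma expectation_chain_val_counts:
  assumes G: "\<And>s s'. s' \<le> s \<Longrightarrow> unit_bdd (G s s')" and C: "\<And>s. unit_bdd (C s)"
  shows "sorted_wrt (>) ts \<Longrightarrow> valid x \<Longrightarrow>
    measure_pmf.expectation (poisson_counts ts) (\<lambda>cs. chain_val_counts G C cs ts x) = chain_val G C ts x"
proof (induction ts arbitrary: x rule: induct_list012)
  case (3 s s' ts)
  let ?p = "poisson_pmf (mu * (s - s'))" and ?q = "poisson_counts (s' # ts)"
  let ?S = "\<lambda>cs. sample_avg s' (\<lambda>x. C s' x * chain_val_counts G C cs (s' # ts) x)"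
  have srt: "sorted_wrt (>) (s' # ts)" using 3 by simp
  note bdd = unit_bdd_chain_val_counts[of G C, OF G C srt]
  have S: "unit_bdd (?S cs)" for cs by (intro unit_bdd_sample_avg unit_bdd_mult C bdd)
  have le: "s' \<le> s" using 3 by auto
  have "measure_pmf.expectation (poisson_counts (s # s' # ts)) (\<lambda>cs. chain_val_counts G C cs (s # s' # ts) x)
    = measure_pmf.expectation (pair_pmf ?p ?q) (\<lambda>(c, cs). G s s' x * (event_avg ^^ c) (?S cs) x)"
    by (simp add: case_prod_unfold)
  also have "\<dots> = measure_pmf.expectation ?p (\<lambda>c. measure_pmf.expectation ?q (\<lambda>cs. G s s' x * (event_avg ^^ c) (?S cs) x))"
    by (rule integral_pair_pmf_unit)
       (use unit_bdd_mult[OF G[OF le] unit_bdd_event_avg_pow[OF S]] 3(4) in \<open>auto simp: unit_bdd_def\<close>)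
  also have "\<dots> = G s s' x * measure_pmf.expectation ?p (\<lambda>c. measure_pmf.expectation ?q (\<lambda>cs. (event_avg ^^ c) (?S cs) x))"
    by simp
  also have "\<dots> = G s s' x * measure_pmf.expectation ?p (\<lambda>c. (event_avg ^^ c) (sample_avg s' (\<lambda>x. C s' x * chain_val G C (s' # ts) x)) x)"
  proof -
    have "measure_pmf.expectation ?q (\<lambda>cs. (event_avg ^^ c) (?S cs) x)
       = (event_avg ^^ c) (sample_avg s' (\<lambda>x. C s' x * chain_val G C (s' # ts) x)) x" for c
    proof -
      have "measure_pmf.expectation ?q (\<lambda>cs. (event_avg ^^ c) (?S cs) x)
         = (event_avg ^^ c) (\<lambda>x. measure_pmf.expectation ?q (\<lambda>cs. ?S cs x)) x"
        by (rule event_avg_pow_integral[symmetric]) (use S 3 in auto)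
      also have "\<dots> = (event_avg ^^ c) (sample_avg s' (\<lambda>x. C s' x * chain_val G C (s' # ts) x)) x"
      proof (rule event_avg_pow_cong[OF _ 3(4)])
        fix x assume x: "valid x"
        have "measure_pmf.expectation ?q (\<lambda>cs. ?S cs x)
          = sample_avg s' (\<lambda>x. measure_pmf.expectation ?q (\<lambda>cs. C s' x * chain_val_counts G C cs (s' # ts) x)) x"
          by (rule sample_avg_integral[symmetric]) (use x in \<open>auto intro!: unit_bdd_mult C bdd\<close>)
        also have "\<dots> = sample_avg s' (\<lambda>x. C s' x * chain_val G C (s' # ts) x) x"
          using 3(2)[OF srt] by (intro sample_avg_cong x) simp
        finally show "measure_pmf.expectation ?q (\<lambda>cs. ?S cs x) = sample_avg s' (\<lambda>x. C s' x * chain_val G C (s' # ts) x) x" .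
      qed
      finally show ?thesis .
    qed
    then show ?thesis by simp
  qed
  finally show ?case by (simp add: poisson_avg_def)
qed auto

end

section \<open>Ancestral slots as iterated averages\<close>

lemma measurable_map_countable:
  fixes w :: "'z \<Rightarrow> 'i \<Rightarrow> 'a::countable"
  assumes "\<And>i. i \<in> set l \<Longrightarrow> (\<lambda>z. w z i) \<in> measurable N (count_space UNIV)"
  shows "(\<lambda>z. map (w z) l) \<in> measurable N (count_space UNIV)"
  using assms
proof (induction l)
  case (Cons a l)
  have "(\<lambda>z. (#) (w z a) (map (w z) l)) \<in> measurable N (count_space UNIV)"
    by (rule measurable_comp2_countable) (use Cons in auto)
  then show ?case by simp
qed simp

lemma measurable_finite_dep:
  fixes f :: "('i \<Rightarrow> 'a::countable) \<Rightarrow> 'c::topological_space"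
  assumes "finite A" and dep: "\<And>w w'. (\<And>i. i \<in> A \<Longrightarrow> w i = w' i) \<Longrightarrow> f w = f w'"
    and "\<And>i. i \<in> A \<Longrightarrow> (\<lambda>z. w z i) \<in> measurable N (count_space UNIV)"
  shows "(\<lambda>z. f (w z)) \<in> borel_measurable N"
proof -
  obtain l where l: "set l = A" using assms(1) finite_list by blast
  define F where "F vs = f (\<lambda>i. the (map_of (zip l vs) i))" for vs
  have "f (w z) = F (map (w z) l)" for z
    unfolding F_def by (rule dep) (auto simp: l[symmetric] map_of_zip_map)
  moreover have "(\<lambda>z. F (map (w z) l)) \<in> borel_measurable N"
    by (rule measurable_compose[OF measurable_map_countable]) (use assms l in auto)
  ultimately show ?thesis by simp
qed

context smgp begin

definition MK :: "(int \<Rightarrow> nat \<times> nat) measure" where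
  "MK = PiM UNIV (\<lambda>_. measure_pmf (pmf_of_set (moran_pairs n)))"

definition MX :: "(nat \<Rightarrow> nat) measure" where
  "MX = PiM UNIV (\<lambda>_. measure_pmf (pmf_of_set {..<n}))"

abbreviation MKX :: "((int \<Rightarrow> nat \<times> nat) \<times> (nat \<Rightarrow> nat)) measure" where
  "MKX \<equiv> MK \<Otimes>\<^sub>M MX"

abbreviation MM :: "omega measure" where "MM \<equiv> smgp_space n mu"

lemma MM_eq: "MM = ME \<Otimes>\<^sub>M MKX"
  by (simp add: smgp_space_def ME_def EXP_def MK_def MX_def)

sublocale MK: prob_space MK
  unfolding MK_def by (intro prob_space_PiM measure_pmf.prob_space_axioms)

sublocale MX: prob_space MX
  unfolding MX_def by (intro prob_space_PiM measure_pmf.prob_space_axioms)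

sublocale MKX: pair_prob_space MK MX ..

sublocale EKX: pair_prob_space ME MKX ..

sublocale MM: prob_space MM
  unfolding MM_eq by (rule EKX.prob_space_axioms)

lemma space_MK [simp]: "space MK = UNIV" and space_MX [simp]: "space MX = UNIV"
  by (auto simp: MK_def MX_def space_PiM)

lemma space_MKX [simp]: "space MKX = UNIV"
  by (simp add: space_pair_measure)

lemma space_MM [simp]: "space MM = UNIV"
  by (simp add: MM_eq space_pair_measure)

lemma moran_pairs_nonempty: "moran_pairs n \<noteq> {}"
proof -
  have "(0, 1) \<in> moran_pairs n" using n2 by (auto simp: moran_pairs_def)
  then show ?thesis by blast
qed

lemma measurable_MK_coord [measurable]: "(\<lambda>mk. mk m) \<in> measurable MK (count_space UNIV)"
proof -
  have "(\<lambda>mk. mk m) \<in> measurable MK (measure_pmf (pmf_of_set (moran_pairs n)))"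
    unfolding MK_def by measurable
  then show ?thesis by (simp cong: measurable_cong_sets)
qed

lemma measurable_MX_coord [measurable]: "(\<lambda>X. X i) \<in> measurable MX (count_space UNIV)"
proof -
  have "(\<lambda>X. X i) \<in> measurable MX (measure_pmf (pmf_of_set {..<n}))"
    unfolding MX_def by measurable
  then show ?thesis by (simp cong: measurable_cong_sets)
qed

lemma measurable_MK_slot_upd: "(\<lambda>mk. mk(m := b)) \<in> measurable MK MK"
  unfolding MK_def by (rule measurable_fun_upd[where J = UNIV]) auto

lemma measurable_MX_slot_upd: "(\<lambda>X. X(m := b)) \<in> measurable MX MX"
  unfolding MX_def by (rule measurable_fun_upd[where J = UNIV]) auto

lemma resample_mark:
  assumes f [measurable]: "f \<in> borel_measurable MKX"
  shows "(\<integral>\<^sup>+z. f z \<partial>MKX) = (\<Sum>b\<in>moran_pairs n. \<integral>\<^sup>+z. f ((fst z)(m := b), snd z) \<partial>MKX) / real (n * (n - 1))"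
proof -
  have fm: "(\<lambda>z. f ((fst z)(m := b), snd z)) \<in> borel_measurable MKX" for b
    by (rule measurable_compose[OF _ f],
        intro measurable_Pair measurable_compose[OF measurable_fst measurable_MK_slot_upd] measurable_snd)
  have "(\<integral>\<^sup>+z. f z \<partial>MKX) = (\<integral>\<^sup>+mk. \<integral>\<^sup>+X. f (mk, X) \<partial>MX \<partial>MK)"
    by (rule MX.nn_integral_fst[symmetric]) measurable
  also have "\<dots> = (\<integral>\<^sup>+b. \<integral>\<^sup>+mk. \<integral>\<^sup>+X. f (mk(m := b), X) \<partial>MX \<partial>MK \<partial>measure_pmf (pmf_of_set (moran_pairs n)))"
    unfolding MK_def
    by (rule nn_integral_PiM_resample[OF measure_pmf.prob_space_axioms])
       (unfold MK_def[symmetric], measurable)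
  also have "\<dots> = (\<Sum>b\<in>moran_pairs n. \<integral>\<^sup>+mk. \<integral>\<^sup>+X. f (mk(m := b), X) \<partial>MX \<partial>MK) / card (moran_pairs n)"
    by (rule nn_integral_pmf_of_set) (auto simp: moran_pairs_nonempty)
  also have "\<dots> = (\<Sum>b\<in>moran_pairs n. \<integral>\<^sup>+z. f ((fst z)(m := b), snd z) \<partial>MKX) / card (moran_pairs n)"
    by (subst MX.nn_integral_fst[symmetric]) (rule fm, simp)
  finally show ?thesis by (simp only: card_moran_pairs ennreal_of_nat_eq_real_of_nat)
qed

lemma resample_sample:
  assumes f [measurable]: "f \<in> borel_measurable MKX"
  shows "(\<integral>\<^sup>+z. f z \<partial>MKX) = (\<Sum>y<n. \<integral>\<^sup>+z. f (fst z, (snd z)(i := y)) \<partial>MKX) / real n"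
proof -
  have fm: "(\<lambda>z. f (fst z, (snd z)(i := b))) \<in> borel_measurable MKX" for b
    by (rule measurable_compose[OF _ f],
        intro measurable_Pair measurable_compose[OF measurable_snd measurable_MX_slot_upd] measurable_fst)
  have "(\<integral>\<^sup>+z. f z \<partial>MKX) = (\<integral>\<^sup>+X. \<integral>\<^sup>+mk. f (mk, X) \<partial>MK \<partial>MX)"
    by (rule MKX.nn_integral_snd[symmetric]) measurable
  also have "\<dots> = (\<integral>\<^sup>+y. \<integral>\<^sup>+X. \<integral>\<^sup>+mk. f (mk, X(i := y)) \<partial>MK \<partial>MX \<partial>measure_pmf (pmf_of_set {..<n}))"
    unfolding MX_def
    by (rule nn_integral_PiM_resample[OF measure_pmf.prob_space_axioms])
       (unfold MX_def[symmetric], measurable)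
  also have "\<dots> = (\<Sum>y<n. \<integral>\<^sup>+X. \<integral>\<^sup>+mk. f (mk, X(i := y)) \<partial>MK \<partial>MX) / card {..<n}"
    by (rule nn_integral_pmf_of_set) (use n2 in \<open>auto simp: lessThan_empty_iff\<close>)
  also have "\<dots> = (\<Sum>y<n. \<integral>\<^sup>+z. f (fst z, (snd z)(i := y)) \<partial>MKX) / card {..<n}"
    by (subst MKX.nn_integral_snd[symmetric]) (rule fm, simp)
  finally show ?thesis by (simp only: card_lessThan ennreal_of_nat_eq_real_of_nat)
qed

definition apply_events :: "(int \<Rightarrow> nat \<times> nat) \<Rightarrow> int list \<Rightarrow> (nat \<Rightarrow> nat) \<Rightarrow> nat \<Rightarrow> nat" where
  "apply_events mk es x = (\<lambda>i. foldr (\<lambda>m. back_step (mk m)) es (x i))"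

definition sample_upd :: "real \<Rightarrow> (nat \<Rightarrow> nat) \<Rightarrow> (nat \<Rightarrow> nat) \<Rightarrow> nat \<Rightarrow> nat" where
  "sample_upd s X x = (\<lambda>i. if 1 \<le> i \<and> i \<le> Suc k \<and> t i = s then X i else x i)"

fun chain_path :: "(real \<Rightarrow> real \<Rightarrow> (nat \<Rightarrow> nat) \<Rightarrow> real) \<Rightarrow> (real \<Rightarrow> (nat \<Rightarrow> nat) \<Rightarrow> real)
    \<Rightarrow> int list list \<Rightarrow> real list \<Rightarrow> (nat \<Rightarrow> nat) \<Rightarrow> (int \<Rightarrow> nat \<times> nat) \<Rightarrow> (nat \<Rightarrow> nat) \<Rightarrow> real" where
  "chain_path G C (es # ess) (s # s' # ts) x mk X
    = G s s' x * (C s' (sample_upd s' X (apply_events mk es x)) * chain_path G C ess (s' # ts) (sample_upd s' X (apply_events mk es x)) mk X)"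
| "chain_path G C _ [s] x mk X = G s s x"
| "chain_path G C _ _ x mk X = 1"

lemma apply_events_cong: "(\<And>m. m \<in> set es \<Longrightarrow> mk m = mk' m) \<Longrightarrow> apply_events mk es x = apply_events mk' es x"
  unfolding apply_events_def by (intro ext foldr_cong) auto

lemma chain_path_cong:
  assumes "sorted_wrt (>) ts" "\<And>m. m \<in> set (concat ess) \<Longrightarrow> mk m = mk' m"
    "\<And>i. i \<in> {1..Suc k} \<Longrightarrow> t i < hd ts \<Longrightarrow> X i = X' i"
  shows "chain_path G C ess ts x mk X = chain_path G C ess ts x mk' X'"
  using assms
proof (induction G C ess ts x mk X arbitrary: mk' X' rule: chain_path.induct)
  case (1 G C es ess s s' ts x mk X)
  have st: "apply_events mk es x = apply_events mk' es x" using 1(3) by (intro apply_events_cong) auto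
  have sm: "sample_upd s' X y = sample_upd s' X' y" for y
  proof (rule ext)
    fix i show "sample_upd s' X y i = sample_upd s' X' y i"
      using 1(4)[of i] 1(2) by (auto simp: sample_upd_def)
  qed
  have "chain_path G C ess (s' # ts) (sample_upd s' X (apply_events mk es x)) mk X
      = chain_path G C ess (s' # ts) (sample_upd s' X (apply_events mk es x)) mk' X'"
    by (rule 1(1)) (use 1(2,3,4) in auto)
  then show ?case unfolding chain_path.simps st[symmetric] sm[symmetric] by simp
qed auto

lemma measurable_MKX_dep:
  fixes f :: "(int \<Rightarrow> nat \<times> nat) \<Rightarrow> (nat \<Rightarrow> nat) \<Rightarrow> real"
  assumes "finite A" "finite B"
    "\<And>mk mk' X X'. (\<And>m. m \<in> A \<Longrightarrow> mk m = mk' m) \<Longrightarrow> (\<And>i. i \<in> B \<Longrightarrow> X i = X' i) \<Longrightarrow> f mk X = f mk' X'"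
  shows "(\<lambda>z. f (fst z) (snd z)) \<in> borel_measurable MKX"
proof -
  define w where "w z i = (case i of Inl m \<Rightarrow> Inl (fst z m) | Inr j \<Rightarrow> Inr (snd z j))"
    for z :: "(int \<Rightarrow> nat \<times> nat) \<times> (nat \<Rightarrow> nat)" and i :: "int + nat"
  define F where "F v = f (\<lambda>m. case v (Inl m) of Inl b \<Rightarrow> b | Inr _ \<Rightarrow> undefined) (\<lambda>j. case v (Inr j) of Inr y \<Rightarrow> y | Inl _ \<Rightarrow> undefined)"
    for v :: "int + nat \<Rightarrow> (nat \<times> nat) + nat"
  have "(\<lambda>z. F (w z)) \<in> borel_measurable MKX"
  proof (rule measurable_finite_dep)
    show "finite (Inl ` A \<union> Inr ` B)" using assms by auto
    show "F v = F v'" if "\<And>i. i \<in> Inl ` A \<union> Inr ` B \<Longrightarrow> v i = v' i" for v v'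
      unfolding F_def by (rule assms(3)) (use that in auto)
    show "(\<lambda>z. w z i) \<in> measurable MKX (count_space UNIV)" for i
    proof (cases i)
      case (Inl m)
      have "(\<lambda>z. Inl (fst z m) :: (nat \<times> nat) + nat) \<in> measurable MKX (count_space UNIV)" by measurable
      then show ?thesis by (simp add: w_def Inl)
    next
      case (Inr m)
      have "(\<lambda>z. Inr (snd z m) :: (nat \<times> nat) + nat) \<in> measurable MKX (count_space UNIV)" by measurable
      then show ?thesis by (simp add: w_def Inr)
    qed
  qed
  then show ?thesis by (simp add: F_def w_def)
qed

lemma ennreal_avg:
  assumes "\<And>b. b \<in> A \<Longrightarrow> 0 \<le> f b" "0 < m"
  shows "(\<Sum>b\<in>A. ennreal (f b)) / ennreal (real m) = ennreal ((\<Sum>b\<in>A. f b) / real m)"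
  using assms by (simp add: sum_ennreal divide_ennreal sum_nonneg)

lemma measurable_chain_path_sample:
  assumes "sorted_wrt (>) ts"
  shows "(\<lambda>z. ennreal (C s (sample_upd s (snd z) (apply_events (fst z) es x)) *
     chain_path G C ess ts (sample_upd s (snd z) (apply_events (fst z) es x)) (fst z) (snd z))) \<in> borel_measurable MKX"
proof -
  have "(\<lambda>z. (\<lambda>mk X. C s (sample_upd s X (apply_events mk es x)) *
     chain_path G C ess ts (sample_upd s X (apply_events mk es x)) mk X) (fst z) (snd z)) \<in> borel_measurable MKX"
  proof (rule measurable_MKX_dep[of "set es \<union> set (concat ess)" "{1..Suc k}"])
    fix mk mk' :: "int \<Rightarrow> nat \<times> nat" and X X' :: "nat \<Rightarrow> nat"
    assume m: "\<And>m. m \<in> set es \<union> set (concat ess) \<Longrightarrow> mk m = mk' m" and X: "\<And>i. i \<in> {1..Suc k} \<Longrightarrow> X i = X' i"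
    have st: "apply_events mk es x = apply_events mk' es x" using m by (intro apply_events_cong) auto
    have sm: "sample_upd s X y = sample_upd s X' y" for y using X by (auto simp: sample_upd_def)
    have "chain_path G C ess ts y mk X = chain_path G C ess ts y mk' X'" for y
      by (rule chain_path_cong[OF assms]) (use m X in auto)
    then show "C s (sample_upd s X (apply_events mk es x)) * chain_path G C ess ts (sample_upd s X (apply_events mk es x)) mk X =
       C s (sample_upd s X' (apply_events mk' es x)) * chain_path G C ess ts (sample_upd s X' (apply_events mk' es x)) mk' X'"
      unfolding st sm by simp
  qed auto
  then show ?thesis by measurable
qed

lemma inner_sample:
  assumes G: "\<And>s s'. s' \<le> s \<Longrightarrow> unit_bdd (G s s')" and C: "\<And>s. unit_bdd (C s)"
    and srt: "sorted_wrt (>) (s # ts)" and x: "valid x"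
    and IH: "\<And>x. valid x \<Longrightarrow> (\<integral>\<^sup>+z. ennreal (chain_path G C ess (s # ts) x (fst z) (snd z)) \<partial>MKX)
        = ennreal (chain_val_counts G C (map length ess) (s # ts) x)"
  shows "(\<integral>\<^sup>+z. ennreal (C s (sample_upd s (snd z) x) * chain_path G C ess (s # ts) (sample_upd s (snd z) x) (fst z) (snd z)) \<partial>MKX)
     = ennreal (sample_avg s (\<lambda>x. C s x * chain_val_counts G C (map length ess) (s # ts) x) x)"
proof -
  have C0: "0 \<le> C s y" if "valid y" for y using C that by (auto simp: unit_bdd_def)
  have VC0: "0 \<le> chain_val_counts G C (map length ess) (s # ts) y" if "valid y" for y
    using unit_bdd_chain_val_counts[of G C, OF G C srt] that by (auto simp: unit_bdd_def)
  have one: "(\<integral>\<^sup>+z. ennreal (C s y * chain_path G C ess (s # ts) y (fst z) (snd z)) \<partial>MKX)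
     = ennreal (C s y * chain_val_counts G C (map length ess) (s # ts) y)" if y: "valid y" for y
  proof -
    have m: "(\<lambda>z. chain_path G C ess (s # ts) y (fst z) (snd z)) \<in> borel_measurable MKX"
      by (rule measurable_MKX_dep[of "set (concat ess)" "{1..Suc k}"]) (auto intro!: chain_path_cong[OF srt])
    have "(\<integral>\<^sup>+z. ennreal (C s y * chain_path G C ess (s # ts) y (fst z) (snd z)) \<partial>MKX)
       = (\<integral>\<^sup>+z. ennreal (C s y) * ennreal (chain_path G C ess (s # ts) y (fst z) (snd z)) \<partial>MKX)"
      using C0[OF y] by (simp add: ennreal_mult')
    also have "\<dots> = ennreal (C s y) * (\<integral>\<^sup>+z. ennreal (chain_path G C ess (s # ts) y (fst z) (snd z)) \<partial>MKX)"
      by (rule nn_integral_cmult) (use m in measurable)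
    finally show ?thesis using IH[OF y] C0[OF y] VC0[OF y] by (simp add: ennreal_mult)
  qed
  show ?thesis
  proof (cases "\<exists>i\<in>{1..Suc k}. t i = s")
    case False
    then have "sample_upd s X y = y" "slot_upd s v y = y" for X y v by (auto simp: sample_upd_def slot_upd_def fun_eq_iff)
    then show ?thesis using one[OF x] n2 by (simp add: sample_avg_def)
  next
    case True
    then obtain i where i: "i \<in> {1..Suc k}" "t i = s" by blast
    have sm: "sample_upd s (X(i := y)) x = slot_upd s y x" for X y
      using i t_eq_iff[of _ i] by (auto simp: sample_upd_def slot_upd_def fun_eq_iff)
    have uc: "chain_path G C ess (s # ts) v mk (X(i := y)) = chain_path G C ess (s # ts) v mk X" for v mk X y
      by (rule chain_path_cong[OF srt]) (use i in auto)
    have meas: "(\<lambda>z. ennreal (C s (sample_upd s (snd z) x) * chain_path G C ess (s # ts) (sample_upd s (snd z) x) (fst z) (snd z))) \<in> borel_measurable MKX"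
      using measurable_chain_path_sample[OF srt, of C s "[]" x G ess] by (simp add: apply_events_def)
    show ?thesis
      apply (subst resample_sample[OF meas, of i])
      apply (simp add: sm uc)
      apply (subst sum.cong[OF refl one])
       apply (use x valid_slot_upd in simp)
      apply (subst ennreal_avg)
      using n2 C0 VC0 x valid_slot_upd by (auto simp: sample_avg_def)
  qed
qed

lemma inner_steps:
  assumes G: "\<And>s s'. s' \<le> s \<Longrightarrow> unit_bdd (G s s')" and C: "\<And>s. unit_bdd (C s)"
    and srt: "sorted_wrt (>) (s # ts)"
    and IH: "\<And>x. valid x \<Longrightarrow> (\<integral>\<^sup>+z. ennreal (chain_path G C ess (s # ts) x (fst z) (snd z)) \<partial>MKX)
        = ennreal (chain_val_counts G C (map length ess) (s # ts) x)"
  shows "valid x \<Longrightarrow> distinct (es @ concat ess) \<Longrightarrow>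
    (\<integral>\<^sup>+z. ennreal (C s (sample_upd s (snd z) (apply_events (fst z) es x)) *
        chain_path G C ess (s # ts) (sample_upd s (snd z) (apply_events (fst z) es x)) (fst z) (snd z)) \<partial>MKX)
     = ennreal ((event_avg ^^ length es) (sample_avg s (\<lambda>x. C s x * chain_val_counts G C (map length ess) (s # ts) x)) x)"
proof (induction es arbitrary: x rule: rev_induct)
  case Nil
  then show ?case using inner_sample[OF G C srt _ IH, of x] by (simp add: apply_events_def)
next
  case (snoc m es)
  let ?h = "sample_avg s (\<lambda>x. C s x * chain_val_counts G C (map length ess) (s # ts) x)"
  let ?f = "\<lambda>es x z. ennreal (C s (sample_upd s (snd z) (apply_events (fst z) es x)) *
        chain_path G C ess (s # ts) (sample_upd s (snd z) (apply_events (fst z) es x)) (fst z) (snd z))"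
  have bdd: "unit_bdd ((event_avg ^^ c) ?h)" for c
    by (intro unit_bdd_event_avg_pow unit_bdd_sample_avg unit_bdd_mult C unit_bdd_chain_val_counts G srt)
  have st: "apply_events (mk(m := b)) (es @ [m]) x = apply_events mk es (\<lambda>i. back_step b (x i))" for mk b
  proof -
    have "apply_events (mk(m := b)) (es @ [m]) x = apply_events (mk(m := b)) es (\<lambda>i. back_step b (x i))"
      by (simp add: apply_events_def)
    also have "\<dots> = apply_events mk es (\<lambda>i. back_step b (x i))"
      using snoc.prems by (intro apply_events_cong) auto
    finally show ?thesis .
  qed
  have uc: "chain_path G C ess (s # ts) v (mk(m := b)) X = chain_path G C ess (s # ts) v mk X" for v mk X b
    by (rule chain_path_cong[OF srt]) (use snoc.prems in auto)
  have "(\<integral>\<^sup>+z. ?f (es @ [m]) x z \<partial>MKX)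
     = (\<Sum>b\<in>moran_pairs n. \<integral>\<^sup>+z. ?f (es @ [m]) x ((fst z)(m := b), snd z) \<partial>MKX) / real (n * (n - 1))"
    by (rule resample_mark[OF measurable_chain_path_sample[OF srt]])
  also have "\<dots> = (\<Sum>b\<in>moran_pairs n. \<integral>\<^sup>+z. ?f es (\<lambda>i. back_step b (x i)) z \<partial>MKX) / real (n * (n - 1))"
    by (simp only: fst_conv snd_conv st uc)
  also have "\<dots> = (\<Sum>b\<in>moran_pairs n. ennreal ((event_avg ^^ length es) ?h (\<lambda>i. back_step b (x i)))) / real (n * (n - 1))"
    by (subst sum.cong[OF refl snoc.IH]) (use snoc.prems valid_back in auto)
  also have "\<dots> = ennreal (event_avg ((event_avg ^^ length es) ?h) x)"
    unfolding event_avg_def[of "(event_avg ^^ length es) ?h"]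
    by (rule ennreal_avg) (use n2 bdd snoc.prems valid_back in \<open>auto simp: unit_bdd_def\<close>)
  finally show ?case by simp
qed

lemma inner_integral:
  assumes G: "\<And>s s'. s' \<le> s \<Longrightarrow> unit_bdd (G s s')" and C: "\<And>s. unit_bdd (C s)"
  shows "sorted_wrt (>) ts \<Longrightarrow> length ess = length ts - 1 \<Longrightarrow> distinct (concat ess) \<Longrightarrow> valid x \<Longrightarrow>
    (\<integral>\<^sup>+z. ennreal (chain_path G C ess ts x (fst z) (snd z)) \<partial>MKX) = ennreal (chain_val_counts G C (map length ess) ts x)"
proof (induction ts arbitrary: x ess rule: induct_list012)
  case 1 then show ?case using MKX.P.emeasure_space_1 by simp
next
  case (2 s) then show ?case using MKX.P.emeasure_space_1 by (simp add: chain_val_counts_fun)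
next
  case (3 s s' ts)
  then obtain es ess' where ess: "ess = es # ess'" by (cases ess) auto
  have srt: "sorted_wrt (>) (s' # ts)" and le: "s' \<le> s" using 3 by auto
  have IH: "(\<integral>\<^sup>+z. ennreal (chain_path G C ess' (s' # ts) x (fst z) (snd z)) \<partial>MKX) = ennreal (chain_val_counts G C (map length ess') (s' # ts) x)"
    if "valid x" for x by (rule 3(2)) (use 3 ess that in auto)
  let ?h = "sample_avg s' (\<lambda>x. C s' x * chain_val_counts G C (map length ess') (s' # ts) x)"
  have bdd: "unit_bdd ((event_avg ^^ c) ?h)" for c
    by (intro unit_bdd_event_avg_pow unit_bdd_sample_avg unit_bdd_mult C unit_bdd_chain_val_counts G srt)
  have G0: "0 \<le> G s s' x" using G[OF le] 3 by (auto simp: unit_bdd_def)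
  have "(\<integral>\<^sup>+z. ennreal (chain_path G C ess (s # s' # ts) x (fst z) (snd z)) \<partial>MKX)
    = (\<integral>\<^sup>+z. ennreal (G s s' x) * ennreal (C s' (sample_upd s' (snd z) (apply_events (fst z) es x)) *
        chain_path G C ess' (s' # ts) (sample_upd s' (snd z) (apply_events (fst z) es x)) (fst z) (snd z)) \<partial>MKX)"
    using G0 by (simp add: ess ennreal_mult')
  also have "\<dots> = ennreal (G s s' x) * (\<integral>\<^sup>+z. ennreal (C s' (sample_upd s' (snd z) (apply_events (fst z) es x)) *
        chain_path G C ess' (s' # ts) (sample_upd s' (snd z) (apply_events (fst z) es x)) (fst z) (snd z)) \<partial>MKX)"
    by (rule nn_integral_cmult[OF measurable_chain_path_sample[OF srt]])
  also have "\<dots> = ennreal (G s s' x) * ennreal ((event_avg ^^ length es) ?h x)"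
    by (subst inner_steps[OF G C srt IH]) (use 3 ess in auto)
  also have "\<dots> = ennreal (chain_val_counts G C (map length ess) (s # s' # ts) x)"
    using G0 bdd 3 by (auto simp: ess ennreal_mult unit_bdd_def)
  finally show ?case .
qed

fun event_lists :: "(int \<Rightarrow> real) \<Rightarrow> real list \<Rightarrow> int list list" where
  "event_lists E (s # s' # ts) = event_list E s' s # event_lists E (s' # ts)"
| "event_lists E _ = []"

lemma length_event_lists: "length (event_lists E ts) = length ts - 1"
  by (induction E ts rule: event_lists.induct) auto

lemma map_length_event_lists: "map length (event_lists E ts) = counts E ts"
  by (induction E ts rule: event_lists.induct) (auto simp: event_list_def)

lemma set_event_list: "set (event_list E s u) \<subseteq> {m. s < event_time E m \<and> event_time E m \<le> u}"
  unfolding event_list_def by (cases "finite {m. s < event_time E m \<and> event_time E m \<le> u}") auto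

lemma set_event_lists: "sorted_wrt (>) ts \<Longrightarrow> ts \<noteq> [] \<Longrightarrow> set (concat (event_lists E ts)) \<subseteq> {m. event_time E m \<le> hd ts}"
proof (induction E ts rule: event_lists.induct)
  case (1 E s s' ts)
  have "set (concat (event_lists E (s' # ts))) \<subseteq> {m. event_time E m \<le> s'}" using 1 by auto
  then show ?case using set_event_list[of E s' s] 1(2) by fastforce
qed auto

lemma distinct_event_lists: "sorted_wrt (>) ts \<Longrightarrow> distinct (concat (event_lists E ts))"
proof (induction E ts rule: event_lists.induct)
  case (1 E s s' ts)
  have "set (concat (event_lists E (s' # ts))) \<subseteq> {m. event_time E m \<le> s'}"
    using set_event_lists[of "s' # ts" E] 1 by auto
  moreover have "set (event_list E s' s) \<subseteq> {m. s' < event_time E m}" using set_event_list[of E s' s] by auto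
  ultimately have "set (event_list E s' s) \<inter> set (concat (event_lists E (s' # ts))) = {}"
    by (force simp: disjoint_iff)
  moreover have "distinct (event_list E s' s)" by (simp add: event_list_def)
  ultimately show ?case using 1 by auto
qed auto

lemma event_time_Suc: "goodE E \<Longrightarrow> event_time E m < event_time E (m + 1)"
proof (cases m rule: int_cases_pn)
  case (1 j)
  assume "goodE E"
  then have "0 < gaps_pos_seq E (Suc j)" by (auto simp: goodE_def gaps_pos_seq_def)
  moreover have e: "m + 1 = int (Suc j)" using 1 by simp
  have "event_time E (m + 1) = event_time E m + gaps_pos_seq E (Suc j)"
    unfolding e by (simp only: 1 event_time_pos partial_sum_def sum.lessThan_Suc)
  ultimately show ?thesis by simp
next
  case (2 j)
  assume E: "goodE E"
  show ?thesis
  proof (cases j)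
    case 0
    then show ?thesis using 2 event_time_sign[OF E, of 0] by simp
  next
    case (Suc i)
    have "0 < gaps_neg_seq E j" using E by (auto simp: goodE_def gaps_neg_seq_def)
    moreover have e: "m + 1 = - 1 - int i" using 2 Suc by simp
    have "event_time E (m + 1) = - partial_sum (gaps_neg_seq E) (Suc i)" unfolding e by (rule event_time_neg)
    moreover have "event_time E m = - partial_sum (gaps_neg_seq E) (Suc j)" unfolding 2 by (rule event_time_neg)
    moreover have "partial_sum (gaps_neg_seq E) (Suc j) = partial_sum (gaps_neg_seq E) (Suc i) + gaps_neg_seq E j" using Suc by (simp add: partial_sum_def)
    ultimately show ?thesis by simp
  qed
qed

lemma event_time_mono:
  assumes "goodE E" shows "l < m \<Longrightarrow> event_time E l < event_time E m"
proof (induction rule: int_gr_induct)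
  case base then show ?case using event_time_Suc[OF assms] by simp
next
  case (step m) then show ?case using event_time_Suc[OF assms, of m] by simp
qed

lemma event_time_less_iff: "goodE E \<Longrightarrow> event_time E l < event_time E m \<longleftrightarrow> l < m"
  by (metis event_time_mono less_irrefl less_linear order_less_trans)

lemma finite_events: 
  assumes "goodE E" shows "finite {m. s < event_time E m \<and> event_time E m \<le> u}"
proof -
  have "{m. s < event_time E m \<and> event_time E m \<le> u} \<subseteq> int ` {j. partial_sum (gaps_pos_seq E) (Suc j) \<le> u}
     \<union> (\<lambda>j. - 1 - int j) ` {j. partial_sum (gaps_neg_seq E) (Suc j) \<le> - s}"
  proof
    fix m assume m: "m \<in> {m. s < event_time E m \<and> event_time E m \<le> u}"
    show "m \<in> int ` {j. partial_sum (gaps_pos_seq E) (Suc j) \<le> u} \<union> (\<lambda>j. - 1 - int j) ` {j. partial_sum (gaps_neg_seq E) (Suc j) \<le> - s}"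
      by (cases m rule: int_cases_pn) (use m in \<open>auto simp: event_time_pos event_time_neg\<close>)
  qed
  then show ?thesis using assms by (elim finite_subset) (auto simp: goodE_def)
qed

lemma event_list_split:
  assumes "goodE E" "s' \<le> s" "s \<le> u"
  shows "event_list E s' u = event_list E s' s @ event_list E s u"
proof -
  let ?A = "{m. s' < event_time E m \<and> event_time E m \<le> s}" and ?B = "{m. s < event_time E m \<and> event_time E m \<le> u}"
  note fin = finite_events[OF assms(1)]
  have AB: "{m. s' < event_time E m \<and> event_time E m \<le> u} = ?A \<union> ?B" using assms by auto
  have "sorted_wrt (<) (event_list E s' s @ event_list E s u)"
    unfolding sorted_wrt_append event_list_def using fin event_time_less_iff[OF assms(1)] by force
  moreover have "set (event_list E s' s @ event_list E s u) = ?A \<union> ?B" using fin by (simp add: event_list_def)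
  ultimately have "sorted_list_of_set (?A \<union> ?B) = event_list E s' s @ event_list E s u"
    using sorted_list_of_set.idem_if_sorted_distinct[of "event_list E s' s @ event_list E s u"]
    by (simp add: strict_sorted_iff)
  then show ?thesis unfolding AB event_list_def[of E s' u] .
qed

definition anc :: "omega \<Rightarrow> real \<Rightarrow> nat \<Rightarrow> nat" where "anc \<omega> s i = anc_slot t \<omega> i s"

lemma evt_time_event_time: "evt_time \<omega> m = event_time (fst \<omega>) m"
  by (simp add: evt_time_def event_time_def)

lemma anc_eq: "anc \<omega> s i = foldr (\<lambda>m. back_step (fst (snd \<omega>) m)) (event_list (fst \<omega>) s (t i)) (snd (snd \<omega>) i)"
  by (simp add: anc_def anc_slot_def events_in_def evt_mark_def sample_slot_def event_list_def evt_time_event_time)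

lemma anc_step:
  assumes "goodE (fst \<omega>)" "s' \<le> s" "s \<le> t i"
  shows "anc \<omega> s' i = foldr (\<lambda>m. back_step (fst (snd \<omega>) m)) (event_list (fst \<omega>) s' s) (anc \<omega> s i)"
  unfolding anc_eq event_list_split[OF assms] by simp

lemma anc_self: "anc \<omega> (t i) i = snd (snd \<omega>) i"
  by (simp add: anc_eq event_list_def flip: not_less)

fun path_weight :: "(real \<Rightarrow> real \<Rightarrow> (nat \<Rightarrow> nat) \<Rightarrow> real) \<Rightarrow> (real \<Rightarrow> (nat \<Rightarrow> nat) \<Rightarrow> real)
    \<Rightarrow> real list \<Rightarrow> (real \<Rightarrow> nat \<Rightarrow> nat) \<Rightarrow> real" where
  "path_weight G C (s # s' # ts) Y = C s (Y s) * (G s s' (Y s) * path_weight G C (s' # ts) Y)"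
| "path_weight G C [s] Y = C s (Y s) * G s s (Y s)"
| "path_weight G C [] Y = 1"

definition local_at :: "real \<Rightarrow> ((nat \<Rightarrow> nat) \<Rightarrow> real) \<Rightarrow> bool" where
  "local_at s f \<longleftrightarrow> (\<forall>x y. (\<forall>i\<in>{1..Suc k}. s \<le> t i \<longrightarrow> x i = y i) \<longrightarrow> f x = f y)"

lemma path_weight_eq_chain_path:
  assumes E: "goodE (fst \<omega>)" and G: "\<And>s s'. local_at s (G s s')" and C: "\<And>s. local_at s (C s)"
  shows "grid ts \<Longrightarrow> (\<And>i. i \<in> {1..Suc k} \<Longrightarrow> hd ts \<le> t i \<Longrightarrow> x i = anc \<omega> (hd ts) i) \<Longrightarrow>
    path_weight G C ts (anc \<omega>) = C (hd ts) x * chain_path G C (event_lists (fst \<omega>) ts) ts x (fst (snd \<omega>)) (snd (snd \<omega>))"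
proof (induction ts arbitrary: x rule: induct_list012)
  case (2 s)
  have "G s s (anc \<omega> s) = G s s x" "C s (anc \<omega> s) = C s x"
    using G[of s s] C[of s] 2 unfolding local_at_def by force+
  then show ?case by simp
next
  case (3 s s' ts)
  have Gs: "G s s' (anc \<omega> s) = G s s' x" and Cs: "C s (anc \<omega> s) = C s x"
    using G[of s s'] C[of s] 3(4) unfolding local_at_def by force+
  let ?x = "sample_upd s' (snd (snd \<omega>)) (apply_events (fst (snd \<omega>)) (event_list (fst \<omega>) s' s) x)"
  have "path_weight G C (s' # ts) (anc \<omega>) = C (hd (s' # ts)) ?x * chain_path G C (event_lists (fst \<omega>) (s' # ts)) (s' # ts) ?x (fst (snd \<omega>)) (snd (snd \<omega>))"
  proof (rule 3(2))
    show "grid (s' # ts)" by (rule grid_ConsD(1)[OF 3(3)])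
    fix i assume i: "i \<in> {1..Suc k}" "hd (s' # ts) \<le> t i"
    show "?x i = anc \<omega> (hd (s' # ts)) i"
    proof (cases "t i = s'")
      case True
      then show ?thesis using i anc_self[of \<omega> i] by (simp add: sample_upd_def)
    next
      case False
      have "t i \<in> set (s # s' # ts) \<or> s < t i" using 3(3) i by (auto simp: grid_def)
      moreover have "u < s'" if "u \<in> set ts" for u using 3(3) that by (auto simp: grid_def)
      ultimately have st: "s \<le> t i" using False i by force
      have "s' \<le> s" using grid_ConsD(2)[OF 3(3)] by simp
      from anc_step[OF E this st] show ?thesis
        using False 3(4)[of i] i st by (simp add: sample_upd_def apply_events_def)
    qed
  qed
  then show ?case using Gs Cs by simp
qed (simp add: grid_def)

lemma measurable_foldr_countable:
  fixes g :: "'z \<Rightarrow> nat"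
  assumes "\<And>m. (\<lambda>z. f z m) \<in> measurable N (count_space (UNIV :: (nat \<times> nat) set))" "g \<in> measurable N (count_space UNIV)"
  shows "(\<lambda>z. foldr (\<lambda>m. back_step (f z m)) l (g z)) \<in> measurable N (count_space UNIV)"
proof (induction l)
  case (Cons m l)
  then show ?case using assms by (auto intro!: measurable_comp2_countable[of _ N _ back_step])
qed (use assms in simp)

lemma measurable_anc [measurable]: "(\<lambda>\<omega>. anc \<omega> s i) \<in> measurable MM (count_space UNIV)"
  unfolding anc_eq MM_eq
proof (rule measurable_compose_countable[where g = "\<lambda>\<omega>. event_list (fst \<omega>) s (t i)"])
  show "(\<lambda>\<omega>. foldr (\<lambda>m. back_step (fst (snd \<omega>) m)) l (snd (snd \<omega>) i)) \<in> measurable (ME \<Otimes>\<^sub>M MKX) (count_space UNIV)" for l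
    by (rule measurable_foldr_countable) measurable
qed measurable

lemma measurable_local_at:
  assumes "local_at s f" shows "(\<lambda>\<omega>. f (anc \<omega> s)) \<in> borel_measurable MM"
proof (rule measurable_finite_dep[of "{i \<in> {1..Suc k}. s \<le> t i}" f])
  show "f w = f w'" if "\<And>i. i \<in> {i \<in> {1..Suc k}. s \<le> t i} \<Longrightarrow> w i = w' i" for w w'
    using assms that unfolding local_at_def by blast
qed auto

lemma measurable_path_weight:
  assumes G: "\<And>s s'. local_at s (G s s')" and C: "\<And>s. local_at s (C s)"
  shows "(\<lambda>\<omega>. path_weight G C ts (anc \<omega>)) \<in> borel_measurable MM"
proof (induction ts rule: induct_list012)
  case (2 s)
  show ?case using borel_measurable_times[OF measurable_local_at[OF C[of s]] measurable_local_at[OF G[of s s]]] by simp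
next
  case (3 s s' ts)
  show ?case
    using borel_measurable_times[OF measurable_local_at[OF C[of s]] borel_measurable_times[OF measurable_local_at[OF G[of s s']] 3(2)]]
    by simp
qed simp

theorem nn_integral_path_weight:
  assumes G: "\<And>s s'. s' \<le> s \<Longrightarrow> unit_bdd (G s s')" and C: "\<And>s. unit_bdd (C s)"
    and Gl: "\<And>s s'. local_at s (G s s')" and Cl: "\<And>s. local_at s (C s)"
    and ts: "grid ts" "0 \<in> set ts" "t (Suc k) \<le> hd ts" and x: "valid x"
  shows "(\<integral>\<^sup>+\<omega>. ennreal (path_weight G C ts (anc \<omega>)) \<partial>MM) = ennreal (sample_avg (hd ts) (\<lambda>x. C (hd ts) x * chain_val G C ts x) x)"
proof -
  have srt: "sorted_wrt (>) ts" and ne: "ts \<noteq> []" using ts by (auto simp: grid_def)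
  have ts': "ts = hd ts # tl ts" using ne by simp
  have m: "(\<lambda>\<omega>. ennreal (path_weight G C ts (anc \<omega>))) \<in> borel_measurable MM"
    using measurable_path_weight[OF Gl Cl] by measurable
  have bdd: "unit_bdd (\<lambda>x. C (hd ts) x * chain_val_counts G C cs ts x)" for cs
    by (intro unit_bdd_mult C unit_bdd_chain_val_counts G srt)
  have "(\<integral>\<^sup>+\<omega>. ennreal (path_weight G C ts (anc \<omega>)) \<partial>MM)
     = (\<integral>\<^sup>+E. \<integral>\<^sup>+z. ennreal (path_weight G C ts (anc (E, z))) \<partial>MKX \<partial>ME)"
    unfolding MM_eq by (rule MKX.P.nn_integral_fst[symmetric]) (use m in \<open>simp add: MM_eq\<close>)
  also have "\<dots> = (\<integral>\<^sup>+E. ennreal (sample_avg (hd ts) (\<lambda>x. C (hd ts) x * chain_val_counts G C (counts E ts) ts x) x) \<partial>ME)"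
  proof (rule nn_integral_cong_AE, use AE_goodE in eventually_elim)
    case (elim E)
    have "path_weight G C ts (anc (E, z)) = C (hd ts) (sample_upd (hd ts) (snd z) x) *
       chain_path G C (event_lists E ts) (hd ts # tl ts) (sample_upd (hd ts) (snd z) x) (fst z) (snd z)" for z
    proof -
      have "sample_upd (hd ts) (snd z) x i = anc (E, z) (hd ts) i" if i: "i \<in> {1..Suc k}" "hd ts \<le> t i" for i
      proof -
        have "t i \<le> t (Suc k)" using i t_less[of i "Suc k"] by (cases "i = Suc k") auto
        then have "t i = hd ts" using i ts(3) by simp
        then show ?thesis using i anc_self[of "(E, z)" i] by (simp add: sample_upd_def)
      qed
      from path_weight_eq_chain_path[OF _ Gl Cl ts(1) this] elim show ?thesis using ne by simp
    qed
    then have "(\<integral>\<^sup>+z. ennreal (path_weight G C ts (anc (E, z))) \<partial>MKX) = (\<integral>\<^sup>+z. ennreal (C (hd ts) (sample_upd (hd ts) (snd z) x) *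
       chain_path G C (event_lists E ts) (hd ts # tl ts) (sample_upd (hd ts) (snd z) x) (fst z) (snd z)) \<partial>MKX)" by simp
    also have "\<dots> = ennreal (sample_avg (hd ts) (\<lambda>x. C (hd ts) x * chain_val_counts G C (map length (event_lists E ts)) (hd ts # tl ts) x) x)"
      using ne srt by (intro inner_sample G C x inner_integral) (auto simp: length_event_lists distinct_event_lists)
    finally show ?case using ne by (simp add: map_length_event_lists)
  qed
  also have "\<dots> = ennreal (\<integral>E. sample_avg (hd ts) (\<lambda>x. C (hd ts) x * chain_val_counts G C (counts E ts) ts x) x \<partial>ME)"
  proof (rule nn_integral_eq_integral)
    have b: "0 \<le> sample_avg (hd ts) (\<lambda>x. C (hd ts) x * chain_val_counts G C cs ts x) x \<and> sample_avg (hd ts) (\<lambda>x. C (hd ts) x * chain_val_counts G C cs ts x) x \<le> 1" for cs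
      using unit_bdd_sample_avg[OF bdd] x by (auto simp: unit_bdd_def)
    have "(\<lambda>E. (\<lambda>cs. sample_avg (hd ts) (\<lambda>x. C (hd ts) x * chain_val_counts G C cs ts x) x) (counts E ts)) \<in> borel_measurable ME"
      by (rule measurable_compose[OF measurable_counts]) simp
    then show "integrable ME (\<lambda>E. sample_avg (hd ts) (\<lambda>x. C (hd ts) x * chain_val_counts G C (counts E ts) ts x) x)"
      by (intro ME.integrable_const_bound[of _ 1]) (use b in auto)
    show "AE E in ME. 0 \<le> sample_avg (hd ts) (\<lambda>x. C (hd ts) x * chain_val_counts G C (counts E ts) ts x) x" using b by simp
  qed
  also have "(\<integral>E. sample_avg (hd ts) (\<lambda>x. C (hd ts) x * chain_val_counts G C (counts E ts) ts x) x \<partial>ME)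
     = measure_pmf.expectation (poisson_counts ts) (\<lambda>cs. sample_avg (hd ts) (\<lambda>x. C (hd ts) x * chain_val_counts G C cs ts x) x)"
    by (rule integral_counts[OF srt ts(2)])
  also have "\<dots> = sample_avg (hd ts) (\<lambda>x. measure_pmf.expectation (poisson_counts ts) (\<lambda>cs. C (hd ts) x * chain_val_counts G C cs ts x)) x"
    by (rule sample_avg_integral[OF bdd x, symmetric])
  also have "\<dots> = sample_avg (hd ts) (\<lambda>x. C (hd ts) x * chain_val G C ts x) x"
    by (rule sample_avg_cong[OF _ x]) (use expectation_chain_val_counts[of G C, OF G C srt] in simp)
  finally show ?thesis .
qed

section \<open>Meeting and attachment times\<close>

text \<open>The supremum in the definition of the meeting time may be taken over the rationals and the right
  end point, also for the irregular \<open>\<omega>\<close> whose events accumulate.\<close>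

lemma meet_rational:
  assumes s: "s \<le> min (t i) (t j)" "anc \<omega> s i = anc \<omega> s j" "c < s"
  defines "b \<equiv> min (t i) (t j)"
  shows "anc \<omega> b i = anc \<omega> b j \<or> (\<exists>q::rat. c < of_rat q \<and> of_rat q < b \<and> anc \<omega> (of_rat q) i = anc \<omega> (of_rat q) j)"
proof (cases "s = b")
  case True then show ?thesis using s by simp
next
  case False
  moreover have "s \<le> b" using s(1) by (simp only: b_def)
  ultimately have sb: "s < b" by simp
  let ?T = "event_time (fst \<omega>)"
  let ?K = "{m. s < ?T m \<and> ?T m \<le> b}"
  show ?thesis
  proof (cases "finite ?K")
    case True
    obtain u where u: "s < u" "u < b" "\<And>m. s < ?T m \<Longrightarrow> ?T m \<le> b \<Longrightarrow> u < ?T m"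
    proof -
      define S where "S = insert b (?T ` ?K)"
      have S: "finite S" "S \<noteq> {}" "\<forall>v\<in>S. s < v" using True sb by (auto simp: S_def)
      then have "s < Min S" by simp
      then obtain u where u: "s < u" "u < Min S" using dense by blast
      have "u < v" if "v \<in> S" for v using u(2) S that by (meson Min_le less_le_trans)
      then show ?thesis using u(1) by (intro that[of u]) (auto simp: S_def)
    qed
    obtain q where q: "s < of_rat q" "of_rat q < u" using of_rat_dense[OF u(1)] by blast
    have "{m. of_rat q < ?T m \<and> ?T m \<le> v} = {m. s < ?T m \<and> ?T m \<le> v}" if "b \<le> v" for v
      using q u that by (force intro: less_imp_le)
    then have "anc \<omega> (of_rat q) l = anc \<omega> s l" if "b \<le> t l" for l
      using that by (simp add: anc_eq event_list_def)
    then have "anc \<omega> (of_rat q) i = anc \<omega> (of_rat q) j" using s(2) by (simp add: b_def)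
    then show ?thesis using q u s by (intro disjI2 exI[of _ q]) auto
  next
    case False
    have inf: "infinite {m. s' < ?T m \<and> ?T m \<le> v}" if "s' \<le> s" "b \<le> v" for s' v
      using False that by (elim contrapos_nn) (auto elim: finite_subset[rotated])
    then have X: "anc \<omega> s' l = snd (snd \<omega>) l" if "s' \<le> s" "b \<le> t l" for s' l
      using that by (simp add: anc_eq event_list_def)
    obtain q where q: "c < of_rat q" "of_rat q < s" using of_rat_dense[OF s(3)] by blast
    have "anc \<omega> (of_rat q) i = anc \<omega> (of_rat q) j"
      using X[of s] X[of "of_rat q"] q s(2) by (simp add: b_def)
    then show ?thesis using q sb by (intro disjI2 exI[of _ q]) auto
  qed
qed

lemma measurable_meet_time [measurable]: "(\<lambda>\<omega>. meet_time t \<omega> i j) \<in> borel_measurable MM"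
proof (rule borel_measurableI_greater)
  fix c :: real
  define b where "b = min (t i) (t j)"
  let ?P = "\<lambda>s \<omega>. anc \<omega> s i = anc \<omega> s j"
  have [measurable]: "Measurable.pred MM (?P s)" for s
    by (rule measurable_comp2_countable[OF measurable_anc measurable_anc])
  let ?NE = "\<lambda>\<omega>. ?P b \<omega> \<or> (\<exists>q::rat. of_rat q < b \<and> ?P (of_rat q) \<omega>)"
  have eq: "c < meet_time t \<omega> i j \<longleftrightarrow>
     (?NE \<omega> \<and> ((c < b \<and> ?P b \<omega>) \<or> (\<exists>q::rat. c < of_rat q \<and> of_rat q < b \<and> ?P (of_rat q) \<omega>)))
     \<or> (\<not> ?NE \<omega> \<and> c < Sup {})" for \<omega>
  proof -
    define S where "S = {s. s \<le> b \<and> ?P s \<omega>}"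
    have mt: "meet_time t \<omega> i j = Sup S" by (simp add: meet_time_def S_def b_def anc_def)
    have NE: "?NE \<omega> \<longleftrightarrow> S \<noteq> {}"
    proof
      assume "?NE \<omega>" then show "S \<noteq> {}" by (auto simp: S_def intro: less_imp_le)
    next
      assume "S \<noteq> {}"
      then obtain s where "s \<le> min (t i) (t j)" "?P s \<omega>" by (auto simp: S_def b_def)
      from meet_rational[OF this, of "s - 1"] show "?NE \<omega>" by (auto simp: b_def)
    qed
    have bd: "bdd_above S" by (auto simp: S_def bdd_above_def)
    show ?thesis
    proof (cases "S = {}")
      case False
      then have "c < Sup S \<longleftrightarrow> (\<exists>s\<in>S. c < s)" by (intro less_cSup_iff bd)
      also have "\<dots> \<longleftrightarrow> (c < b \<and> ?P b \<omega>) \<or> (\<exists>q::rat. c < of_rat q \<and> of_rat q < b \<and> ?P (of_rat q) \<omega>)"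
      proof
        assume "\<exists>s\<in>S. c < s"
        then obtain s where s: "s \<le> min (t i) (t j)" "?P s \<omega>" "c < s" by (auto simp: S_def b_def)
        then have "c < b" by (simp add: b_def)
        then show "(c < b \<and> ?P b \<omega>) \<or> (\<exists>q::rat. c < of_rat q \<and> of_rat q < b \<and> ?P (of_rat q) \<omega>)"
          using meet_rational[OF s] by (simp add: b_def)
      qed (auto simp: S_def intro: less_imp_le)
      finally show ?thesis using NE False mt by simp
    qed (use NE mt in auto)
  qed
  show "{\<omega> \<in> space MM. c < meet_time t \<omega> i j} \<in> sets MM"
    unfolding eq by measurable
qed

lemma measurable_attach [measurable]: "1 < j \<Longrightarrow> (\<lambda>\<omega>. attach t \<omega> j) \<in> borel_measurable MM"
  unfolding attach_def by (rule borel_measurable_Max) auto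

lemma no_event_right:
  assumes "goodE E" obtains u where "s < u" "\<And>m. \<not> (s < event_time E m \<and> event_time E m \<le> u)"
proof -
  define S where "S = insert (s + 1) (event_time E ` {m. s < event_time E m \<and> event_time E m \<le> s + 1})"
  have S: "finite S" "S \<noteq> {}" "\<forall>v\<in>S. s < v" using finite_events[OF assms] by (auto simp: S_def)
  then have "s < Min S" by simp
  then obtain u where u: "s < u" "u < Min S" using dense by blast
  have *: "u < v" if "v \<in> S" for v using u(2) S that by (meson Min_le less_le_trans)
  then have "u < s + 1" by (simp add: S_def)
  then have "\<not> (s < event_time E m \<and> event_time E m \<le> u)" for m
    using *[of "event_time E m"] by (force simp: S_def)
  with u show ?thesis using that by blast
qed

lemma no_event_left:
  assumes "goodE E" "r < s"
  obtains u where "r \<le> u" "u < s" "\<And>m. \<not> (u < event_time E m \<and> event_time E m < s)"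
proof -
  define S where "S = insert r (event_time E ` {m. r < event_time E m \<and> event_time E m \<le> s} \<inter> {..<s})"
  have S: "finite S" "S \<noteq> {}" "\<forall>v\<in>S. v < s" using finite_events[OF assms(1)] assms(2) by (auto simp: S_def)
  have "r \<le> Max S" "Max S < s" using S by (auto simp: S_def)
  moreover have "\<not> (Max S < event_time E m \<and> event_time E m < s)" for m
  proof
    assume a: "Max S < event_time E m \<and> event_time E m < s"
    then have "r < event_time E m" using \<open>r \<le> Max S\<close> by simp
    then have "event_time E m \<in> S" using a by (auto simp: S_def)
    then show False using a S by (meson Max_ge not_le)
  qed
  ultimately show ?thesis using that by blast
qed

lemma anc_const:
  assumes "goodE (fst \<omega>)" "s' \<le> s" "s \<le> t i" "\<And>m. \<not> (s' < event_time (fst \<omega>) m \<and> event_time (fst \<omega>) m \<le> s)"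
  shows "anc \<omega> s' i = anc \<omega> s i"
  using anc_step[OF assms(1-3)] assms(4) by (simp add: event_list_def)

lemma anc_coal:
  assumes "goodE (fst \<omega>)" "s' \<le> s" "s \<le> t i" "s \<le> t j" "anc \<omega> s i = anc \<omega> s j"
  shows "anc \<omega> s' i = anc \<omega> s' j"
  using anc_step[OF assms(1-3)] anc_step[OF assms(1,2,4)] assms(5) by simp

definition good :: "omega \<Rightarrow> bool" where
  "good \<omega> \<longleftrightarrow> goodE (fst \<omega>) \<and> (\<forall>m. fst (snd \<omega>) m \<in> moran_pairs n) \<and> (\<forall>i. snd (snd \<omega>) i < n)
     \<and> (\<forall>i\<ge>1. \<forall>m. event_time (fst \<omega>) m \<noteq> t i)"

definition meets :: "omega \<Rightarrow> bool" where
  "meets \<omega> \<longleftrightarrow> (\<forall>i\<ge>1. \<forall>j\<ge>1. \<exists>s\<le>min (t i) (t j). anc \<omega> s i = anc \<omega> s j)"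

lemma anc_valid: assumes "good \<omega>" shows "valid (anc \<omega> s)"
proof -
  have "foldr (\<lambda>m. back_step (fst (snd \<omega>) m)) l y < n" if "y < n" for l y
    using that
  proof (induction l)
    case (Cons m l)
    have "fst (snd \<omega>) m \<in> moran_pairs n" using assms by (simp add: good_def)
    then show ?case using Cons by (auto simp: back_step_def moran_pairs_def)
  qed simp
  then show ?thesis using assms by (simp add: valid_def anc_eq good_def)
qed

lemma meet_gt_iff:
  assumes g: "goodE (fst \<omega>)" and m: "meets \<omega>" and ij: "1 \<le> i" "1 \<le> j"
  shows "s < meet_time t \<omega> i j \<longleftrightarrow> s < min (t i) (t j) \<and> anc \<omega> s i = anc \<omega> s j"
proof -
  define S where "S = {s. s \<le> min (t i) (t j) \<and> anc \<omega> s i = anc \<omega> s j}"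
  have mt: "meet_time t \<omega> i j = Sup S" by (simp add: meet_time_def S_def anc_def)
  have ne: "S \<noteq> {}" using m ij unfolding meets_def S_def by blast
  have bd: "bdd_above S" by (auto simp: S_def bdd_above_def)
  have "s < Sup S \<longleftrightarrow> (\<exists>u\<in>S. s < u)" by (intro less_cSup_iff ne bd)
  also have "\<dots> \<longleftrightarrow> s < min (t i) (t j) \<and> anc \<omega> s i = anc \<omega> s j"
  proof
    assume "\<exists>u\<in>S. s < u"
    then obtain u where u: "u \<le> min (t i) (t j)" "anc \<omega> u i = anc \<omega> u j" "s < u" by (auto simp: S_def)
    then show "s < min (t i) (t j) \<and> anc \<omega> s i = anc \<omega> s j"
      using anc_coal[OF g _ _ _ u(2), of s] by auto
  next
    assume a: "s < min (t i) (t j) \<and> anc \<omega> s i = anc \<omega> s j"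
    obtain u where u: "s < u" "\<And>m. \<not> (s < event_time (fst \<omega>) m \<and> event_time (fst \<omega>) m \<le> u)"
      using no_event_right[OF g] by blast
    define v where "v = min u (min (t i) (t j))"
    have v: "s < v" "v \<le> u" "v \<le> t i" "v \<le> t j" using a u by (auto simp: v_def)
    have "anc \<omega> s l = anc \<omega> v l" if "v \<le> t l" for l
      by (rule anc_const[OF g _ that]) (use v u(2) in \<open>auto intro: order_trans\<close>)
    then have "v \<in> S" using a v by (auto simp: S_def)
    then show "\<exists>u\<in>S. s < u" using v by auto
  qed
  finally show ?thesis by (simp add: mt)
qed

lemma attach_gt_iff:
  assumes g: "goodE (fst \<omega>)" and m: "meets \<omega>" and j: "2 \<le> j"
  shows "s < attach t \<omega> j \<longleftrightarrow> (\<exists>i\<in>{1..<j}. s < t i \<and> anc \<omega> s i = anc \<omega> s j)"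
proof -
  have "s < attach t \<omega> j \<longleftrightarrow> (\<exists>i\<in>{1..<j}. s < meet_time t \<omega> i j)"
    unfolding attach_def using j by (subst Max_gr_iff) auto
  also have "\<dots> \<longleftrightarrow> (\<exists>i\<in>{1..<j}. s < t i \<and> anc \<omega> s i = anc \<omega> s j)"
  proof (intro bex_cong refl)
    fix i assume i: "i \<in> {1..<j}"
    then have "t i < t j" by (intro t_less) auto
    then show "s < meet_time t \<omega> i j \<longleftrightarrow> s < t i \<and> anc \<omega> s i = anc \<omega> s j"
      using meet_gt_iff[OF g m, of i j s] i by auto
  qed
  finally show ?thesis .
qed

lemma attach_ge_iff:
  assumes g: "goodE (fst \<omega>)" and m: "meets \<omega>" and j: "2 \<le> j" and ne: "\<And>m. event_time (fst \<omega>) m \<noteq> s"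
  shows "s \<le> attach t \<omega> j \<longleftrightarrow> (\<exists>i\<in>{1..<j}. s \<le> t i \<and> anc \<omega> s i = anc \<omega> s j)"
proof
  assume a: "s \<le> attach t \<omega> j"
  define r where "r = Max (insert (s - 1) (t ` {1..<j} \<inter> {..<s}))"
  have fin: "finite (insert (s - 1) (t ` {1..<j} \<inter> {..<s}))" by simp
  have r: "r < s" unfolding r_def by (subst Max_less_iff) auto
  have rt: "t i \<le> r" if "i \<in> {1..<j}" "t i < s" for i
    unfolding r_def by (rule Max_ge[OF fin]) (use that in auto)
  obtain u where u: "r \<le> u" "u < s" "\<And>m. \<not> (u < event_time (fst \<omega>) m \<and> event_time (fst \<omega>) m < s)"
    using no_event_left[OF g r] by blast
  have nu: "\<not> (u < event_time (fst \<omega>) m \<and> event_time (fst \<omega>) m \<le> s)" for m using u(3)[of m] ne[of m] by auto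
  have "u < attach t \<omega> j" using a u by simp
  then obtain i where i: "i \<in> {1..<j}" "u < t i" "anc \<omega> u i = anc \<omega> u j"
    using attach_gt_iff[OF g m j] by blast
  then have st: "s \<le> t i" using rt[of i] u(1) by force
  moreover have "t i < t j" using i by (intro t_less) auto
  ultimately have "anc \<omega> u i = anc \<omega> s i" "anc \<omega> u j = anc \<omega> s j"
    using u(2) nu by (auto intro!: anc_const[OF g])
  then show "\<exists>i\<in>{1..<j}. s \<le> t i \<and> anc \<omega> s i = anc \<omega> s j" using i st by auto
next
  assume "\<exists>i\<in>{1..<j}. s \<le> t i \<and> anc \<omega> s i = anc \<omega> s j"
  then obtain i where i: "i \<in> {1..<j}" "s \<le> t i" "anc \<omega> s i = anc \<omega> s j" by blast
  have tij: "t i < t j" using i by (intro t_less) auto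
  show "s \<le> attach t \<omega> j"
  proof (rule ccontr)
    assume "\<not> s \<le> attach t \<omega> j"
    then have lt: "attach t \<omega> j < s" by simp
    then have "anc \<omega> (attach t \<omega> j) i = anc \<omega> (attach t \<omega> j) j"
      using i tij by (intro anc_coal[OF g _ _ _ i(3)]) auto
    then have "attach t \<omega> j < attach t \<omega> j"
      using attach_gt_iff[OF g m j, of "attach t \<omega> j"] i lt by force
    then show False by simp
  qed
qed

lemma attach_less:
  assumes g: "goodE (fst \<omega>)" and m: "meets \<omega>" and j: "2 \<le> j"
  shows "attach t \<omega> j \<le> t (j - 1)" "attach t \<omega> j < t j"
proof -
  show 1: "attach t \<omega> j \<le> t (j - 1)"
  proof (rule ccontr)
    assume "\<not> attach t \<omega> j \<le> t (j - 1)"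
    then obtain i where i: "i \<in> {1..<j}" "t (j - 1) < t i"
      using attach_gt_iff[OF g m j, of "t (j - 1)"] by auto
    have "1 \<le> j - 1" using j by simp
    from t_less_iff[OF this, of i] i show False by auto
  qed
  moreover have "t (j - 1) < t j" by (rule t_less) (use j in auto)
  ultimately show "attach t \<omega> j < t j" by simp
qed

lemma attach_neq:
  assumes g: "good \<omega>" and m: "meets \<omega>" and jl: "2 \<le> j" "j < l"
  shows "attach t \<omega> j \<noteq> attach t \<omega> l"
proof
  assume eq: "attach t \<omega> j = attach t \<omega> l"
  define b where "b = attach t \<omega> l"
  have gE: "goodE (fst \<omega>)" using g by (simp add: good_def)
  have l2: "2 \<le> l" using jl by simp
  note gt = attach_gt_iff[OF gE m]
  have nl: "anc \<omega> b i \<noteq> anc \<omega> b l" if "i \<in> {1..<l}" "b < t i" for i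
    using gt[OF l2, of b] that by (auto simp: b_def)
  have nj: "anc \<omega> b i \<noteq> anc \<omega> b j" if "i \<in> {1..<j}" "b < t i" for i
    using gt[OF jl(1), of b] that by (auto simp: b_def eq)
  have bj: "b < t j" and bl: "b < t l" using attach_less(2)[OF gE m jl(1)] attach_less(2)[OF gE m l2] eq by (simp_all add: b_def)
  have jl': "j \<in> {1..<l}" using jl by auto
  show False
  proof (cases "\<exists>m. event_time (fst \<omega>) m = b")
    case False
    then have ne: "\<And>m. event_time (fst \<omega>) m \<noteq> b" by blast
    obtain i where i: "i \<in> {1..<l}" "b \<le> t i" "anc \<omega> b i = anc \<omega> b l"
      using attach_ge_iff[OF gE m l2 ne] by (auto simp: b_def)
    obtain i' where i': "i' \<in> {1..<j}" "b \<le> t i'" "anc \<omega> b i' = anc \<omega> b j"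
      using attach_ge_iff[OF gE m jl(1) ne] by (auto simp: b_def eq)
    have "t i = b" "t i' = b" using nl nj i i' by force+
    then have "i = i'" using t_eq_iff[of i i'] i i' by auto
    then show False using i i' nl[OF jl' bj] by simp
  next
    case True
    then obtain e where e: "event_time (fst \<omega>) e = b" by blast
    let ?mk = "fst (snd \<omega>)"
    obtain d p where dp: "?mk e = (d, p)" by (cases "?mk e")
    define r where "r = Max (insert (b - 1) (t ` {1..<l} \<inter> {..<b}))"
    have fin: "finite (insert (b - 1) (t ` {1..<l} \<inter> {..<b}))" by simp
    have r: "r < b" unfolding r_def by (subst Max_less_iff) auto
    have rt: "t i \<le> r" if "i \<in> {1..<l}" "t i < b" for i
      unfolding r_def by (rule Max_ge[OF fin]) (use that in auto)
    have tb: "t i \<noteq> b" if "1 \<le> i" for i using g e that unfolding good_def by metis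
    obtain u where u: "r \<le> u" "u < b" "\<And>m. \<not> (u < event_time (fst \<omega>) m \<and> event_time (fst \<omega>) m < b)"
      using no_event_left[OF gE r] by blast
    have ev: "{m. u < event_time (fst \<omega>) m \<and> event_time (fst \<omega>) m \<le> b} = {e}"
    proof -
      have "m = e" if "u < event_time (fst \<omega>) m" "event_time (fst \<omega>) m \<le> b" for m
        using u(3)[of m] that e event_time_less_iff[OF gE, of m e] event_time_less_iff[OF gE, of e m] by force
      then show ?thesis using e u by auto
    qed
    have st: "anc \<omega> u i = back_step (d, p) (anc \<omega> b i)" if "b \<le> t i" for i
      using anc_step[OF gE _ that, of u] u ev dp by (simp add: event_list_def)
    have big: "b < t i" if "i \<in> {1..<l}" "u < t i" for i
      using that rt[of i] u(1) tb[of i] by force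
    have mem: "\<exists>i\<in>{1..<q}. b < t i \<and> anc \<omega> b i \<noteq> anc \<omega> b q \<and> {anc \<omega> b i, anc \<omega> b q} = {d, p}"
      if q: "2 \<le> q" "q \<le> l" "attach t \<omega> q = b" for q
    proof -
      have "u < attach t \<omega> q" using q u by simp
      then obtain i where i: "i \<in> {1..<q}" "u < t i" "anc \<omega> u i = anc \<omega> u q"
        using gt[OF q(1)] by blast
      have bi: "b < t i" using big[of i] i q by auto
      have bq: "b < t q" using attach_less[OF gE m q(1)] q by simp
      have ne: "anc \<omega> b i \<noteq> anc \<omega> b q" using gt[OF q(1), of b] q i bi by auto
      have "back_step (d, p) (anc \<omega> b i) = back_step (d, p) (anc \<omega> b q)"
        using i(3) st[of i] st[of q] bi bq by simp
      then have "{anc \<omega> b i, anc \<omega> b q} = {d, p}" using ne by (auto simp: back_step_def split: if_splits)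
      then show ?thesis using i bi ne by blast
    qed
    obtain i where i: "i \<in> {1..<l}" "b < t i" "{anc \<omega> b i, anc \<omega> b l} = {d, p}"
      using mem[of l] l2 by (auto simp: b_def)
    obtain i' where i': "i' \<in> {1..<j}" "b < t i'" "{anc \<omega> b i', anc \<omega> b j} = {d, p}"
      using mem[of j] jl eq by (auto simp: b_def)
    have "anc \<omega> b l \<in> {anc \<omega> b i', anc \<omega> b j}" unfolding i'(3) i(3)[symmetric] by simp
    moreover have "i' \<in> {1..<l}" using i' jl by auto
    ultimately show False using nl[of i'] nl[OF jl' bj] i'(2) by fastforce
  qed
qed

lemma attach_inj:
  assumes "good \<omega>" "meets \<omega>" shows "inj_on (attach t \<omega>) {2..}"
  unfolding inj_on_def using attach_neq[OF assms] by (metis atLeast_iff linorder_neqE_nat)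

text \<open>Every sample \<open>j\<close> contributes the lineage between its attachment time and \<open>t j\<close>.\<close>

definition lin_count :: "omega \<Rightarrow> real \<Rightarrow> real" where
  "lin_count \<omega> s = real (card {i \<in> {1..k}. s < t i}) - (\<Sum>j\<in>{2..k}. of_bool (s < attach t \<omega> j))"

lemma lin_count_card: "lin_count \<omega> s = real (card {i \<in> {1..k}. s < t i}) - real (card {j \<in> {2..k}. s < attach t \<omega> j})"
  unfolding lin_count_def by (simp add: sum.If_cases of_bool_def Int_def)

lemma t_inj: "inj_on t {1..}"
  unfolding inj_on_def using t_eq_iff by auto

lemma dead_imp: "dead t k \<omega> i \<longleftrightarrow> (\<exists>j\<in>{i<..k}. attach t \<omega> j = t i)"
  by (auto simp: dead_def)

lemma lineages_eq_lin_count: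
  assumes g: "good \<omega>" and m: "meets \<omega>"
  shows "lineages t k \<omega> s = lin_count \<omega> s"
proof -
  have gE: "goodE (fst \<omega>)" using g by (simp add: good_def)
  let ?A = "attach t \<omega>"
  let ?T = "{t i |i. 1 \<le> i}"
  define D where "D = {i \<in> {1..k}. s < t i \<and> dead t k \<omega> i}"
  define JS where "JS = {j \<in> {2..k}. s < ?A j \<and> ?A j \<in> ?T}"
  define JB where "JB = {j \<in> {2..k}. s < ?A j \<and> ?A j \<notin> ?T}"
  have inj: "inj_on ?A B" if "B \<subseteq> {2..}" for B using attach_inj[OF g m] that inj_on_subset by blast
  have "{e \<in> live t k \<omega>. e > s} = t ` ({i \<in> {1..k}. s < t i} - D)"
    by (auto simp: live_def D_def)
  then have c1: "card {e \<in> live t k \<omega>. e > s} = card ({i \<in> {1..k}. s < t i} - D)"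
    by (simp add: card_image inj_on_subset[OF t_inj] subset_iff)
  have c2: "card ({i \<in> {1..k}. s < t i} - D) = card {i \<in> {1..k}. s < t i} - card D"
    by (rule card_Diff_subset) (auto simp: D_def)
  have c2': "card D \<le> card {i \<in> {1..k}. s < t i}" by (rule card_mono) (auto simp: D_def)
  have "t ` D = ?A ` JS"
  proof (intro equalityI subsetI)
    fix e assume "e \<in> t ` D"
    then obtain i where i: "i \<in> {1..k}" "s < t i" "dead t k \<omega> i" "e = t i" by (auto simp: D_def)
    then obtain j where j: "j \<in> {i<..k}" "?A j = t i" by (auto simp: dead_imp)
    then have "j \<in> JS" using i by (auto simp: JS_def)
    then show "e \<in> ?A ` JS" using j i by force
  next
    fix e assume "e \<in> ?A ` JS"
    then obtain j where j: "j \<in> {2..k}" "s < ?A j" "?A j \<in> ?T" "e = ?A j" by (auto simp: JS_def)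
    then obtain i where i: "1 \<le> i" "?A j = t i" by auto
    have "t i < t j" using attach_less(2)[OF gE m, of j] j i by simp
    then have ij: "i < j" using t_less_iff[of i j] i j by auto
    then have "i \<in> D" using i j by (auto simp: D_def dead_imp)
    then show "e \<in> t ` D" using i j by auto
  qed
  moreover have "card (t ` D) = card D" by (rule card_image) (rule inj_on_subset[OF t_inj], auto simp: D_def)
  moreover have "card (?A ` JS) = card JS" by (rule card_image, rule inj) (auto simp: JS_def)
  ultimately have c3: "card D = card JS" by simp
  have "{b \<in> branch_points t k \<omega>. b > s} = ?A ` JB"
    by (auto simp: branch_points_def JB_def)
  then have c4: "card {b \<in> branch_points t k \<omega>. b > s} = card JB"
    using card_image[OF inj, of JB] by (simp add: JB_def subset_iff)
  have "{j \<in> {2..k}. s < ?A j} = JS \<union> JB" by (auto simp: JS_def JB_def)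
  then have "card {j \<in> {2..k}. s < ?A j} = card JS + card JB"
    by (simp add: card_Un_disjoint JS_def JB_def disjoint_iff)
  then show ?thesis unfolding lineages_def lin_count_card c1 c2 c4 using c2' c3 by simp
qed

lemma card_image_filter_new:
  fixes f :: "nat \<Rightarrow> nat"
  assumes "\<And>i. i \<in> {1..j} \<Longrightarrow> p i \<Longrightarrow> f i \<in> f ` {l \<in> {1..<i}. p l} \<longleftrightarrow> q i"
  shows "card (f ` {i \<in> {1..j}. p i}) = card {i \<in> {1..j}. p i \<and> \<not> q i}"
  using assms
proof (induction j)
  case (Suc j)
  have IH: "card (f ` {i \<in> {1..j}. p i}) = card {i \<in> {1..j}. p i \<and> \<not> q i}"
    by (rule Suc.IH) (use Suc.prems in auto)
  have set: "{i \<in> {1..Suc j}. r i} = (if r (Suc j) then insert (Suc j) {i \<in> {1..j}. r i} else {i \<in> {1..j}. r i})" for r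
    by (auto simp: le_Suc_eq)
  have "{l \<in> {1..<Suc j}. p l} = {l \<in> {1..j}. p l}" by auto
  then have mem: "f (Suc j) \<in> f ` {i \<in> {1..j}. p i} \<longleftrightarrow> q (Suc j)" if "p (Suc j)"
    using Suc.prems[of "Suc j"] that by simp
  show ?case
  proof (cases "p (Suc j)")
    case True
    then show ?thesis unfolding set using mem[OF True] IH by (cases "q (Suc j)") (simp_all add: insert_absorb)
  qed (simp only: set if_False simp_thms IH)
qed simp

lemma card_anc:
  assumes g: "goodE (fst \<omega>)" and m: "meets \<omega>"
  shows "card (anc \<omega> s ` {i \<in> {1..j}. s < t i}) = card {i \<in> {1..j}. s < t i \<and> \<not> (2 \<le> i \<and> s < attach t \<omega> i)}"
proof (rule card_image_filter_new)
  fix i assume i: "i \<in> {1..j}"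
  have im: "a \<in> f ` B \<longleftrightarrow> (\<exists>l\<in>B. f l = a)" for a and f :: "nat \<Rightarrow> nat" and B by blast
  show "anc \<omega> s i \<in> anc \<omega> s ` {l \<in> {1..<i}. s < t l} \<longleftrightarrow> 2 \<le> i \<and> s < attach t \<omega> i"
    unfolding im using attach_gt_iff[OF g m, of i s] by (cases "2 \<le> i") auto
qed

lemma card_anc_le:
  assumes g: "goodE (fst \<omega>)" and m: "meets \<omega>" and ne: "\<And>m. event_time (fst \<omega>) m \<noteq> s"
  shows "card (anc \<omega> s ` {i \<in> {1..j}. s \<le> t i}) = card {i \<in> {1..j}. s \<le> t i \<and> \<not> (2 \<le> i \<and> s \<le> attach t \<omega> i)}"
proof (rule card_image_filter_new)
  fix i assume i: "i \<in> {1..j}"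
  have im: "a \<in> f ` B \<longleftrightarrow> (\<exists>l\<in>B. f l = a)" for a and f :: "nat \<Rightarrow> nat" and B by blast
  show "anc \<omega> s i \<in> anc \<omega> s ` {l \<in> {1..<i}. s \<le> t l} \<longleftrightarrow> 2 \<le> i \<and> s \<le> attach t \<omega> i"
    unfolding im using attach_ge_iff[OF g m _ ne, of i] by (cases "2 \<le> i") auto
qed

lemma lin_count_eq_card:
  assumes g: "goodE (fst \<omega>)" and m: "meets \<omega>"
  shows "lin_count \<omega> s = real (card (anc \<omega> s ` smp_gt s))"
proof -
  have "{i \<in> {1..k}. s < t i \<and> \<not> (2 \<le> i \<and> s < attach t \<omega> i)} = {i \<in> {1..k}. s < t i} - {j \<in> {2..k}. s < attach t \<omega> j}"
    by auto
  moreover have "{j \<in> {2..k}. s < attach t \<omega> j} \<subseteq> {i \<in> {1..k}. s < t i}"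
    using attach_less(2)[OF g m] by (force intro: less_trans)
  ultimately show ?thesis unfolding smp_gt_def card_anc[OF g m] lin_count_card
    by (simp add: card_Diff_subset card_mono of_nat_diff)
qed

lemma dead_iff:
  assumes g: "good \<omega>" and m: "meets \<omega>" and i: "i \<in> {1..k}"
  shows "dead t k \<omega> i \<longleftrightarrow> anc \<omega> (t i) ` smp_ge (t i) = anc \<omega> (t i) ` smp_gt (t i)"
proof -
  have gE: "goodE (fst \<omega>)" using g by (simp add: good_def)
  have ne: "event_time (fst \<omega>) m \<noteq> t i" for m using g i by (simp add: good_def)
  have JJ: "smp_ge (t i) = insert i (smp_gt (t i))" using i t_eq_iff[of _ i] by (auto simp: smp_ge_eq_smp_gt_Un)
  have J'i: "smp_gt (t i) = {i<..k}" using i t_less_iff[of i] by (force simp: smp_gt_def)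
  have "anc \<omega> (t i) ` smp_ge (t i) = anc \<omega> (t i) ` smp_gt (t i) \<longleftrightarrow> (\<exists>j\<in>{i<..k}. anc \<omega> (t i) j = anc \<omega> (t i) i)"
  proof -
    have ins: "insert a S = S \<longleftrightarrow> a \<in> S" for a and S :: "nat set" by blast
    have im: "a \<in> f ` B \<longleftrightarrow> (\<exists>j\<in>B. f j = a)" for a and f :: "nat \<Rightarrow> nat" and B by blast
    show ?thesis unfolding JJ J'i image_insert ins im ..
  qed
  also have "\<dots> \<longleftrightarrow> dead t k \<omega> i"
  proof
    assume "\<exists>j\<in>{i<..k}. anc \<omega> (t i) j = anc \<omega> (t i) i"
    then have ex: "\<exists>j. j \<in> {i<..k} \<and> anc \<omega> (t i) j = anc \<omega> (t i) i" by blast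
    define j where "j = (LEAST j. j \<in> {i<..k} \<and> anc \<omega> (t i) j = anc \<omega> (t i) i)"
    from LeastI_ex[OF ex] have j: "j \<in> {i<..k}" "anc \<omega> (t i) j = anc \<omega> (t i) i" by (auto simp: j_def)
    have least: "j \<le> l" if "l \<in> {i<..k}" "anc \<omega> (t i) l = anc \<omega> (t i) i" for l
      unfolding j_def by (rule Least_le) (use that in auto)
    have j2: "2 \<le> j" using j i by auto
    have "t i \<le> attach t \<omega> j"
      unfolding attach_ge_iff[OF gE m j2 ne] using j i by (intro bexI[of _ i]) auto
    moreover have "\<not> t i < attach t \<omega> j"
    proof
      assume "t i < attach t \<omega> j"
      then obtain l where l: "l \<in> {1..<j}" "t i < t l" "anc \<omega> (t i) l = anc \<omega> (t i) j"
        using attach_gt_iff[OF gE m j2] by blast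
      then have "i < l" using t_less_iff[of i l] i by auto
      then show False using least[of l] l j by auto
    qed
    ultimately show "dead t k \<omega> i" using j by (auto simp: dead_imp)
  next
    assume "dead t k \<omega> i"
    then obtain j where j: "j \<in> {i<..k}" "attach t \<omega> j = t i" by (auto simp: dead_imp)
    have j2: "2 \<le> j" using j i by auto
    obtain l where l: "l \<in> {1..<j}" "t i \<le> t l" "anc \<omega> (t i) l = anc \<omega> (t i) j"
      using attach_ge_iff[OF gE m j2 ne] j by auto
    have "\<not> t i < t l"
    proof
      assume "t i < t l"
      then have "t i < attach t \<omega> j" unfolding attach_gt_iff[OF gE m j2] using l by blast
      then show False using j by simp
    qed
    then have "l = i" using l i t_eq_iff[of l i] by auto
    then show "\<exists>j\<in>{i<..k}. anc \<omega> (t i) j = anc \<omega> (t i) i" using l j by auto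
  qed
  finally show ?thesis by simp
qed

end

section \<open>Refining the grid of times\<close>

fun grid_sum :: "real \<Rightarrow> (real \<Rightarrow> real) \<Rightarrow> real list \<Rightarrow> real" where
  "grid_sum a f (s # s' # ts) = (if a < s then (s - s') * f s else 0) + grid_sum a f (s' # ts)"
| "grid_sum a f _ = 0"

lemma grid_sum_mono:
  "sorted_wrt (>) ts \<Longrightarrow> (\<And>s. s \<in> set ts \<Longrightarrow> f s \<le> h s) \<Longrightarrow> grid_sum a f ts \<le> grid_sum a h ts"
  by (induction a f ts rule: grid_sum.induct) (auto intro!: add_mono mult_left_mono)

lemma grid_sum_cong: "(\<And>s. s \<in> set ts \<Longrightarrow> f s = h s) \<Longrightarrow> grid_sum a f ts = grid_sum a h ts"
  by (induction a f ts rule: grid_sum.induct) auto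

lemma grid_sum_zero: "grid_sum a (\<lambda>_. 0) ts = 0"
  by (induction a "\<lambda>_::real. 0::real" ts rule: grid_sum.induct) auto

lemma grid_sum_diff: "grid_sum a (\<lambda>s. f s - h s) ts = grid_sum a f ts - grid_sum a h ts"
  by (induction a f ts rule: grid_sum.induct) (auto simp: algebra_simps)

lemma grid_sum_sum: "grid_sum a (\<lambda>s. \<Sum>i\<in>A. f i s) ts = (\<Sum>i\<in>A. grid_sum a (f i) ts)"
proof (induction ts rule: induct_list012)
  case (3 s s' ts)
  then show ?case by (cases "a < s") (auto simp: sum.distrib sum_distrib_left)
qed auto

lemma grid_sum_below: "sorted_wrt (>) ts \<Longrightarrow> ts \<noteq> [] \<Longrightarrow> hd ts \<le> a \<Longrightarrow> grid_sum a f ts = 0"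
  by (induction a f ts rule: grid_sum.induct) auto

lemma grid_sum_step_hd:
  "sorted_wrt (>) ts \<Longrightarrow> a \<in> set ts \<Longrightarrow> hd ts \<le> b \<Longrightarrow> grid_sum a (\<lambda>s. of_bool (s \<le> b)) ts = hd ts - a"
proof (induction ts rule: induct_list012)
  case (3 s s' ts)
  show ?case
  proof (cases "a = s")
    case True
    then show ?thesis using grid_sum_below[OF 3(3)] by simp
  next
    case False
    then have "a \<le> s'" using 3 by auto
    then have "a < s" using 3 by auto
    then show ?thesis using 3 False by (auto simp: less_imp_le)
  qed
qed auto

lemma grid_sum_step:
  assumes "0 \<le> e"
  shows "sorted_wrt (>) ts \<Longrightarrow> a \<in> set ts \<Longrightarrow> b \<le> hd ts \<Longrightarrow> \<forall>d\<in>set (gaps ts). d \<le> e \<Longrightarrow>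
    max 0 (b - a) - e \<le> grid_sum a (\<lambda>s. of_bool (s \<le> b)) ts \<and> grid_sum a (\<lambda>s. of_bool (s \<le> b)) ts \<le> max 0 (b - a)"
proof (induction ts rule: induct_list012)
  case (3 s s' ts)
  show ?case
  proof (cases "a = s")
    case True
    then have "grid_sum a (\<lambda>s. of_bool (s \<le> b)) (s # s' # ts) = 0" using grid_sum_below[OF 3(3)] by simp
    then show ?thesis using True 3 assms by simp
  next
    case False
    then have a: "a \<in> set (s' # ts)" using 3 by auto
    then have as: "a \<le> s'" "s' < s" using 3(3) by auto
    have srt: "sorted_wrt (>) (s' # ts)" using 3 by simp
    consider "b = s" | "b < s" "s' \<le> b" | "b < s'" using 3(5) by fastforce
    then show ?thesis
    proof cases
      case 1
      then have "grid_sum a (\<lambda>s. of_bool (s \<le> b)) (s # s' # ts) = s - a"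
        using grid_sum_step_hd[OF 3(3,4), of b] by simp
      then show ?thesis using 1 as assms by simp
    next
      case 2
      have "grid_sum a (\<lambda>s. of_bool (s \<le> b)) (s' # ts) = s' - a"
        using grid_sum_step_hd[OF srt a, of b] 2 by simp
      then show ?thesis using 2 as assms 3(6) by simp
    next
      case c3: 3
      have "grid_sum a (\<lambda>s. of_bool (s \<le> b)) (s # s' # ts) = grid_sum a (\<lambda>s. of_bool (s \<le> b)) (s' # ts)"
        using c3 as by simp
      moreover have "max 0 (b - a) - e \<le> grid_sum a (\<lambda>s. of_bool (s \<le> b)) (s' # ts) \<and> grid_sum a (\<lambda>s. of_bool (s \<le> b)) (s' # ts) \<le> max 0 (b - a)"
        by (rule "3.IH"(2)) (use srt a c3 3(6) in auto)
      ultimately show ?thesis by simp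
    qed
  qed
qed (use assms in auto)

lemma sq_gaps_le:
  "sorted_wrt (>) ts \<Longrightarrow> \<forall>d\<in>set (gaps ts). d \<le> e \<Longrightarrow> ts \<noteq> [] \<Longrightarrow> sq_gaps ts \<le> e * (hd ts - last ts)"
proof (induction ts rule: induct_list012)
  case (3 s s' ts)
  have "(s - s')\<^sup>2 \<le> e * (s - s')"
    unfolding power2_eq_square using 3 by (intro mult_right_mono) auto
  moreover have "sq_gaps (s' # ts) \<le> e * (s' - last (s' # ts))" using 3 by simp
  ultimately show ?case by (simp add: algebra_simps)
qed auto

lemma gaps_le:
  "sorted_wrt (>) ts \<Longrightarrow> (\<And>x. x \<in> set ts \<Longrightarrow> x \<noteq> hd ts \<Longrightarrow> \<exists>y\<in>set ts. x < y \<and> y \<le> x + e) \<Longrightarrow>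
     \<forall>d\<in>set (gaps ts). d \<le> e"
proof (induction ts rule: induct_list012)
  case (3 s s' ts)
  have s': "s' < s" using 3 by simp
  obtain y where y: "y \<in> set (s # s' # ts)" "s' < y" "y \<le> s' + e" using 3(4)[of s'] s' by auto
  then have "y = s" using 3(3) by auto
  moreover have "\<forall>d\<in>set (gaps (s' # ts)). d \<le> e"
  proof (rule "3.IH"(2))
    fix x assume x: "x \<in> set (s' # ts)" "x \<noteq> hd (s' # ts)"
    then have xs: "x < s'" using 3(3) by auto
    have "\<exists>y\<in>set (s # s' # ts). x < y \<and> y \<le> x + e" by (rule 3(4)) (use x xs s' in auto)
    then obtain y where y: "y \<in> set (s # s' # ts)" "x < y" "y \<le> x + e" by blast
    show "\<exists>y\<in>set (s' # ts). x < y \<and> y \<le> x + e"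
      using y xs s' by (cases "y = s") (auto intro: bexI[of _ s'])
  qed (use 3 in auto)
  ultimately show ?case using y by simp
qed auto

lemma fine_grid_exists:
  fixes P :: "real set"
  assumes P: "finite P" "P \<noteq> {}" and e: "0 < e"
  obtains ts where "sorted_wrt (>) ts" "P \<subseteq> set ts" "ts \<noteq> []" "hd ts = Max P" "last ts = Min P"
    "\<forall>d\<in>set (gaps ts). d \<le> e"
proof -
  let ?lo = "Min P" and ?hi = "Max P"
  define R where "R = {?lo + e * real i | i. ?lo + e * real i \<le> ?hi}"
  have "R \<subseteq> (\<lambda>i. ?lo + e * real i) ` {..nat \<lceil>(?hi - ?lo) / e\<rceil>}"
  proof
    fix r assume "r \<in> R"
    then obtain i where i: "r = ?lo + e * real i" "?lo + e * real i \<le> ?hi" by (auto simp: R_def)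
    then have "real i \<le> (?hi - ?lo) / e" using e by (simp add: field_simps)
    then have "i \<le> nat \<lceil>(?hi - ?lo) / e\<rceil>" by linarith
    then show "r \<in> (\<lambda>i. ?lo + e * real i) ` {..nat \<lceil>(?hi - ?lo) / e\<rceil>}" using i by auto
  qed
  then have fR: "finite R" by (rule finite_subset) simp
  define G where "G = P \<union> R"
  have fG: "finite G" using P fR by (simp add: G_def)
  have lohi: "?lo \<in> P" "?hi \<in> P" using P by auto
  have bnd: "?lo \<le> x" "x \<le> ?hi" if "x \<in> G" for x
    using that P e by (auto simp: G_def R_def)
  define ts where "ts = rev (sorted_list_of_set G)"
  have set: "set ts = G" using fG by (simp add: ts_def)
  have srt: "sorted_wrt (>) ts" using fG by (simp add: ts_def sorted_wrt_rev)
  have ne: "ts \<noteq> []" using set lohi by (auto simp: G_def)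
  have hd: "hd ts = ?hi"
  proof -
    obtain x xs where ts: "ts = x # xs" using ne by (cases ts) auto
    have "?hi \<in> set ts" using set lohi by (auto simp: G_def)
    moreover have "x \<le> ?hi" using bnd set ts by auto
    ultimately show ?thesis using srt ts by force
  qed
  have last: "last ts = ?lo"
  proof -
    obtain x xs where ts: "ts = xs @ [x]" using ne by (cases ts rule: rev_cases) auto
    have "?lo \<in> set ts" using set lohi by (auto simp: G_def)
    moreover have "?lo \<le> x" using bnd set ts by auto
    ultimately show ?thesis using srt ts by (force simp: sorted_wrt_append)
  qed
  have "\<forall>d\<in>set (gaps ts). d \<le> e"
  proof (rule gaps_le[OF srt])
    fix x assume x: "x \<in> set ts" "x \<noteq> hd ts"
    then have x1: "?lo \<le> x" "x < ?hi" using bnd[of x] set hd by auto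
    define i where "i = nat (\<lfloor>(x - ?lo) / e\<rfloor> + 1)"
    have fl: "0 \<le> \<lfloor>(x - ?lo) / e\<rfloor>" using x1 e by simp
    then have i: "real i = of_int \<lfloor>(x - ?lo) / e\<rfloor> + 1" by (simp add: i_def)
    have "(x - ?lo) / e < real i" "real i \<le> (x - ?lo) / e + 1" unfolding i by linarith+
    then have y: "x < ?lo + e * real i" "?lo + e * real i \<le> x + e" using e by (auto simp: field_simps)
    show "\<exists>y\<in>set ts. x < y \<and> y \<le> x + e"
    proof (cases "?lo + e * real i \<le> ?hi")
      case True
      then have "?lo + e * real i \<in> set ts" by (auto simp: set G_def R_def)
      then show ?thesis using y by blast
    next
      case False
      then show ?thesis using y x1 lohi by (intro bexI[of _ ?hi]) (auto simp: set G_def)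
    qed
  qed
  then show ?thesis using that[of ts] srt set ne hd last by (auto simp: G_def)
qed

lemma distr_pair_snd_prob:
  assumes "prob_space M" "sigma_finite_measure N"
  shows "distr (M \<Otimes>\<^sub>M N) N snd = N"
proof (rule measure_eqI)
  interpret M: prob_space M by fact
  interpret N: sigma_finite_measure N by fact
  fix A assume A: "A \<in> sets (distr (M \<Otimes>\<^sub>M N) N snd)"
  then have "snd -` A \<inter> space (M \<Otimes>\<^sub>M N) = space M \<times> A"
    by (auto simp: space_pair_measure dest: sets.sets_into_space)
  then show "emeasure (distr (M \<Otimes>\<^sub>M N) N snd) A = emeasure N A"
    using A by (simp add: emeasure_distr N.emeasure_pair_measure_Times M.emeasure_space_1)
qed simp

context smgp begin

lemma AE_MM_fst: assumes "AE E in ME. P E" shows "AE \<omega> in MM. P (fst \<omega>)"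
proof -
  have eq: "distr MM ME fst = ME" unfolding MM_eq by (rule MKX.P.distr_pair_fst)
  have "AE E in distr MM ME fst. P E" unfolding eq by (rule assms)
  moreover have "fst \<in> measurable MM ME" unfolding MM_eq by measurable
  ultimately show ?thesis by (intro AE_distrD[of fst MM ME P])
qed

lemma AE_good: "AE \<omega> in MM. good \<omega>"
proof -
  have 1: "AE \<omega> in MM. goodE (fst \<omega>) \<and> (\<forall>i\<in>{1..}. \<forall>m. event_time (fst \<omega>) m \<noteq> t i)"
    by (rule AE_MM_fst) (intro AE_conjI AE_goodE, subst AE_ball_countable, auto intro: AE_no_event)
  have "AE mk in MK. \<forall>m. mk m \<in> moran_pairs n"
    unfolding AE_all_countable MK_def
    by (intro allI AE_PiM_component measure_pmf.prob_space_axioms UNIV_I)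
       (auto simp: AE_measure_pmf_iff moran_pairs_nonempty)
  moreover have "AE X in MX. \<forall>i. X i < n"
    unfolding AE_all_countable MX_def
    by (intro allI AE_PiM_component measure_pmf.prob_space_axioms UNIV_I)
       (use n2 in \<open>auto simp: AE_measure_pmf_iff lessThan_empty_iff\<close>)
  ultimately have "AE z in MKX. (\<forall>m. fst z m \<in> moran_pairs n) \<and> (\<forall>i. snd z i < n)"
  proof (intro AE_conjI)
    assume *: "AE mk in MK. \<forall>m. mk m \<in> moran_pairs n"
    have eq: "distr MKX MK fst = MK" by (rule MX.distr_pair_fst)
    have "AE mk in distr MKX MK fst. \<forall>m. mk m \<in> moran_pairs n" unfolding eq by (rule *)
    then show "AE z in MKX. \<forall>m. fst z m \<in> moran_pairs n"
      by (intro AE_distrD[of fst MKX MK "\<lambda>mk. \<forall>m. mk m \<in> moran_pairs n"] measurable_fst)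
  next
    assume *: "AE X in MX. \<forall>i. X i < n"
    have "distr MKX MX snd = MX" by (intro distr_pair_snd_prob MK.prob_space_axioms MX.sigma_finite_measure_axioms)
    then have "AE X in distr MKX MX snd. \<forall>i. X i < n" using * by (simp only:)
    then show "AE z in MKX. \<forall>i. snd z i < n"
      by (intro AE_distrD[of snd MKX MX "\<lambda>X. \<forall>i. X i < n"] measurable_snd)
  qed
  moreover have "distr MM MKX snd = MKX" unfolding MM_eq by (intro distr_pair_snd_prob ME.prob_space_axioms MKX.P.sigma_finite_measure_axioms)
  ultimately have "AE z in distr MM MKX snd. (\<forall>m. fst z m \<in> moran_pairs n) \<and> (\<forall>i. snd z i < n)" by (simp only:)
  then have 2: "AE \<omega> in MM. (\<forall>m. fst (snd \<omega>) m \<in> moran_pairs n) \<and> (\<forall>i. snd (snd \<omega>) i < n)"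
    by (intro AE_distrD[of snd MM MKX "\<lambda>z. (\<forall>m. fst z m \<in> moran_pairs n) \<and> (\<forall>i. snd z i < n)"])
       (simp_all add: MM_eq)
  from 1 2 show ?thesis by eventually_elim (auto simp: good_def)
qed

definition apart_test :: "(nat \<times> nat \<times> real) set \<Rightarrow> real \<Rightarrow> (nat \<Rightarrow> nat) \<Rightarrow> real" where
  "apart_test Q s x = of_bool (\<forall>(i, j, c)\<in>Q. c = s \<longrightarrow> x i \<noteq> x j)"

definition test_ok :: "(nat \<times> nat \<times> real) set \<Rightarrow> bool" where
  "test_ok Q \<longleftrightarrow> finite Q \<and> (\<forall>(i, j, c)\<in>Q. i \<in> {1..k} \<and> j \<in> {1..k} \<and> c < t i \<and> c < t j)"

definition apart :: "(nat \<times> nat \<times> real) set \<Rightarrow> omega \<Rightarrow> bool" where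
  "apart Q \<omega> \<longleftrightarrow> (\<forall>(i, j, c)\<in>Q. anc \<omega> c i \<noteq> anc \<omega> c j)"

lemma apart_test_cong: "test_ok Q \<Longrightarrow> (\<And>i j. i \<in> smp_ge s \<Longrightarrow> j \<in> smp_ge s \<Longrightarrow> (x i = x j) = (y i = y j)) \<Longrightarrow> apart_test Q s x = apart_test Q s y"
proof -
  assume Q: "test_ok Q" and xy: "\<And>i j. i \<in> smp_ge s \<Longrightarrow> j \<in> smp_ge s \<Longrightarrow> (x i = x j) = (y i = y j)"
  have "(c = s \<longrightarrow> x i \<noteq> x j) = (c = s \<longrightarrow> y i \<noteq> y j)" if "(i, j, c) \<in> Q" for i j c
  proof (cases "c = s")
    case True
    have "i \<in> {1..k} \<and> j \<in> {1..k} \<and> c < t i \<and> c < t j" using Q that by (auto simp: test_ok_def)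
    then have "i \<in> smp_ge s" "j \<in> smp_ge s" using True by (auto simp: smp_ge_def)
    then show ?thesis using xy by blast
  qed simp
  then have "(\<forall>(i, j, c)\<in>Q. c = s \<longrightarrow> x i \<noteq> x j) = (\<forall>(i, j, c)\<in>Q. c = s \<longrightarrow> y i \<noteq> y j)" by fast
  then show ?thesis by (simp add: apart_test_def)
qed

lemma invariant_test_apart_test: "test_ok Q \<Longrightarrow> invariant_test (apart_test Q)"
proof -
  assume Q: "test_ok Q"
  have "kernel_inv (smp_ge s) (apart_test Q s)" for s
    unfolding kernel_inv_def
  proof (intro allI impI)
    fix x y assume "same_kernel (smp_ge s) x y"
    then show "apart_test Q s x = apart_test Q s y" by (intro apart_test_cong[OF Q]) (auto simp: same_kernel_def)
  qed
  moreover have "unit_bdd (apart_test Q s)" for s by (simp add: unit_bdd_def apart_test_def)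
  ultimately show ?thesis by (simp add: invariant_test_def)
qed

lemma smp_ge_act: "i \<in> smp_ge s \<Longrightarrow> i \<in> {1..Suc k} \<and> s \<le> t i"
  by (auto simp: smp_ge_def)

lemma local_at_cong_image:
  assumes "\<forall>i\<in>{1..Suc k}. s \<le> t i \<longrightarrow> x i = y i"
  shows "x ` smp_ge s = y ` smp_ge s" "x ` smp_gt s = y ` smp_gt s"
  using assms by (auto intro!: image_cong simp: smp_ge_def smp_gt_def)

lemma local_at_apart_test: assumes "test_ok Q" shows "local_at s (apart_test Q s)"
  unfolding local_at_def
proof (intro allI impI)
  fix x y :: "nat \<Rightarrow> nat" assume *: "\<forall>i\<in>{1..Suc k}. s \<le> t i \<longrightarrow> x i = y i"
  show "apart_test Q s x = apart_test Q s y"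
    by (rule apart_test_cong[OF assms]) (use * smp_ge_act[of _ s] in auto)
qed

lemma local_at_separate: "\<forall>i\<in>{1..Suc k}. s \<le> t i \<longrightarrow> x i = y i \<Longrightarrow> separate s x = separate s y"
proof (cases "smp_ge s = {}")
  case False
  assume *: "\<forall>i\<in>{1..Suc k}. s \<le> t i \<longrightarrow> x i = y i"
  from False obtain i where "i \<in> smp_ge s" by blast
  then have "s \<le> t (Suc k)" using t_less[of i "Suc k"] by (auto simp: smp_ge_def)
  then show ?thesis using * local_at_cong_image[OF *] by (simp add: separate_def)
qed (simp add: separate_def)

lemma local_at_sep_weight: assumes "test_ok Q" shows "local_at s (sep_weight (apart_test Q) a s s')"
  unfolding local_at_def
proof (intro allI impI)
  fix x y :: "nat \<Rightarrow> nat" assume *: "\<forall>i\<in>{1..Suc k}. s \<le> t i \<longrightarrow> x i = y i"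
  have "apart_test Q s x = apart_test Q s y" using local_at_apart_test[OF assms, of s] * by (simp only: local_at_def)
  then show "sep_weight (apart_test Q) a s s' x = sep_weight (apart_test Q) a s s' y" using local_at_separate[OF *] by (simp add: sep_weight_def)
qed

lemma local_at_kill_weight: assumes "test_ok Q" shows "local_at s (kill_weight (apart_test Q) a s s')"
  unfolding local_at_def
proof (intro allI impI)
  fix x y :: "nat \<Rightarrow> nat" assume *: "\<forall>i\<in>{1..Suc k}. s \<le> t i \<longrightarrow> x i = y i"
  have "apart_test Q s x = apart_test Q s y" using local_at_apart_test[OF assms, of s] * by (simp only: local_at_def)
  then show "kill_weight (apart_test Q) a s s' x = kill_weight (apart_test Q) a s s' y" using local_at_cong_image[OF *] by (simp add: kill_weight_def)
qed

lemma local_at_live_weight: "local_at s (live_weight a s)"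
  unfolding local_at_def
proof (intro allI impI)
  fix x y :: "nat \<Rightarrow> nat" assume *: "\<forall>i\<in>{1..Suc k}. s \<le> t i \<longrightarrow> x i = y i"
  show "live_weight a s x = live_weight a s y" using local_at_cong_image[OF *] by (simp add: live_weight_def)
qed

lemma path_weight_sep:
  "path_weight (sep_weight g a) no_weight ts Y = (\<Prod>s\<leftarrow>ts. g s (Y s)) * (\<Prod>s\<leftarrow>ts. if a \<le> s then of_bool (separate s (Y s)) else 1)"
  by (induction ts rule: induct_list012) (auto simp: sep_weight_def)

lemma path_weight_kill_weight:
  "path_weight (kill_weight g a) (live_weight a) ts Y = (\<Prod>s\<leftarrow>ts. g s (Y s)) * exp (- (rate * grid_sum a (\<lambda>s. real (card (Y s ` smp_ge s))) ts))
     * (\<Prod>s\<leftarrow>ts. live_weight a s (Y s))"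
  by (induction ts rule: induct_list012) (auto simp: kill_weight_def algebra_simps exp_minus exp_add exp_diff field_simps)

lemma prod_list_of_bool: "(\<Prod>s\<leftarrow>ts. of_bool (P s) :: real) = of_bool (\<forall>s\<in>set ts. P s)"
  by (induction ts) auto

lemma prod_apart_test:
  assumes "test_ok Q" "\<And>i j c. (i, j, c) \<in> Q \<Longrightarrow> c \<in> set ts"
  shows "(\<Prod>s\<leftarrow>ts. apart_test Q s (anc \<omega> s)) = of_bool (apart Q \<omega>)"
  unfolding apart_test_def prod_list_of_bool apart_def using assms(2) by (intro arg_cong[where f = of_bool]) fastforce

lemma path_weight_L_eq:
  assumes g: "goodE (fst \<omega>)" and Q: "test_ok Q" "\<And>i j c. (i, j, c) \<in> Q \<Longrightarrow> c \<in> set ts" and a: "a \<in> set ts"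
  shows "path_weight (sep_weight (apart_test Q) a) no_weight ts (anc \<omega>) = of_bool (apart Q \<omega> \<and> separate a (anc \<omega> a))"
proof -
  have "(\<Prod>s\<leftarrow>ts. if a \<le> s then of_bool (separate s (anc \<omega> s)) else 1) = (\<Prod>s\<leftarrow>ts. of_bool (a \<le> s \<longrightarrow> separate s (anc \<omega> s)) :: real)"
    by (rule arg_cong[where f = prod_list], rule map_cong) auto
  also have "\<dots> = of_bool (\<forall>s\<in>set ts. a \<le> s \<longrightarrow> separate s (anc \<omega> s))" by (rule prod_list_of_bool)
  also have "(\<forall>s\<in>set ts. a \<le> s \<longrightarrow> separate s (anc \<omega> s)) \<longleftrightarrow> separate a (anc \<omega> a)"
  proof
    assume sp: "separate a (anc \<omega> a)"
    show "\<forall>s\<in>set ts. a \<le> s \<longrightarrow> separate s (anc \<omega> s)"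
    proof (intro ballI impI, rule ccontr)
      fix s assume s: "a \<le> s" "\<not> separate s (anc \<omega> s)"
      then obtain i where i: "i \<in> smp_ge s" "anc \<omega> s (Suc k) = anc \<omega> s i" by (auto simp: separate_def)
      have "t i < t (Suc k)" using i by (intro t_less) (auto simp: smp_ge_def)
      then have "anc \<omega> a (Suc k) = anc \<omega> a i"
        using i s by (intro anc_coal[OF g _ _ _ i(2)]) (auto simp: smp_ge_def)
      moreover have "i \<in> smp_ge a" using i s by (auto simp: smp_ge_def)
      ultimately show False using sp by (auto simp: separate_def)
    qed
  qed (use a in auto)
  finally have 1: "(\<Prod>s\<leftarrow>ts. if a \<le> s then of_bool (separate s (anc \<omega> s)) else 1) = (of_bool (separate a (anc \<omega> a)) :: real)" .
  have 2: "(\<Prod>s\<leftarrow>ts. apart_test Q s (anc \<omega> s)) = of_bool (apart Q \<omega>)" by (rule prod_apart_test[OF Q])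
  show ?thesis unfolding path_weight_sep 1 2 by simp
qed

lemma path_weight_unit:
  assumes "\<And>s s'. s' \<le> s \<Longrightarrow> unit_bdd (G s s')" "\<And>s. unit_bdd (C s)" "\<And>s. valid (Y s)"
  shows "sorted_wrt (>) ts \<Longrightarrow> 0 \<le> path_weight G C ts Y \<and> path_weight G C ts Y \<le> 1"
proof (induction ts rule: induct_list012)
  case (2 s)
  have "0 \<le> C s (Y s) \<and> C s (Y s) \<le> 1" "0 \<le> G s s (Y s) \<and> G s s (Y s) \<le> 1"
    using assms by (auto simp: unit_bdd_def)
  then show ?case by (auto intro!: mult_nonneg_nonneg mult_le_one)
next
  case (3 s s' ts)
  then have "s' \<le> s" by auto
  then have "0 \<le> C s (Y s) \<and> C s (Y s) \<le> 1" "0 \<le> G s s' (Y s) \<and> G s s' (Y s) \<le> 1"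
    using assms by (auto simp: unit_bdd_def)
  then show ?case using 3 by (auto intro!: mult_nonneg_nonneg mult_le_one)
qed simp

lemma integral_path_weight:
  assumes G: "\<And>s s'. s' \<le> s \<Longrightarrow> unit_bdd (G s s')" and C: "\<And>s. unit_bdd (C s)"
    and Gl: "\<And>s s'. local_at s (G s s')" and Cl: "\<And>s. local_at s (C s)"
    and ts: "grid ts" "0 \<in> set ts" "t (Suc k) \<le> hd ts" and x: "valid x"
  shows "(\<integral>\<omega>. path_weight G C ts (anc \<omega>) \<partial>MM) = sample_avg (hd ts) (\<lambda>x. C (hd ts) x * chain_val G C ts x) x"
    and "integrable MM (\<lambda>\<omega>. path_weight G C ts (anc \<omega>))"
proof -
  have srt: "sorted_wrt (>) ts" using ts by (auto simp: grid_def)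
  note m = measurable_path_weight[where G = G and C = C, OF Gl Cl, of ts]
  have b: "AE \<omega> in MM. 0 \<le> path_weight G C ts (anc \<omega>) \<and> path_weight G C ts (anc \<omega>) \<le> 1"
    using AE_good
  proof eventually_elim
    case (elim \<omega>)
    show ?case by (rule path_weight_unit[OF G C _ srt]) (auto intro: anc_valid elim)
  qed
  show "integrable MM (\<lambda>\<omega>. path_weight G C ts (anc \<omega>))"
  proof (rule MM.integrable_const_bound[of _ 1])
    show "AE \<omega> in MM. norm (path_weight G C ts (anc \<omega>)) \<le> 1" using b by eventually_elim auto
  qed (rule m)
  have "unit_bdd (sample_avg (hd ts) (\<lambda>x. C (hd ts) x * chain_val G C ts x))"
    by (intro unit_bdd_sample_avg unit_bdd_mult C unit_bdd_chain_val G srt)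
  then have "0 \<le> sample_avg (hd ts) (\<lambda>x. C (hd ts) x * chain_val G C ts x) x" using x by (auto simp: unit_bdd_def)
  moreover have "(\<integral>\<omega>. path_weight G C ts (anc \<omega>) \<partial>MM) = enn2real (\<integral>\<^sup>+\<omega>. ennreal (path_weight G C ts (anc \<omega>)) \<partial>MM)"
    by (rule integral_eq_nn_integral[OF m]) (use b in \<open>auto elim!: eventually_mono\<close>)
  ultimately show "(\<integral>\<omega>. path_weight G C ts (anc \<omega>) \<partial>MM) = sample_avg (hd ts) (\<lambda>x. C (hd ts) x * chain_val G C ts x) x"
    using nn_integral_path_weight[where G = G and C = C, OF G C Gl Cl ts x] by simp
qed

lemma path_weight_compare:
  assumes Q: "test_ok Q" and ts: "grid ts" "0 \<in> set ts" "t (Suc k) \<le> hd ts" and a: "a \<in> set ts"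
  shows "\<bar>(\<integral>\<omega>. path_weight (sep_weight (apart_test Q) a) no_weight ts (anc \<omega>) \<partial>MM) - (\<integral>\<omega>. path_weight (kill_weight (apart_test Q) a) (live_weight a) ts (anc \<omega>) \<partial>MM)\<bar>
    \<le> 4 * mu\<^sup>2 * sq_gaps ts"
proof -
  note g = invariant_test_apart_test[OF Q]
  define x :: "nat \<Rightarrow> nat" where "x = (\<lambda>_. 0)"
  have x: "valid x" using n2 by (simp add: valid_def x_def)
  have lCL: "local_at s (\<lambda>_. 1)" for s by (simp add: local_at_def)
  have Lf: "(\<integral>\<omega>. path_weight (sep_weight (apart_test Q) a) no_weight ts (anc \<omega>) \<partial>MM) = sample_avg (hd ts) (\<lambda>x. 1 * chain_val (sep_weight (apart_test Q) a) no_weight ts x) x"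
    by (rule integral_path_weight[OF invariant_test_sep_weight[OF g] unit_bdd_one local_at_sep_weight[OF Q] lCL ts x])
  have Rf: "(\<integral>\<omega>. path_weight (kill_weight (apart_test Q) a) (live_weight a) ts (anc \<omega>) \<partial>MM) = sample_avg (hd ts) (\<lambda>x. live_weight a (hd ts) x * chain_val (kill_weight (apart_test Q) a) (live_weight a) ts x) x"
    by (rule integral_path_weight[OF invariant_test_kill_weight(1)[OF g] unit_bdd_live_weight local_at_kill_weight[OF Q] local_at_live_weight ts x])
  have J0: "smp_ge (hd ts) = {}" "smp_gt (hd ts) = {}"
    using t_less[of _ "Suc k"] ts(3) by (force simp: smp_ge_def smp_gt_def)+
  let ?e = "4 * mu\<^sup>2 * sq_gaps ts"
  have "\<bar>(\<Sum>y<n. 1 * chain_val (sep_weight (apart_test Q) a) no_weight ts (slot_upd (hd ts) y x))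
     - (\<Sum>y<n. live_weight a (hd ts) (slot_upd (hd ts) y x) * chain_val (kill_weight (apart_test Q) a) (live_weight a) ts (slot_upd (hd ts) y x))\<bar> \<le> real (card {..<n}) * ?e"
  proof (rule abs_sum_diff_le)
    fix y assume "y \<in> {..<n}"
    then have v: "valid (slot_upd (hd ts) y x)" by (intro valid_slot_upd x) simp
    have "live_weight a (hd ts) (slot_upd (hd ts) y x) = 1" by (simp add: live_weight_def J0)
    then show "\<bar>1 * chain_val (sep_weight (apart_test Q) a) no_weight ts (slot_upd (hd ts) y x)
       - live_weight a (hd ts) (slot_upd (hd ts) y x) * chain_val (kill_weight (apart_test Q) a) (live_weight a) ts (slot_upd (hd ts) y x)\<bar> \<le> ?e"
      using chain_val_compare[OF g ts(1) a v] by (simp add: separate_def J0)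
  qed
  then show ?thesis unfolding Lf Rf sample_avg_def using nn_pos
    by (simp add: diff_divide_distrib[symmetric] abs_divide divide_le_eq mult.commute)
qed

lemma measurable_apart [measurable]: "test_ok Q \<Longrightarrow> Measurable.pred MM (apart Q)"
proof -
  assume "test_ok Q"
  then have f: "finite Q" by (simp add: test_ok_def)
  have p: "Measurable.pred MM (\<lambda>\<omega>. anc \<omega> c i = anc \<omega> c j)" for c i j
    by (rule measurable_comp2_countable[OF measurable_anc measurable_anc])
  have "Measurable.pred MM (\<lambda>\<omega>. \<forall>q\<in>Q. \<not> (anc \<omega> (snd (snd q)) (fst q) = anc \<omega> (snd (snd q)) (fst (snd q))))"
    by (intro pred_intros_finite(3)[OF f] pred_intros_logic p)
  then show ?thesis by (simp add: apart_def[abs_def] case_prod_beta)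
qed

lemma measurable_separate [measurable]: "Measurable.pred MM (\<lambda>\<omega>. separate s (anc \<omega> s))"
proof -
  have p: "Measurable.pred MM (\<lambda>\<omega>. anc \<omega> s i = anc \<omega> s j)" for i j
    by (rule measurable_comp2_countable[OF measurable_anc measurable_anc])
  have "Measurable.pred MM (\<lambda>\<omega>. \<forall>i\<in>smp_ge s. \<not> (anc \<omega> s (Suc k) = anc \<omega> s i))"
    by (intro pred_intros_finite(3) finite_smp_ge pred_intros_logic p)
  then show ?thesis by (simp add: separate_def[abs_def] image_iff)
qed

lemma grid_for:
  assumes P: "finite P" "t ` {1..Suc k} \<subseteq> P" and e: "0 < e"
  obtains ts where "grid ts" "P \<subseteq> set ts" "t (Suc k) \<le> hd ts" "\<forall>d\<in>set (gaps ts). d \<le> e"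
    "sq_gaps ts \<le> e * (Max P - Min P)" "\<And>p. p \<in> P \<Longrightarrow> p \<le> hd ts"
proof -
  have ne: "P \<noteq> {}" using P by auto
  obtain ts where ts: "sorted_wrt (>) ts" "P \<subseteq> set ts" "ts \<noteq> []" "hd ts = Max P" "last ts = Min P"
    "\<forall>d\<in>set (gaps ts). d \<le> e" using fine_grid_exists[OF P(1) ne e] by metis
  show ?thesis
  proof (rule that[of ts])
    show "grid ts" using ts P by (auto simp: grid_def)
    show "t (Suc k) \<le> hd ts" unfolding ts(4) using P by (intro Max_ge) auto
    show "sq_gaps ts \<le> e * (Max P - Min P)" using sq_gaps_le[OF ts(1,6,3)] ts(4,5) by simp
    show "p \<le> hd ts" if "p \<in> P" for p unfolding ts(4) using P that by (intro Max_ge) auto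
  qed (use ts in auto)
qed

lemma separate_prob_le:
  assumes k1: "1 \<le> k" and a: "a \<le> t 1"
  shows "(\<integral>\<omega>. of_bool (separate a (anc \<omega> a)) \<partial>MM) \<le> exp (- (rate * (t 1 - a - 1)))"
proof (rule field_le_epsilon)
  fix d :: real assume d: "0 < d"
  define P where "P = insert 0 (insert a (t ` {1..Suc k}))"
  have P: "finite P" "t ` {1..Suc k} \<subseteq> P" by (auto simp: P_def)
  define len where "len = 4 * mu\<^sup>2 * (Max P - Min P) + 1"
  have "Min P \<le> Max P" by (rule Min.coboundedI[THEN order_trans, OF P(1) _ Max_ge[OF P(1)], of 0]) (auto simp: P_def)
  then have "0 \<le> 4 * mu\<^sup>2 * (Max P - Min P)" by simp
  then have len: "0 < len" unfolding len_def by linarith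
  define e where "e = min 1 (d / len)"
  have e: "0 < e" "e \<le> 1" "e * len \<le> d" using d len by (auto simp: e_def min_def field_simps)
  obtain ts where ts: "grid ts" "P \<subseteq> set ts" "t (Suc k) \<le> hd ts" "\<forall>d\<in>set (gaps ts). d \<le> e"
    "sq_gaps ts \<le> e * (Max P - Min P)" "\<And>p. p \<in> P \<Longrightarrow> p \<le> hd ts" using grid_for[OF P e(1)] by metis
  have mem: "0 \<in> set ts" "a \<in> set ts" using ts(2) by (auto simp: P_def)
  have srt: "sorted_wrt (>) ts" using ts by (auto simp: grid_def)
  have Q: "test_ok {}" by (simp add: test_ok_def)
  have "(\<integral>\<omega>. of_bool (separate a (anc \<omega> a)) \<partial>MM) = (\<integral>\<omega>. path_weight (sep_weight (apart_test {}) a) no_weight ts (anc \<omega>) \<partial>MM)"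
  proof (rule integral_cong_AE)
    show "(\<lambda>\<omega>. path_weight (sep_weight (apart_test {}) a) no_weight ts (anc \<omega>)) \<in> borel_measurable MM"
      by (rule measurable_path_weight[OF local_at_sep_weight[OF Q]]) (simp add: local_at_def)
    show "AE \<omega> in MM. of_bool (separate a (anc \<omega> a)) = path_weight (sep_weight (apart_test {}) a) no_weight ts (anc \<omega>)"
      using AE_good
    proof eventually_elim
      case (elim \<omega>)
      have "goodE (fst \<omega>)" using elim by (simp add: good_def)
      from path_weight_L_eq[OF this Q _ mem(2)] show ?case by (simp add: apart_def)
    qed
  qed measurable
  also have "\<dots> \<le> (\<integral>\<omega>. path_weight (kill_weight (apart_test {}) a) (live_weight a) ts (anc \<omega>) \<partial>MM) + 4 * mu\<^sup>2 * sq_gaps ts"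
    using path_weight_compare[OF Q ts(1) mem(1) ts(3) mem(2)] by simp
  also have "(\<integral>\<omega>. path_weight (kill_weight (apart_test {}) a) (live_weight a) ts (anc \<omega>) \<partial>MM) \<le> (\<integral>\<omega>. exp (- (rate * (t 1 - a - 1))) \<partial>MM)"
  proof (rule integral_mono_AE)
    have v0: "valid (\<lambda>_. 0)" using n2 by (simp add: valid_def)
    show "integrable MM (\<lambda>\<omega>. path_weight (kill_weight (apart_test {}) a) (live_weight a) ts (anc \<omega>))"
      by (rule integral_path_weight(2)[OF invariant_test_kill_weight(1)[OF invariant_test_apart_test[OF Q]] unit_bdd_live_weight local_at_kill_weight[OF Q] local_at_live_weight ts(1) mem(1) ts(3) v0])
    show "AE \<omega> in MM. path_weight (kill_weight (apart_test {}) a) (live_weight a) ts (anc \<omega>) \<le> exp (- (rate * (t 1 - a - 1)))"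
      using AE_good
    proof eventually_elim
      case (elim \<omega>)
      have "grid_sum a (\<lambda>s. of_bool (s \<le> t 1)) ts \<le> grid_sum a (\<lambda>s. real (card (anc \<omega> s ` smp_ge s))) ts"
      proof (rule grid_sum_mono[OF srt])
        fix s
        have "0 < card (anc \<omega> s ` smp_ge s)" if "s \<le> t 1"
          using that k1 by (auto simp: card_gt_0_iff smp_ge_def)
        then show "of_bool (s \<le> t 1) \<le> real (card (anc \<omega> s ` smp_ge s))" by (cases "s \<le> t 1") auto
      qed
      moreover have "max 0 (t 1 - a) - e \<le> grid_sum a (\<lambda>s. of_bool (s \<le> t 1)) ts"
      proof -
        have "t 1 \<le> hd ts" by (rule ts(6)) (auto simp: P_def)
        then show ?thesis using grid_sum_step[OF _ srt mem(2) _ ts(4), of "t 1"] e by auto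
      qed
      ultimately have r: "t 1 - a - 1 \<le> grid_sum a (\<lambda>s. real (card (anc \<omega> s ` smp_ge s))) ts" using e a by simp
      have "(\<Prod>s\<leftarrow>ts. live_weight a s (anc \<omega> s)) \<le> 1 \<and> 0 \<le> (\<Prod>s\<leftarrow>ts. live_weight a s (anc \<omega> s))"
      proof -
        have "0 \<le> live_weight a s (anc \<omega> s) \<and> live_weight a s (anc \<omega> s) \<le> 1" for s
          using unit_bdd_live_weight anc_valid[OF elim] by (auto simp: unit_bdd_def)
        then show ?thesis by (induction ts) (auto intro!: mult_le_one)
      qed
      moreover have "(\<Prod>s\<leftarrow>ts. apart_test {} s (anc \<omega> s)) = 1"
        by (subst prod_apart_test[OF Q]) (auto simp: apart_def)
      ultimately have "path_weight (kill_weight (apart_test {}) a) (live_weight a) ts (anc \<omega>) \<le> exp (- (rate * grid_sum a (\<lambda>s. real (card (anc \<omega> s ` smp_ge s))) ts))"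
        unfolding path_weight_kill_weight by (simp add: mult_left_le)
      also have "\<dots> \<le> exp (- (rate * (t 1 - a - 1)))" using r rate_pos by simp
      finally show ?case .
    qed
  qed simp
  also have "(\<integral>\<omega>. exp (- (rate * (t 1 - a - 1))) \<partial>MM) = exp (- (rate * (t 1 - a - 1)))"
    using MM.prob_space by simp
  also have "4 * mu\<^sup>2 * sq_gaps ts \<le> d"
  proof -
    have "4 * mu\<^sup>2 * sq_gaps ts \<le> 4 * mu\<^sup>2 * (e * (Max P - Min P))"
      using ts(5) by (intro mult_left_mono) auto
    also have "\<dots> \<le> e * len" using e by (simp add: len_def algebra_simps)
    finally show ?thesis using e by simp
  qed
  finally show "(\<integral>\<omega>. of_bool (separate a (anc \<omega> a)) \<partial>MM) \<le> exp (- (rate * (t 1 - a - 1))) + d" by simp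
qed

lemma AE_some_meet:
  assumes k1: "1 \<le> k"
  shows "AE \<omega> in MM. \<exists>i\<in>{1..k}. \<exists>s\<le>t i. anc \<omega> s i = anc \<omega> s (Suc k)"
proof -
  define B where "B = {\<omega>. \<forall>N::nat. separate (t 1 - real N) (anc \<omega> (t 1 - real N))}"
  have Bm: "B \<in> sets MM"
  proof -
    have "{\<omega> \<in> space MM. \<forall>N::nat. separate (t 1 - real N) (anc \<omega> (t 1 - real N))} \<in> sets MM" by measurable
    then show ?thesis by (simp add: B_def)
  qed
  have le: "measure MM B \<le> exp (- (rate * (real N - 1)))" for N :: nat
  proof -
    have "measure MM B = (\<integral>\<omega>. indicator B \<omega> \<partial>MM)" using Bm by simp
    also have "\<dots> \<le> (\<integral>\<omega>. of_bool (separate (t 1 - real N) (anc \<omega> (t 1 - real N))) \<partial>MM)"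
    proof (rule integral_mono)
      show "integrable MM (\<lambda>\<omega>. of_bool (separate (t 1 - real N) (anc \<omega> (t 1 - real N))) :: real)"
        by (rule MM.integrable_const_bound[of _ 1]) auto
      show "integrable MM (indicator B :: _ \<Rightarrow> real)"
        by (rule MM.integrable_const_bound[of _ 1]) (use Bm in auto)
    qed (auto simp: B_def indicator_def)
    also have "\<dots> \<le> exp (- (rate * (t 1 - (t 1 - real N) - 1)))" by (rule separate_prob_le[OF k1]) simp
    finally show ?thesis by simp
  qed
  have "(\<lambda>N. exp (- (rate * (real N - 1)))) \<longlonglongrightarrow> 0"
  proof -
    have "(\<lambda>N. exp rate * exp (- rate) ^ N) \<longlonglongrightarrow> exp rate * 0"
      by (intro tendsto_mult tendsto_const LIMSEQ_realpow_zero) (use rate_pos in auto)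
    moreover have "exp rate * exp (- rate) ^ N = exp (- (rate * (real N - 1)))" for N
      by (simp add: algebra_simps flip: exp_of_nat_mult exp_add)
    ultimately show ?thesis by simp
  qed
  then have "measure MM B \<le> 0" by (rule LIMSEQ_le_const) (use le in auto)
  then have "emeasure MM B = 0" by (simp add: MM.emeasure_eq_measure measure_le_0_iff)
  then have "AE \<omega> in MM. \<omega> \<notin> B" using Bm by (intro AE_not_in) auto
  then show ?thesis
  proof eventually_elim
    case (elim \<omega>)
    then obtain N :: nat where "\<not> separate (t 1 - real N) (anc \<omega> (t 1 - real N))" by (auto simp: B_def)
    then obtain i where "i \<in> smp_ge (t 1 - real N)" "anc \<omega> (t 1 - real N) (Suc k) = anc \<omega> (t 1 - real N) i"
      by (auto simp: separate_def)
    then show ?case by (intro bexI[of _ i] exI[of _ "t 1 - real N"]) (auto simp: smp_ge_def)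
  qed
qed

end

lemma (in smgp) AE_meets: "AE \<omega> in MM. meets \<omega>"
proof -
  have "AE \<omega> in MM. \<forall>j::nat. 1 \<le> j \<longrightarrow> (\<exists>i\<in>{1..j}. \<exists>s\<le>t i. anc \<omega> s i = anc \<omega> s (Suc j))"
    unfolding AE_all_countable
  proof
    fix j :: nat
    show "AE \<omega> in MM. 1 \<le> j \<longrightarrow> (\<exists>i\<in>{1..j}. \<exists>s\<le>t i. anc \<omega> s i = anc \<omega> s (Suc j))"
      using smgp.AE_some_meet[OF smgp_axioms, of j] by (cases "1 \<le> j") auto
  qed
  with AE_good show ?thesis
  proof eventually_elim
    case (elim \<omega>)
    have g: "goodE (fst \<omega>)" using elim by (simp add: good_def)
    have "\<exists>s. \<forall>i\<in>{1..j}. \<forall>l\<in>{1..j}. s \<le> t i \<and> anc \<omega> s i = anc \<omega> s l" for j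
    proof (induction j)
      case (Suc j)
      then obtain s where s: "\<And>i l. i \<in> {1..j} \<Longrightarrow> l \<in> {1..j} \<Longrightarrow> s \<le> t i \<and> anc \<omega> s i = anc \<omega> s l" by blast
      show ?case
      proof (cases "1 \<le> j")
        case False
        then have "j = 0" by simp
        then show ?thesis by (intro exI[of _ "t 1"]) auto
      next
        case True
        obtain i u where i: "i \<in> {1..j}" "u \<le> t i" "anc \<omega> u i = anc \<omega> u (Suc j)" using elim(2) True by blast
        have ti: "t i < t (Suc j)" using i by (intro t_less) auto
        define v where "v = min s u"
        have v: "v \<le> s" "v \<le> u" by (auto simp: v_def)
        have c: "anc \<omega> v l = anc \<omega> v i" "v \<le> t l" if "l \<in> {1..Suc j}" for l
        proof -
          have "anc \<omega> v l = anc \<omega> v i \<and> v \<le> t l"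
          proof (cases "l = Suc j")
            case True
            then show ?thesis using anc_coal[OF g v(2) _ _ i(3)] i ti v by auto
          next
            case False
            then have "l \<in> {1..j}" using that by auto
            then show ?thesis using anc_coal[OF g v(1), of l i] s[of l i] s[of i l] i v by auto
          qed
          then show "anc \<omega> v l = anc \<omega> v i" "v \<le> t l" by auto
        qed
        show ?thesis by (intro exI[of _ v] ballI conjI) (use c in auto)
      qed
    qed simp
    then have "\<exists>s. s \<le> t i \<and> s \<le> t l \<and> anc \<omega> s i = anc \<omega> s l" if "1 \<le> i" "1 \<le> l" for i l
    proof -
      from \<open>\<And>j. \<exists>s. \<forall>i\<in>{1..j}. \<forall>l\<in>{1..j}. s \<le> t i \<and> anc \<omega> s i = anc \<omega> s l\<close>[of "max i l"]
      obtain s where s: "\<forall>i'\<in>{1..max i l}. \<forall>l'\<in>{1..max i l}. s \<le> t i' \<and> anc \<omega> s i' = anc \<omega> s l'" by blast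
      have "i \<in> {1..max i l}" "l \<in> {1..max i l}" using that by auto
      then show ?thesis using s by blast
    qed
    then show ?case unfolding meets_def by (metis min.bounded_iff)
  qed
qed

section \<open>The survival weight\<close>

context smgp begin

definition lin_integral :: "omega \<Rightarrow> real \<Rightarrow> real" where
  "lin_integral \<omega> a = (\<Sum>i\<in>{1..k}. max 0 (t i - a)) - (\<Sum>j\<in>{2..k}. max 0 (attach t \<omega> j - a))"

definition live_factor :: "omega \<Rightarrow> nat \<Rightarrow> real" where
  "live_factor \<omega> i = (if dead t k \<omega> i then 1 else (real n - lin_count \<omega> (t i) - 1) / (real n - lin_count \<omega> (t i)))"

definition surv_lt :: "omega \<Rightarrow> real \<Rightarrow> real" where
  "surv_lt \<omega> a = exp (- (rate * lin_integral \<omega> a)) * (\<Prod>i\<in>{1..k}. if a \<le> t i then live_factor \<omega> i else 1)"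

definition surv_le :: "omega \<Rightarrow> real \<Rightarrow> real" where
  "surv_le \<omega> a = exp (- (rate * lin_integral \<omega> a)) * (\<Prod>i\<in>{1..k}. if a < t i then live_factor \<omega> i else 1)"

lemma lin_integral_ge:
  assumes g: "goodE (fst \<omega>)" and m: "meets \<omega>" and k1: "1 \<le> k"
  shows "max 0 (t 1 - a) \<le> lin_integral \<omega> a"
proof -
  have "{1..k} = insert 1 {2..k}" using k1 by auto
  then have "(\<Sum>i\<in>{1..k}. max 0 (t i - a)) = max 0 (t 1 - a) + (\<Sum>i\<in>{2..k}. max 0 (t i - a))" by simp
  moreover have "(\<Sum>j\<in>{2..k}. max 0 (attach t \<omega> j - a)) \<le> (\<Sum>i\<in>{2..k}. max 0 (t i - a))"
    using attach_less(2)[OF g m] by (intro sum_mono) (force simp: max_def)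
  ultimately show ?thesis unfolding lin_integral_def by linarith
qed

lemma live_factor_live_weight:
  assumes g: "good \<omega>" and m: "meets \<omega>" and i: "i \<in> {1..k}"
  shows "live_weight a (t i) (anc \<omega> (t i)) = (if a \<le> t i then live_factor \<omega> i else 1)"
proof -
  have gE: "goodE (fst \<omega>)" using g by (simp add: good_def)
  show ?thesis unfolding live_weight_def live_factor_def dead_iff[OF g m i] lin_count_eq_card[OF gE m] by auto
qed

lemma live_factor_unit:
  assumes g: "good \<omega>" and m: "meets \<omega>" and i: "i \<in> {1..k}"
  shows "0 \<le> live_factor \<omega> i" "live_factor \<omega> i \<le> 1"
proof -
  have "0 \<le> live_weight (t i) (t i) (anc \<omega> (t i)) \<and> live_weight (t i) (t i) (anc \<omega> (t i)) \<le> 1"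
    using unit_bdd_live_weight anc_valid[OF g] unfolding unit_bdd_def by blast
  then show "0 \<le> live_factor \<omega> i" "live_factor \<omega> i \<le> 1" using live_factor_live_weight[OF assms, of "t i"] by simp_all
qed

lemma prod_live_weight:
  assumes g: "good \<omega>" and m: "meets \<omega>" and ts: "distinct ts" "t ` {1..k} \<subseteq> set ts"
  shows "(\<Prod>s\<leftarrow>ts. live_weight a s (anc \<omega> s)) = (\<Prod>i\<in>{1..k}. if a \<le> t i then live_factor \<omega> i else 1)"
proof -
  have "(\<Prod>s\<leftarrow>ts. live_weight a s (anc \<omega> s)) = (\<Prod>s\<in>set ts. live_weight a s (anc \<omega> s))"
    by (rule prod.distinct_set_conv_list[OF ts(1), symmetric])
  also have "\<dots> = (\<Prod>s\<in>t ` {1..k}. live_weight a s (anc \<omega> s))"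
  proof (rule prod.mono_neutral_right[OF _ ts(2)])
    show "\<forall>s\<in>set ts - t ` {1..k}. live_weight a s (anc \<omega> s) = 1"
    proof
      fix s assume "s \<in> set ts - t ` {1..k}"
      then have "smp_ge s = smp_gt s" by (auto simp: smp_ge_eq_smp_gt_Un)
      then show "live_weight a s (anc \<omega> s) = 1" by (simp add: live_weight_def)
    qed
  qed simp
  also have "\<dots> = (\<Prod>i\<in>{1..k}. live_weight a (t i) (anc \<omega> (t i)))"
    by (subst prod.reindex) (auto intro: inj_on_subset[OF t_inj])
  also have "\<dots> = (\<Prod>i\<in>{1..k}. if a \<le> t i then live_factor \<omega> i else 1)"
    by (rule prod.cong[OF refl]) (rule live_factor_live_weight[OF g m])
  finally show ?thesis .
qed

lemma card_smp_ge_sum: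
  assumes g: "goodE (fst \<omega>)" and m: "meets \<omega>" and ne: "\<And>m. event_time (fst \<omega>) m \<noteq> s"
  shows "real (card (anc \<omega> s ` smp_ge s)) = (\<Sum>i\<in>{1..k}. of_bool (s \<le> t i)) - (\<Sum>j\<in>{2..k}. of_bool (s \<le> attach t \<omega> j))"
proof -
  have "{i \<in> {1..k}. s \<le> t i \<and> \<not> (2 \<le> i \<and> s \<le> attach t \<omega> i)} = {i \<in> {1..k}. s \<le> t i} - {j \<in> {2..k}. s \<le> attach t \<omega> j}"
    by auto
  moreover have sub: "{j \<in> {2..k}. s \<le> attach t \<omega> j} \<subseteq> {i \<in> {1..k}. s \<le> t i}"
    using attach_less(2)[OF g m] by (force intro: less_imp_le le_less_trans)
  ultimately have "real (card (anc \<omega> s ` smp_ge s)) = real (card {i \<in> {1..k}. s \<le> t i}) - real (card {j \<in> {2..k}. s \<le> attach t \<omega> j})"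
    unfolding smp_ge_def card_anc_le[OF g m ne] by (simp add: card_Diff_subset card_mono of_nat_diff)
  then show ?thesis by (simp add: of_bool_def sum.If_cases Int_def)
qed

lemma exp_neg_lipschitz: "0 \<le> x \<Longrightarrow> 0 \<le> y \<Longrightarrow> \<bar>exp (- x) - exp (- y)\<bar> \<le> \<bar>x - (y::real)\<bar>"
proof (induction x y rule: linorder_wlog)
  case (le x y)
  have "exp (- x) * (1 - exp (- (y - x))) \<le> 1 * (y - x)"
  proof (rule mult_mono)
    show "1 - exp (- (y - x)) \<le> y - x" using exp_ge_add_one_self[of "- (y - x)"] by linarith
    show "0 \<le> 1 - exp (- (y - x))" using le by simp
  qed (use le in auto)
  moreover have "exp (- x) * (1 - exp (- (y - x))) = exp (- x) - exp (- y)"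
    by (simp add: algebra_simps flip: exp_add)
  moreover have "exp (- y) \<le> exp (- x)" using le by simp
  ultimately show ?case using le by simp
next
  case (sym x y) then show ?case by (simp add: abs_minus_commute)
qed

lemma path_weight_R_approx:
  assumes g: "good \<omega>" and m: "meets \<omega>" and k1: "1 \<le> k" and Q: "test_ok Q" "\<And>i j c. (i, j, c) \<in> Q \<Longrightarrow> c \<in> set ts"
    and ts: "grid ts" "t ` {1..Suc k} \<subseteq> set ts" "a \<in> set ts" and e: "\<forall>d\<in>set (gaps ts). d \<le> e" "0 \<le> e"
    and ne: "\<And>s m. s \<in> set ts \<Longrightarrow> event_time (fst \<omega>) m \<noteq> s"
  shows "\<bar>path_weight (kill_weight (apart_test Q) a) (live_weight a) ts (anc \<omega>) - of_bool (apart Q \<omega>) * surv_lt \<omega> a\<bar> \<le> rate * (2 * real k * e)"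
proof -
  have gE: "goodE (fst \<omega>)" using g by (simp add: good_def)
  have srt: "sorted_wrt (>) ts" and tsne: "ts \<noteq> []" using ts by (auto simp: grid_def)
  have dist: "distinct ts" using srt by (induction ts) auto
  have hd: "u \<le> hd ts" if "u \<in> set ts" for u using srt that by (cases ts) (auto simp: less_imp_le)
  define rs where "rs = grid_sum a (\<lambda>s. real (card (anc \<omega> s ` smp_ge s))) ts"
  define P where "P = (\<Prod>i\<in>{1..k}. if a \<le> t i then live_factor \<omega> i else 1)"
  have P01: "0 \<le> P" "P \<le> 1" unfolding P_def
    by (auto intro!: prod_nonneg prod_le_1 simp: live_factor_unit[OF g m])
  let ?q = "\<lambda>b. grid_sum a (\<lambda>s. of_bool (s \<le> b)) ts"
  have rs: "rs = (\<Sum>i\<in>{1..k}. ?q (t i)) - (\<Sum>j\<in>{2..k}. ?q (attach t \<omega> j))"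
    unfolding rs_def grid_sum_sum[symmetric] grid_sum_diff[symmetric]
    by (rule grid_sum_cong) (rule card_smp_ge_sum[OF gE m ne])
  have q: "\<bar>?q b - max 0 (b - a)\<bar> \<le> e" if "b \<le> hd ts" for b
    using grid_sum_step[OF e(2) srt ts(3) that e(1)] by linarith
  have b1: "\<bar>(\<Sum>i\<in>{1..k}. ?q (t i)) - (\<Sum>i\<in>{1..k}. max 0 (t i - a))\<bar> \<le> real (card {1..k}) * e"
    by (rule abs_sum_diff_le, rule q, rule hd) (use ts(2) in auto)
  have b2: "\<bar>(\<Sum>j\<in>{2..k}. ?q (attach t \<omega> j)) - (\<Sum>j\<in>{2..k}. max 0 (attach t \<omega> j - a))\<bar> \<le> real (card {2..k}) * e"
  proof (rule abs_sum_diff_le, rule q)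
    fix j assume j: "j \<in> {2..k}"
    then have "attach t \<omega> j < t j" by (intro attach_less(2)[OF gE m]) auto
    moreover have "t j \<le> hd ts" by (rule hd) (use ts(2) j in auto)
    ultimately show "attach t \<omega> j \<le> hd ts" by simp
  qed
  have "real (card {2..k}) * e \<le> real k * e" using e(2) by (intro mult_right_mono) auto
  then have d: "\<bar>rs - lin_integral \<omega> a\<bar> \<le> 2 * real k * e" unfolding rs lin_integral_def using b1 b2 by simp
  have rs0: "0 \<le> rs"
  proof -
    have "grid_sum a (\<lambda>_. 0) ts \<le> rs" unfolding rs_def by (rule grid_sum_mono[OF srt]) simp
    then show ?thesis by (simp add: grid_sum_zero)
  qed
  have IL0: "0 \<le> lin_integral \<omega> a" using lin_integral_ge[OF gE m k1, of a] by simp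
  have "\<bar>exp (- (rate * rs)) - exp (- (rate * lin_integral \<omega> a))\<bar> \<le> \<bar>rate * rs - rate * lin_integral \<omega> a\<bar>"
    by (rule exp_neg_lipschitz) (use rs0 IL0 rate_pos in auto)
  also have "\<dots> = rate * \<bar>rs - lin_integral \<omega> a\<bar>" using rate_pos by (simp add: abs_mult flip: right_diff_distrib)
  also have "\<dots> \<le> rate * (2 * real k * e)" using d rate_pos by (intro mult_left_mono) auto
  finally have ex: "\<bar>exp (- (rate * rs)) - exp (- (rate * lin_integral \<omega> a))\<bar> \<le> rate * (2 * real k * e)" .
  have path_weight: "path_weight (kill_weight (apart_test Q) a) (live_weight a) ts (anc \<omega>) = of_bool (apart Q \<omega>) * exp (- (rate * rs)) * P"
  proof -
    have 1: "(\<Prod>s\<leftarrow>ts. apart_test Q s (anc \<omega> s)) = of_bool (apart Q \<omega>)" by (rule prod_apart_test[OF Q])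
    have 2: "(\<Prod>s\<leftarrow>ts. live_weight a s (anc \<omega> s)) = P" unfolding P_def
      by (rule prod_live_weight[OF g m dist]) (use ts(2) in auto)
    show ?thesis unfolding path_weight_kill_weight 1 2 rs_def ..
  qed
  have "\<bar>path_weight (kill_weight (apart_test Q) a) (live_weight a) ts (anc \<omega>) - of_bool (apart Q \<omega>) * surv_lt \<omega> a\<bar>
    = of_bool (apart Q \<omega>) * P * \<bar>exp (- (rate * rs)) - exp (- (rate * lin_integral \<omega> a))\<bar>"
    unfolding path_weight surv_lt_def P_def[symmetric] using P01
    by (cases "apart Q \<omega>") (auto simp: abs_mult mult.commute[of _ P] simp flip: right_diff_distrib)
  also have "\<dots> \<le> 1 * 1 * \<bar>exp (- (rate * rs)) - exp (- (rate * lin_integral \<omega> a))\<bar>"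
    using P01 by (intro mult_right_mono mult_mono) auto
  finally show ?thesis using ex by simp
qed

lemma measurable_attach_le [measurable]: "j \<in> {2..k} \<Longrightarrow> (\<lambda>\<omega>. attach t \<omega> j) \<in> borel_measurable MM"
  by (rule measurable_attach) auto

lemma surv_lt_unit:
  assumes "good \<omega>" "meets \<omega>" "1 \<le> k" shows "0 \<le> surv_lt \<omega> a" "surv_lt \<omega> a \<le> 1"
proof -
  have gE: "goodE (fst \<omega>)" using assms by (simp add: good_def)
  have "0 \<le> lin_integral \<omega> a" using lin_integral_ge[OF gE assms(2,3), of a] by simp
  moreover have "0 \<le> (\<Prod>i\<in>{1..k}. if a \<le> t i then live_factor \<omega> i else 1) \<and> (\<Prod>i\<in>{1..k}. if a \<le> t i then live_factor \<omega> i else 1) \<le> 1"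
    by (auto intro!: prod_nonneg prod_le_1 simp: live_factor_unit[OF assms(1,2)])
  ultimately show "0 \<le> surv_lt \<omega> a" "surv_lt \<omega> a \<le> 1" using rate_pos unfolding surv_lt_def by (auto intro!: mult_le_one)
qed

lemma surv_le_unit:
  assumes "good \<omega>" "meets \<omega>" "1 \<le> k" shows "0 \<le> surv_le \<omega> a" "surv_le \<omega> a \<le> 1"
proof -
  have gE: "goodE (fst \<omega>)" using assms by (simp add: good_def)
  have "0 \<le> lin_integral \<omega> a" using lin_integral_ge[OF gE assms(2,3), of a] by simp
  moreover have "0 \<le> (\<Prod>i\<in>{1..k}. if a < t i then live_factor \<omega> i else 1) \<and> (\<Prod>i\<in>{1..k}. if a < t i then live_factor \<omega> i else 1) \<le> 1"
    by (auto intro!: prod_nonneg prod_le_1 simp: live_factor_unit[OF assms(1,2)])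
  ultimately show "0 \<le> surv_le \<omega> a" "surv_le \<omega> a \<le> 1" using rate_pos unfolding surv_le_def by (auto intro!: mult_le_one)
qed

text \<open>\<open>N\<close> will be both the whole space and the algebra generated by the genealogy.\<close>

lemma measurable_surv:
  assumes [measurable]: "\<And>j. j \<in> {2..k} \<Longrightarrow> (\<lambda>\<omega>. attach t \<omega> j) \<in> borel_measurable N"
  shows "(\<lambda>z. lin_count (fst z) (snd z)) \<in> borel_measurable (N \<Otimes>\<^sub>M borel)"
    and "(\<lambda>z. surv_lt (fst z) (snd z)) \<in> borel_measurable (N \<Otimes>\<^sub>M borel)"
    and "(\<lambda>z. surv_le (fst z) (snd z)) \<in> borel_measurable (N \<Otimes>\<^sub>M borel)"
    and "i \<in> {1..k} \<Longrightarrow> Measurable.pred N (\<lambda>\<omega>. dead t k \<omega> i)"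
proof -
  show lin_count: "(\<lambda>z. lin_count (fst z) (snd z)) \<in> borel_measurable (N \<Otimes>\<^sub>M borel)"
  proof -
    have "real (card {i \<in> {1..k}. s < t i}) = (\<Sum>i\<in>{1..k}. of_bool (s < t i))" for s
      by (simp add: of_bool_def sum.If_cases Int_def)
    then show ?thesis unfolding lin_count_def by (simp only:) measurable
  qed
  have d: "Measurable.pred N (\<lambda>\<omega>. dead t k \<omega> i)" if i: "i \<in> {1..k}" for i
  proof -
    have "Measurable.pred N (\<lambda>\<omega>. \<exists>j\<in>{i<..k}. attach t \<omega> j = t i)"
    proof (rule pred_intros_finite(4))
      fix j assume "j \<in> {i<..k}"
      then have [measurable]: "(\<lambda>\<omega>. attach t \<omega> j) \<in> borel_measurable N" using i by (intro assms) auto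
      show "Measurable.pred N (\<lambda>\<omega>. attach t \<omega> j = t i)" by measurable
    qed simp
    then show ?thesis by (simp add: dead_imp[abs_def])
  qed
  then show "i \<in> {1..k} \<Longrightarrow> Measurable.pred N (\<lambda>\<omega>. dead t k \<omega> i)" by blast
  have live_factor: "(\<lambda>z. live_factor (fst z) i) \<in> borel_measurable (N \<Otimes>\<^sub>M borel)" if "i \<in> {1..k}" for i
  proof -
    note [measurable] = d[OF that]
    have "(\<lambda>\<omega>. (\<lambda>z. lin_count (fst z) (snd z)) (\<omega>, t i)) \<in> borel_measurable N"
      by (rule measurable_compose[OF _ lin_count]) measurable
    then have [measurable]: "(\<lambda>\<omega>. lin_count \<omega> (t i)) \<in> borel_measurable N" by simp
    show ?thesis unfolding live_factor_def by measurable
  qed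
  have lin_integral: "(\<lambda>z. lin_integral (fst z) (snd z)) \<in> borel_measurable (N \<Otimes>\<^sub>M borel)"
    unfolding lin_integral_def by measurable
  note [measurable] = live_factor lin_integral
  show "(\<lambda>z. surv_lt (fst z) (snd z)) \<in> borel_measurable (N \<Otimes>\<^sub>M borel)" unfolding surv_lt_def by measurable
  show "(\<lambda>z. surv_le (fst z) (snd z)) \<in> borel_measurable (N \<Otimes>\<^sub>M borel)" unfolding surv_le_def by measurable
qed

lemma measurable_section:
  assumes "(\<lambda>z. f (fst z) (snd z)) \<in> borel_measurable (N \<Otimes>\<^sub>M borel)"
  shows "(\<lambda>\<omega>. f \<omega> a) \<in> borel_measurable N"
proof -
  have "(\<lambda>\<omega>. (\<lambda>z. f (fst z) (snd z)) (\<omega>, a)) \<in> borel_measurable N"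
    by (rule measurable_compose[OF _ assms]) measurable
  then show ?thesis by simp
qed

lemma measurable_surv_lt [measurable]: "(\<lambda>\<omega>. surv_lt \<omega> a) \<in> borel_measurable MM"
  by (rule measurable_section[OF measurable_surv(2)[OF measurable_attach_le]])

lemma measurable_surv_le [measurable]: "(\<lambda>\<omega>. surv_le \<omega> a) \<in> borel_measurable MM"
  by (rule measurable_section[OF measurable_surv(3)[OF measurable_attach_le]])

theorem separate_prob_eq:
  assumes Q: "test_ok Q" and k1: "1 \<le> k"
  shows "(\<integral>\<omega>. of_bool (apart Q \<omega> \<and> separate a (anc \<omega> a)) \<partial>MM) = (\<integral>\<omega>. of_bool (apart Q \<omega>) * surv_lt \<omega> a \<partial>MM)"
proof -
  note [measurable] = measurable_apart[OF Q]
  let ?l = "\<integral>\<omega>. of_bool (apart Q \<omega> \<and> separate a (anc \<omega> a)) \<partial>MM" and ?r = "\<integral>\<omega>. of_bool (apart Q \<omega>) * surv_lt \<omega> a \<partial>MM"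
  have intW: "integrable MM (\<lambda>\<omega>. of_bool (apart Q \<omega>) * surv_lt \<omega> a)"
  proof (rule MM.integrable_const_bound[of _ 1])
    show "AE \<omega> in MM. norm (of_bool (apart Q \<omega>) * surv_lt \<omega> a) \<le> 1"
      using AE_good AE_meets by eventually_elim (use surv_lt_unit[OF _ _ k1] in auto)
  qed measurable
  define P where "P = insert 0 (insert a (t ` {1..Suc k} \<union> (\<lambda>(i, j, c). c) ` Q))"
  have P: "finite P" "t ` {1..Suc k} \<subseteq> P" using Q by (auto simp: P_def test_ok_def)
  define K where "K = 4 * mu\<^sup>2 * (Max P - Min P) + rate * (2 * real k) + 1"
  have "Min P \<le> Max P" by (rule Min.coboundedI[THEN order_trans, OF P(1) _ Max_ge[OF P(1)], of 0]) (auto simp: P_def)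
  then have "0 \<le> 4 * mu\<^sup>2 * (Max P - Min P)" "0 \<le> rate * (2 * real k)" using rate_pos by auto
  then have K: "0 < K" unfolding K_def by linarith
  have "\<bar>?l - ?r\<bar> \<le> 0 + d" if d: "0 < d" for d
  proof -
    define e where "e = d / K"
    have e: "0 < e" "e * K = d" using d K by (auto simp: e_def)
    obtain ts where ts: "grid ts" "P \<subseteq> set ts" "t (Suc k) \<le> hd ts" "\<forall>d\<in>set (gaps ts). d \<le> e"
      "sq_gaps ts \<le> e * (Max P - Min P)" "\<And>p. p \<in> P \<Longrightarrow> p \<le> hd ts" using grid_for[OF P e(1)] by metis
    have mem: "0 \<in> set ts" "a \<in> set ts" "\<And>i j c. (i, j, c) \<in> Q \<Longrightarrow> c \<in> set ts" "t ` {1..Suc k} \<subseteq> set ts"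
      using ts(2) by (auto simp: P_def)
    have v0: "valid (\<lambda>_. 0)" using n2 by (simp add: valid_def)
    have intR: "integrable MM (\<lambda>\<omega>. path_weight (kill_weight (apart_test Q) a) (live_weight a) ts (anc \<omega>))"
      by (rule integral_path_weight(2)[OF invariant_test_kill_weight(1)[OF invariant_test_apart_test[OF Q]] unit_bdd_live_weight local_at_kill_weight[OF Q] local_at_live_weight ts(1) mem(1) ts(3) v0])
    have L: "?l = (\<integral>\<omega>. path_weight (sep_weight (apart_test Q) a) no_weight ts (anc \<omega>) \<partial>MM)"
    proof (rule integral_cong_AE)
      show "(\<lambda>\<omega>. path_weight (sep_weight (apart_test Q) a) no_weight ts (anc \<omega>)) \<in> borel_measurable MM"
        by (rule measurable_path_weight[OF local_at_sep_weight[OF Q]]) (simp add: local_at_def)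
      show "AE \<omega> in MM. of_bool (apart Q \<omega> \<and> separate a (anc \<omega> a)) = path_weight (sep_weight (apart_test Q) a) no_weight ts (anc \<omega>)"
        using AE_good
      proof eventually_elim
        case (elim \<omega>)
        have "goodE (fst \<omega>)" using elim by (simp add: good_def)
        from path_weight_L_eq[OF this Q mem(3,2)] show ?case by simp
      qed
    qed measurable
    have "AE \<omega> in MM. \<forall>s\<in>set ts. \<forall>m. event_time (fst \<omega>) m \<noteq> s"
      by (rule AE_MM_fst) (subst AE_finite_all, auto intro: AE_no_event)
    with AE_good AE_meets
    have ae: "AE \<omega> in MM. \<bar>path_weight (kill_weight (apart_test Q) a) (live_weight a) ts (anc \<omega>) - of_bool (apart Q \<omega>) * surv_lt \<omega> a\<bar> \<le> rate * (2 * real k * e)"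
    proof eventually_elim
      case (elim \<omega>)
      show ?case by (rule path_weight_R_approx[OF elim(1,2) k1 Q mem(3) ts(1) mem(4,2) ts(4)]) (use e elim(3) in auto)
    qed
    have "\<bar>(\<integral>\<omega>. path_weight (kill_weight (apart_test Q) a) (live_weight a) ts (anc \<omega>) \<partial>MM) - ?r\<bar>
        = \<bar>\<integral>\<omega>. path_weight (kill_weight (apart_test Q) a) (live_weight a) ts (anc \<omega>) - of_bool (apart Q \<omega>) * surv_lt \<omega> a \<partial>MM\<bar>"
      using intR intW by simp
    also have "\<dots> \<le> (\<integral>\<omega>. \<bar>path_weight (kill_weight (apart_test Q) a) (live_weight a) ts (anc \<omega>) - of_bool (apart Q \<omega>) * surv_lt \<omega> a\<bar> \<partial>MM)"
      by (rule integral_abs_bound)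
    also have "\<dots> \<le> rate * (2 * real k * e)"
      using intR intW by (intro MM.integral_le_const ae) auto
    finally have b: "\<bar>(\<integral>\<omega>. path_weight (kill_weight (apart_test Q) a) (live_weight a) ts (anc \<omega>) \<partial>MM) - ?r\<bar> \<le> rate * (2 * real k * e)" .
    have "4 * mu\<^sup>2 * sq_gaps ts \<le> 4 * mu\<^sup>2 * (e * (Max P - Min P))"
      using ts(5) by (intro mult_left_mono) auto
    then have "\<bar>?l - ?r\<bar> \<le> 4 * mu\<^sup>2 * (e * (Max P - Min P)) + rate * (2 * real k * e)"
      using b path_weight_compare[OF Q ts(1) mem(1) ts(3) mem(2)] unfolding L by linarith
    also have "\<dots> \<le> e * K" using e by (simp add: K_def algebra_simps)
    finally show ?thesis using e by simp
  qed
  then have "\<bar>?l - ?r\<bar> \<le> 0" by (rule field_le_epsilon)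
  then show ?thesis by simp
qed

end

section \<open>The conditional distribution function\<close>

lemma jump_cdf:
  fixes f h r :: "real \<Rightarrow> real"
  assumes "finite E" and h [measurable]: "h \<in> borel_measurable borel" and h0: "\<And>x. 0 \<le> h x" and f0: "\<And>x. 0 \<le> f x"
    and fh: "\<And>b. (\<integral>\<^sup>+x. ennreal (h x) * indicator {..b} x \<partial>lborel) = ennreal (f b)"
  shows "(\<And>e. e \<in> E \<Longrightarrow> 0 \<le> r e \<and> r e \<le> 1) \<Longrightarrow>
    (\<integral>\<^sup>+x. ennreal (h x * (\<Prod>e\<in>{e \<in> E. x < e}. r e)) * indicator {..b} x \<partial>lborel)
      + (\<Sum>e\<in>{e \<in> E. e \<le> b}. ennreal ((1 - r e) * (f e * (\<Prod>e'\<in>{e' \<in> E. e < e'}. r e'))))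
    = ennreal (f b * (\<Prod>e\<in>{e \<in> E. b < e}. r e))"
  using assms(1)
proof (induction E arbitrary: b rule: finite_linorder_min_induct)
  case empty
  then show ?case using fh by simp
next
  case (insert e0 E)
  let ?p = "\<lambda>E x. \<Prod>e\<in>{e \<in> E. x < e}. r e"
  let ?I = "\<lambda>b. \<integral>\<^sup>+x. ennreal (h x * ?p E x) * indicator {..b} x \<partial>lborel"
  let ?S = "\<lambda>b. \<Sum>e\<in>{e \<in> E. e \<le> b}. ennreal ((1 - r e) * (f e * ?p E e))"
  have r0: "0 \<le> r e0" "r e0 \<le> 1" using insert.prems by auto
  have rE: "\<And>e. e \<in> E \<Longrightarrow> 0 \<le> r e \<and> r e \<le> 1" using insert.prems by auto
  have IH: "?I b + ?S b = ennreal (f b * ?p E b)" for b by (rule insert.IH[OF rE])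
  have p0: "0 \<le> ?p E x" for x by (intro prod_nonneg) (use rE in auto)
  have pins: "?p (insert e0 E) x = (if x < e0 then r e0 else 1) * ?p E x" for x
  proof (cases "x < e0")
    case True
    then have "{e \<in> insert e0 E. x < e} = insert e0 {e \<in> E. x < e}" by auto
    moreover have "e0 \<notin> E" using insert.hyps by auto
    ultimately show ?thesis using True insert.hyps by simp
  next
    case False
    then have "{e \<in> insert e0 E. x < e} = {e \<in> E. x < e}" by auto
    then show ?thesis using False by simp
  qed
  have pm [measurable]: "(\<lambda>x. ?p E x) \<in> borel_measurable borel"
  proof -
    have "?p E x = (\<Prod>e\<in>E. if x < e then r e else 1)" for x
      using insert.hyps(1) by (simp add: prod.inter_filter)
    then show ?thesis by simp
  qed
  have S0: "?S b = 0" if "b \<le> e0" for b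
    using that insert.hyps by (intro sum.neutral) force
  show ?case
  proof (cases "b < e0")
    case True
    have "(\<integral>\<^sup>+x. ennreal (h x * ?p (insert e0 E) x) * indicator {..b} x \<partial>lborel)
      = (\<integral>\<^sup>+x. ennreal (r e0) * (ennreal (h x * ?p E x) * indicator {..b} x) \<partial>lborel)"
    proof (rule nn_integral_cong)
      fix x
      show "ennreal (h x * ?p (insert e0 E) x) * indicator {..b} x = ennreal (r e0) * (ennreal (h x * ?p E x) * indicator {..b} x)"
      proof (cases "x \<le> b")
        case T: True
        then have eqn: "h x * ?p (insert e0 E) x = r e0 * (h x * ?p E x)" unfolding pins using True by simp
        show ?thesis unfolding eqn using r0 T by (simp add: ennreal_mult')
      qed simp
    qed
    also have "\<dots> = ennreal (r e0) * ?I b" by (rule nn_integral_cmult) measurable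
    also have "?I b = ennreal (f b * ?p E b)" using IH[of b] S0[of b] True by simp
    finally have "(\<integral>\<^sup>+x. ennreal (h x * ?p (insert e0 E) x) * indicator {..b} x \<partial>lborel) = ennreal (r e0 * (f b * ?p E b))"
      using r0 by (simp add: ennreal_mult')
    moreover have "{e \<in> insert e0 E. e \<le> b} = {}" using True insert.hyps by force
    ultimately show ?thesis unfolding pins using True by (simp only: sum.empty) (simp add: algebra_simps)
  next
    case False
    let ?K = "\<integral>\<^sup>+x. ennreal (h x * ?p E x) * indicator {e0..b} x \<partial>lborel"
    let ?L = "\<integral>\<^sup>+x. ennreal (h x * ?p E x) * indicator {..<e0} x \<partial>lborel"
    define z where "z = f e0 * ?p E e0"
    have z0: "0 \<le> z" using f0 p0 by (simp add: z_def)
    have L: "?L = ?I e0"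
    proof (rule nn_integral_cong_AE)
      have "AE x in lborel. x \<noteq> e0" by (rule AE_lborel_singleton)
      then show "AE x in lborel. ennreal (h x * ?p E x) * indicator {..<e0} x = ennreal (h x * ?p E x) * indicator {..e0} x"
        by eventually_elim (auto simp: indicator_def)
    qed
    have Iz: "?I e0 = ennreal z" using IH[of e0] S0[of e0] by (simp add: z_def)
    have Ib: "?I b = ?L + ?K"
    proof -
      have "?I b = (\<integral>\<^sup>+x. ennreal (h x * ?p E x) * indicator {..<e0} x + ennreal (h x * ?p E x) * indicator {e0..b} x \<partial>lborel)"
        by (rule nn_integral_cong) (use False in \<open>auto simp: indicator_def\<close>)
      also have "\<dots> = ?L + ?K" by (rule nn_integral_add) measurable
      finally show ?thesis .
    qed
    have "(\<integral>\<^sup>+x. ennreal (h x * ?p (insert e0 E) x) * indicator {..b} x \<partial>lborel)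
      = (\<integral>\<^sup>+x. ennreal (r e0) * (ennreal (h x * ?p E x) * indicator {..<e0} x) + ennreal (h x * ?p E x) * indicator {e0..b} x \<partial>lborel)"
    proof (rule nn_integral_cong)
      fix x
      show "ennreal (h x * ?p (insert e0 E) x) * indicator {..b} x
         = ennreal (r e0) * (ennreal (h x * ?p E x) * indicator {..<e0} x) + ennreal (h x * ?p E x) * indicator {e0..b} x"
      proof (cases "x < e0")
        case T: True
        then have eqn: "h x * ?p (insert e0 E) x = r e0 * (h x * ?p E x)" unfolding pins by simp
        show ?thesis unfolding eqn using r0 T False by (simp add: ennreal_mult' indicator_def)
      next
        case F: False
        then show ?thesis unfolding pins by (simp add: indicator_def)
      qed
    qed
    also have "\<dots> = (\<integral>\<^sup>+x. ennreal (r e0) * (ennreal (h x * ?p E x) * indicator {..<e0} x) \<partial>lborel) + ?K"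
      by (rule nn_integral_add) measurable
    also have "(\<integral>\<^sup>+x. ennreal (r e0) * (ennreal (h x * ?p E x) * indicator {..<e0} x) \<partial>lborel) = ennreal (r e0) * ?L"
      by (rule nn_integral_cmult) measurable
    finally have i: "(\<integral>\<^sup>+x. ennreal (h x * ?p (insert e0 E) x) * indicator {..b} x \<partial>lborel) = ennreal (r e0 * z) + ?K"
      using r0 z0 by (simp add: L Iz ennreal_mult)
    have set: "{e \<in> insert e0 E. e \<le> b} = insert e0 {e \<in> E. e \<le> b}" using False by auto
    have s: "(\<Sum>e\<in>{e \<in> insert e0 E. e \<le> b}. ennreal ((1 - r e) * (f e * ?p (insert e0 E) e))) = ennreal ((1 - r e0) * z) + ?S b"
    proof -
      have "e0 \<notin> E" using insert.hyps by auto
      then have "(\<Sum>e\<in>{e \<in> insert e0 E. e \<le> b}. ennreal ((1 - r e) * (f e * ?p (insert e0 E) e)))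
         = ennreal ((1 - r e0) * z) + (\<Sum>e\<in>{e \<in> E. e \<le> b}. ennreal ((1 - r e) * (f e * ?p (insert e0 E) e)))"
        unfolding set using insert.hyps(1) unfolding pins by (subst sum.insert) (auto simp: z_def)
      also have "(\<Sum>e\<in>{e \<in> E. e \<le> b}. ennreal ((1 - r e) * (f e * ?p (insert e0 E) e))) = ?S b"
        unfolding pins using insert.hyps(2) by (intro sum.cong refl) auto
      finally show ?thesis .
    qed
    have rz: "ennreal (r e0 * z) + ennreal ((1 - r e0) * z) = ennreal z"
      using r0 z0 by (subst ennreal_plus[symmetric]) (auto simp: algebra_simps mult_left_le)
    have "ennreal (r e0 * z) + ?K + (ennreal ((1 - r e0) * z) + ?S b)
      = (ennreal (r e0 * z) + ennreal ((1 - r e0) * z)) + ?K + ?S b" by (simp only: ac_simps)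
    also have "\<dots> = ennreal z + ?K + ?S b" by (simp only: rz)
    also have "\<dots> = ?I b + ?S b" by (simp only: Ib L Iz)
    also have "\<dots> = ennreal (f b * ?p E b)" by (rule IH)
    finally have "ennreal (r e0 * z) + ?K + (ennreal ((1 - r e0) * z) + ?S b) = ennreal (f b * ?p E b)" .
    moreover have pb: "?p (insert e0 E) b = ?p E b" unfolding pins using False by simp
    ultimately show ?thesis unfolding i s pb by (simp only:)
  qed
qed

lemma max_diff_deriv:
  fixes x b :: real
  assumes "x \<noteq> b"
  shows "((\<lambda>y. max 0 (b - y)) has_real_derivative - of_bool (x < b)) (at x)"
proof (cases "x < b")
  case True
  have "((\<lambda>y. b - y) has_real_derivative -1) (at x)" by (auto intro!: derivative_eq_intros)
  then have "((\<lambda>y. max 0 (b - y)) has_real_derivative -1) (at x)"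
    by (rule has_field_derivative_transform_within_open[of _ _ _ "{..<b}"]) (use True in auto)
  then show ?thesis using True by simp
next
  case False
  have "((\<lambda>y. 0::real) has_real_derivative 0) (at x)" by simp
  then have "((\<lambda>y. max 0 (b - y)) has_real_derivative 0) (at x)"
    by (rule has_field_derivative_transform_within_open[of _ _ _ "{b<..}"]) (use False assms in auto)
  then show ?thesis using False by simp
qed

lemma set_integral_of_bool_less:
  fixes a b :: real
  shows "(LINT s:{a..}|lborel. of_bool (s < b)) = max 0 (b - a)" "set_integrable lborel {a..} (\<lambda>s. of_bool (s < b) :: real)"
proof -
  have eq: "(\<lambda>s. indicator {a..} s *\<^sub>R (of_bool (s < b) :: real)) = indicator {a..<b}" by (auto simp: indicator_def)
  show "(LINT s:{a..}|lborel. of_bool (s < b)) = max 0 (b - a)"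
    unfolding set_lebesgue_integral_def eq by (cases "a \<le> b") auto
  show "set_integrable lborel {a..} (\<lambda>s. of_bool (s < b) :: real)"
    unfolding set_integrable_def eq by (cases "a \<le> b") auto
qed

context smgp begin

lemma rate_choose: "mu / real (n choose 2) = rate"
proof -
  have "even (n * (n - 1))" by (cases "even n") auto
  then have e: "real (n choose 2) = real (n * (n - 1)) / 2" unfolding choose_two by (simp add: real_of_nat_div del: of_nat_mult)
  show ?thesis unfolding rate_def e by simp
qed

lemma live_eq: "live t k \<omega> = t ` {i \<in> {1..k}. \<not> dead t k \<omega> i}"
  by (auto simp: live_def)

lemma prod_live:
  "(\<Prod>e\<in>{e \<in> live t k \<omega>. P e}. (real n - lin_count \<omega> e - 1) / (real n - lin_count \<omega> e)) = (\<Prod>i\<in>{1..k}. if P (t i) then live_factor \<omega> i else 1)"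
proof -
  have "{e \<in> live t k \<omega>. P e} = t ` {i \<in> {1..k}. \<not> dead t k \<omega> i \<and> P (t i)}" by (auto simp: live_eq)
  then have "(\<Prod>e\<in>{e \<in> live t k \<omega>. P e}. (real n - lin_count \<omega> e - 1) / (real n - lin_count \<omega> e))
    = (\<Prod>i\<in>{i \<in> {1..k}. \<not> dead t k \<omega> i \<and> P (t i)}. (real n - lin_count \<omega> (t i) - 1) / (real n - lin_count \<omega> (t i)))"
    by (simp only:) (subst prod.reindex, auto intro: inj_on_subset[OF t_inj])
  also have "\<dots> = (\<Prod>i\<in>{1..k}. if \<not> dead t k \<omega> i \<and> P (t i) then (real n - lin_count \<omega> (t i) - 1) / (real n - lin_count \<omega> (t i)) else 1)"
    by (rule prod.inter_filter) simp
  also have "\<dots> = (\<Prod>i\<in>{1..k}. if P (t i) then live_factor \<omega> i else 1)"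
    by (rule prod.cong) (auto simp: live_factor_def)
  finally show ?thesis .
qed

lemma integral_lin_count: "(LINT s:{a..}|lborel. lin_count \<omega> s / real (n choose 2) * mu) = rate * lin_integral \<omega> a"
proof -
  have eq: "lin_count \<omega> s / real (n choose 2) * mu = rate * ((\<Sum>i\<in>{1..k}. of_bool (s < t i)) - (\<Sum>j\<in>{2..k}. of_bool (s < attach t \<omega> j)))" for s
    unfolding lin_count_def rate_choose[symmetric] by (simp add: of_bool_def sum.If_cases Int_def)
  have int: "set_integrable lborel {a..} (\<lambda>s. \<Sum>i\<in>A. of_bool (s < b i) :: real)" if "finite A" for A :: "nat set" and b
    using set_integral_of_bool_less(2) that unfolding set_integrable_def scaleR_sum_right by (intro Bochner_Integration.integrable_sum)
  have sum: "(LINT s:{a..}|lborel. \<Sum>i\<in>A. of_bool (s < b i)) = (\<Sum>i\<in>A. max 0 (b i - a))" if "finite A" for A :: "nat set" and b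
    using set_integral_of_bool_less[of a] unfolding set_integrable_def set_lebesgue_integral_def scaleR_sum_right
    by (subst Bochner_Integration.integral_sum) auto
  show ?thesis unfolding eq
    by (subst set_integral_mult_right, subst set_integral_diff(2)[OF int int], simp, simp, subst sum, simp, subst sum, simp)
       (simp add: lin_integral_def)
qed

lemma prob_eq_surv:
  assumes "good \<omega>" "meets \<omega>"
  shows "prob_lt n mu t k \<omega> a = surv_lt \<omega> a" "prob_le n mu t k \<omega> a = surv_le \<omega> a"
  unfolding prob_lt_def prob_le_def lineages_eq_lin_count[OF assms] integral_lin_count prod_live[of _ "\<lambda>e. a \<le> e"]
    prod_live[of _ "\<lambda>e. a < e"] surv_lt_def surv_le_def by auto

lemma nn_integral_lin_count_exp:
  assumes g: "good \<omega>" and m: "meets \<omega>" and k1: "1 \<le> k"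
  shows "(\<integral>\<^sup>+x. ennreal (rate * lin_count \<omega> x * exp (- (rate * lin_integral \<omega> x))) * indicator {..b} x \<partial>lborel) = ennreal (exp (- (rate * lin_integral \<omega> b)))"
proof -
  have gE: "goodE (fst \<omega>)" using g by (simp add: good_def)
  define f where "f x = exp (- (rate * lin_integral \<omega> x))" for x
  define h where "h x = rate * lin_count \<omega> x * f x" for x
  have lin0: "0 \<le> lin_count \<omega> x" for x by (simp add: lin_count_eq_card[OF gE m])
  have h0: "0 \<le> h x" for x using lin0 rate_pos by (simp add: h_def f_def)
  define S where "S = t ` {1..k} \<union> attach t \<omega> ` {2..k}"
  have dIL: "(lin_integral \<omega> has_real_derivative - lin_count \<omega> x) (at x)" if "x \<notin> S" for x
  proof -
    have "(lin_integral \<omega> has_real_derivative (\<Sum>i\<in>{1..k}. - of_bool (x < t i)) - (\<Sum>j\<in>{2..k}. - of_bool (x < attach t \<omega> j))) (at x)"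
      unfolding lin_integral_def by (intro DERIV_diff DERIV_sum max_diff_deriv) (use that in \<open>auto simp: S_def\<close>)
    moreover have "real (card {i \<in> {1..k}. x < t i}) = (\<Sum>i\<in>{1..k}. of_bool (x < t i))"
      by (simp add: of_bool_def sum.If_cases Int_def)
    ultimately show ?thesis by (simp add: lin_count_def sum_negf)
  qed
  have cIL: "continuous_on A (lin_integral \<omega>)" for A unfolding lin_integral_def by (intro continuous_intros)
  have int: "(\<integral>\<^sup>+x. ennreal (h x) * indicator {a..b} x \<partial>lborel) = ennreal (f b - f a)" if "a \<le> b" for a
  proof (rule nn_integral_has_integral_lebesgue')
    show "(h has_integral (f b - f a)) {a..b}"
    proof (rule fundamental_theorem_of_calculus_interior_strong[of S])
      show "(f has_vector_derivative h x) (at x)" if "x \<in> {a<..<b} - S" for x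
        unfolding has_real_derivative_iff_has_vector_derivative[symmetric] f_def[abs_def] h_def
        by (rule derivative_eq_intros dIL refl | use that in simp)+
      show "continuous_on {a..b} f" unfolding f_def[abs_def] by (intro continuous_intros cIL)
    qed (use that in \<open>auto simp: S_def\<close>)
  qed (rule h0)
  have hm: "h \<in> borel_measurable borel"
  proof -
    have "(\<lambda>x. lin_count \<omega> x) \<in> borel_measurable borel"
    proof -
      have "real (card {i \<in> {1..k}. s < t i}) = (\<Sum>i\<in>{1..k}. of_bool (s < t i))" for s
        by (simp add: of_bool_def sum.If_cases Int_def)
      then show ?thesis unfolding lin_count_def by (simp only:) measurable
    qed
    moreover have "f \<in> borel_measurable borel" unfolding f_def[abs_def]
      by (intro borel_measurable_continuous_onI continuous_intros cIL)
    ultimately show ?thesis unfolding h_def[abs_def] by measurable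
  qed
  let ?D = "density lborel (\<lambda>x. ennreal (h x))"
  have em: "emeasure ?D A = (\<integral>\<^sup>+x. ennreal (h x) * indicator A x \<partial>lborel)" if "A \<in> sets borel" for A
    using that hm by (subst emeasure_density) auto
  have "(\<lambda>N::nat. emeasure ?D {b - real N..b}) \<longlonglongrightarrow> emeasure ?D (\<Union>N::nat. {b - real N..b})"
    by (rule Lim_emeasure_incseq) (auto simp: incseq_def)
  moreover have "(\<Union>N::nat. {b - real N..b}) = {..b}"
  proof -
    have "\<exists>N::nat. b - real N \<le> x" for x using real_arch_simple[of "b - x"] by (auto simp: algebra_simps)
    then show ?thesis by auto
  qed
  moreover have "emeasure ?D {b - real N..b} = ennreal (f b - f (b - real N))" for N :: nat
    by (simp add: em int)
  moreover have "(\<lambda>N::nat. ennreal (f b - f (b - real N))) \<longlonglongrightarrow> ennreal (f b - 0)"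
  proof (intro tendsto_ennrealI tendsto_diff tendsto_const)
    have "(\<lambda>N. exp (- (rate * (t 1 - b))) * exp (- rate) ^ N) \<longlonglongrightarrow> exp (- (rate * (t 1 - b))) * 0"
      by (intro tendsto_mult tendsto_const LIMSEQ_realpow_zero) (use rate_pos in auto)
    moreover have "exp (- (rate * (t 1 - b))) * exp (- rate) ^ N = exp (- (rate * (t 1 - (b - real N))))" for N
      by (simp add: algebra_simps flip: exp_of_nat_mult exp_add)
    ultimately have lim: "(\<lambda>N. exp (- (rate * (t 1 - (b - real N))))) \<longlonglongrightarrow> 0" by (simp only: mult_zero_right)
    have "f x \<le> exp (- (rate * (t 1 - x)))" for x
      using lin_integral_ge[OF gE m k1, of x] rate_pos unfolding f_def by simp
    then show "(\<lambda>N. f (b - real N)) \<longlonglongrightarrow> 0"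
      by (intro tendsto_sandwich[OF _ _ tendsto_const lim]) (auto simp: f_def)
  qed
  ultimately have "emeasure ?D {..b} = ennreal (f b)" by (auto intro: LIMSEQ_unique)
  then have "(\<integral>\<^sup>+x. ennreal (h x) * indicator {..b} x \<partial>lborel) = ennreal (f b)" using em[of "{..b}"] by simp
  then show ?thesis unfolding h_def f_def .
qed

definition dens :: "omega \<Rightarrow> real \<Rightarrow> real" where "dens \<omega> x = rate * lin_count \<omega> x * surv_le \<omega> x"

definition mass :: "omega \<Rightarrow> nat \<Rightarrow> real" where
  "mass \<omega> i = (if dead t k \<omega> i then 0 else surv_le \<omega> (t i) / (real n - lin_count \<omega> (t i)))"

definition attach_law :: "omega \<Rightarrow> real set \<Rightarrow> ennreal" where
  "attach_law \<omega> S = (\<integral>\<^sup>+x. ennreal (dens \<omega> x) * indicator S x \<partial>lborel) + (\<Sum>i\<in>{1..k}. ennreal (mass \<omega> i) * indicator S (t i))"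

lemma live_lin_count_less:
  assumes g: "good \<omega>" and m: "meets \<omega>" and i: "i \<in> {1..k}" "\<not> dead t k \<omega> i"
  shows "lin_count \<omega> (t i) < real n"
proof -
  have gE: "goodE (fst \<omega>)" using g by (simp add: good_def)
  have v: "valid (anc \<omega> (t i))" by (rule anc_valid[OF g])
  have "anc \<omega> (t i) ` smp_ge (t i) \<noteq> anc \<omega> (t i) ` smp_gt (t i)" using i dead_iff[OF g m i(1)] by simp
  then have "anc \<omega> (t i) ` smp_gt (t i) \<subset> {..<n}" using v by (auto simp: smp_ge_eq_smp_gt_Un valid_def)
  then have "card (anc \<omega> (t i) ` smp_gt (t i)) < n" using psubset_card_mono[of "{..<n}"] by simp
  then show ?thesis by (simp add: lin_count_eq_card[OF gE m])
qed

lemma attach_law_atMost: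
  assumes g: "good \<omega>" and m: "meets \<omega>" and k1: "1 \<le> k"
  shows "attach_law \<omega> {..b} = ennreal (surv_le \<omega> b)"
proof -
  have gE: "goodE (fst \<omega>)" using g by (simp add: good_def)
  define f where "f x = exp (- (rate * lin_integral \<omega> x))" for x
  define h where "h x = rate * lin_count \<omega> x * f x" for x
  define r where "r e = (real n - lin_count \<omega> e - 1) / (real n - lin_count \<omega> e)" for e
  let ?E = "live t k \<omega>"
  have fin: "finite ?E" by (simp add: live_eq)
  have lin0: "0 \<le> lin_count \<omega> x" for x by (simp add: lin_count_eq_card[OF gE m])
  have W: "surv_le \<omega> x = f x * (\<Prod>e\<in>{e \<in> ?E. x < e}. r e)" for x
    unfolding surv_le_def f_def r_def prod_live[of _ "\<lambda>e. x < e"] ..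
  have cfr: "r (t i) = live_factor \<omega> i" if "\<not> dead t k \<omega> i" for i using that by (simp add: r_def live_factor_def)
  have r01: "0 \<le> r e \<and> r e \<le> 1" if "e \<in> ?E" for e
    using that live_factor_unit[OF g m] cfr by (auto simp: live_eq)
  have hm: "h \<in> borel_measurable borel"
  proof -
    have "real (card {i \<in> {1..k}. s < t i}) = (\<Sum>i\<in>{1..k}. of_bool (s < t i))" for s
      by (simp add: of_bool_def sum.If_cases Int_def)
    then have "(\<lambda>x. lin_count \<omega> x) \<in> borel_measurable borel" unfolding lin_count_def by (simp only:) measurable
    moreover have "f \<in> borel_measurable borel" unfolding f_def[abs_def] lin_integral_def by measurable
    ultimately show ?thesis unfolding h_def[abs_def] by measurable
  qed
  have "(\<integral>\<^sup>+x. ennreal (h x * (\<Prod>e\<in>{e \<in> ?E. x < e}. r e)) * indicator {..b} x \<partial>lborel)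
      + (\<Sum>e\<in>{e \<in> ?E. e \<le> b}. ennreal ((1 - r e) * (f e * (\<Prod>e'\<in>{e' \<in> ?E. e < e'}. r e'))))
    = ennreal (f b * (\<Prod>e\<in>{e \<in> ?E. b < e}. r e))"
  proof (rule jump_cdf[OF fin hm])
    show "(\<integral>\<^sup>+x. ennreal (h x) * indicator {..b} x \<partial>lborel) = ennreal (f b)" for b
      using nn_integral_lin_count_exp[OF g m k1, of b] by (simp add: h_def f_def)
  qed (use lin0 rate_pos r01 in \<open>auto simp: h_def f_def\<close>)
  also have "f b * (\<Prod>e\<in>{e \<in> ?E. b < e}. r e) = surv_le \<omega> b" by (rule W[symmetric])
  also have "(\<integral>\<^sup>+x. ennreal (h x * (\<Prod>e\<in>{e \<in> ?E. x < e}. r e)) * indicator {..b} x \<partial>lborel)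
     = (\<integral>\<^sup>+x. ennreal (dens \<omega> x) * indicator {..b} x \<partial>lborel)"
    by (simp add: dens_def W h_def mult.assoc)
  also have "(\<Sum>e\<in>{e \<in> ?E. e \<le> b}. ennreal ((1 - r e) * (f e * (\<Prod>e'\<in>{e' \<in> ?E. e < e'}. r e'))))
     = (\<Sum>i\<in>{1..k}. ennreal (mass \<omega> i) * indicator {..b} (t i))"
  proof -
    have "{e \<in> ?E. e \<le> b} = t ` {i \<in> {1..k}. \<not> dead t k \<omega> i \<and> t i \<le> b}" by (auto simp: live_eq)
    then have "(\<Sum>e\<in>{e \<in> ?E. e \<le> b}. ennreal ((1 - r e) * surv_le \<omega> e))
       = (\<Sum>i\<in>{i \<in> {1..k}. \<not> dead t k \<omega> i \<and> t i \<le> b}. ennreal ((1 - r (t i)) * surv_le \<omega> (t i)))"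
      by (simp only:) (subst sum.reindex, auto intro: inj_on_subset[OF t_inj])
    also have "\<dots> = (\<Sum>i\<in>{1..k}. if \<not> dead t k \<omega> i \<and> t i \<le> b then ennreal ((1 - r (t i)) * surv_le \<omega> (t i)) else 0)"
      by (rule sum.inter_filter) simp
    also have "\<dots> = (\<Sum>i\<in>{1..k}. ennreal (mass \<omega> i) * indicator {..b} (t i))"
    proof (rule sum.cong[OF refl])
      fix i assume i: "i \<in> {1..k}"
      show "(if \<not> dead t k \<omega> i \<and> t i \<le> b then ennreal ((1 - r (t i)) * surv_le \<omega> (t i)) else 0) = ennreal (mass \<omega> i) * indicator {..b} (t i)"
      proof (cases "dead t k \<omega> i")
        case False
        from live_lin_count_less[OF g m i False] have "1 - r (t i) = 1 / (real n - lin_count \<omega> (t i))"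
          by (simp add: r_def field_simps)
        then show ?thesis using False by (simp add: mass_def indicator_def)
      qed (simp add: mass_def)
    qed
    finally show ?thesis by (simp add: W)
  qed
  finally show ?thesis by (simp add: attach_law_def)
qed

abbreviation gen_alg :: "omega measure" where "gen_alg \<equiv> genealogy_algebra n mu t k"

lemma space_gen_alg [simp]: "space gen_alg = UNIV"
  by (simp add: genealogy_algebra_def)

lemma measurable_genealogy_MM: "genealogy t k \<in> measurable MM (PiM UNIV (\<lambda>_. borel))"
proof (rule measurable_PiM_single')
  show "(\<lambda>\<omega>. genealogy t k \<omega> ij) \<in> borel_measurable MM" for ij
    unfolding genealogy_def by (cases "fst ij \<in> {1..k} \<and> snd ij \<in> {1..k}") auto
qed (auto simp: PiE_def extensional_def)

lemma subalgebra_gen_alg: "subalgebra MM gen_alg"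
  unfolding subalgebra_def genealogy_algebra_def
  using measurable_sets[OF measurable_genealogy_MM]
  by (auto simp: sets_vimage_algebra2[of "genealogy t k"] space_PiM)

lemma measurable_meet_gen_alg:
  assumes "i \<in> {1..k}" "j \<in> {1..k}"
  shows "(\<lambda>\<omega>. meet_time t \<omega> i j) \<in> borel_measurable gen_alg"
proof -
  have "genealogy t k \<in> measurable gen_alg (PiM UNIV (\<lambda>_. borel))"
    unfolding genealogy_algebra_def by (rule measurable_vimage_algebra1) (auto simp: space_PiM)
  from measurable_compose[OF this measurable_component_singleton[of "(i, j)"]]
  have "(\<lambda>\<omega>. genealogy t k \<omega> (i, j)) \<in> borel_measurable gen_alg" by simp
  then show ?thesis using assms by (simp add: genealogy_def)
qed

lemma measurable_attach_gen_alg: "j \<in> {2..k} \<Longrightarrow> (\<lambda>\<omega>. attach t \<omega> j) \<in> borel_measurable gen_alg"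
  unfolding attach_def by (rule borel_measurable_Max) (auto intro!: measurable_meet_gen_alg)

text \<open>Up to null sets, these boxes are the events \<open>apart Q\<close>.\<close>

definition meet_box :: "(nat \<times> nat \<times> real) set \<Rightarrow> omega set" where
  "meet_box Q = {\<omega>. \<forall>(i, j, c)\<in>Q. meet_time t \<omega> i j \<le> c}"

definition meet_boxes :: "omega set set" where
  "meet_boxes = {meet_box Q |Q. finite Q \<and> Q \<subseteq> {1..k} \<times> {1..k} \<times> UNIV}"

lemma meet_boxes_Pow: "meet_boxes \<subseteq> Pow UNIV"
  by simp

lemma Int_stable_meet_boxes: "Int_stable meet_boxes"
proof (rule Int_stableI)
  fix A B assume "A \<in> meet_boxes" "B \<in> meet_boxes"
  then obtain Q R where "A = meet_box Q" "finite Q" "Q \<subseteq> {1..k} \<times> {1..k} \<times> UNIV"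
     "B = meet_box R" "finite R" "R \<subseteq> {1..k} \<times> {1..k} \<times> UNIV" unfolding meet_boxes_def by blast
  moreover have "meet_box Q \<inter> meet_box R = meet_box (Q \<union> R)" unfolding meet_box_def by (simp only: ball_Un Collect_conj_eq)
  ultimately have "A \<inter> B = meet_box (Q \<union> R)" "finite (Q \<union> R)" "Q \<union> R \<subseteq> {1..k} \<times> {1..k} \<times> UNIV"
    by auto
  then show "A \<inter> B \<in> meet_boxes" unfolding meet_boxes_def by blast
qed

lemma sets_gen_alg_boxes: "sets gen_alg \<subseteq> sigma_sets UNIV meet_boxes"
proof -
  let ?S = "sigma UNIV meet_boxes"
  have sp: "space ?S = UNIV" and st: "sets ?S = sigma_sets UNIV meet_boxes" by (auto simp: space_measure_of_conv)
  have "genealogy t k \<in> measurable ?S (PiM UNIV (\<lambda>_. borel))"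
  proof (rule measurable_PiM_single')
    fix ij :: "nat \<times> nat"
    show "(\<lambda>\<omega>. genealogy t k \<omega> ij) \<in> borel_measurable ?S"
    proof (cases "fst ij \<in> {1..k} \<and> snd ij \<in> {1..k}")
      case True
      have "(\<lambda>\<omega>. meet_time t \<omega> (fst ij) (snd ij)) \<in> borel_measurable ?S"
      proof (rule borel_measurableI_le)
        fix c :: real
        have "{\<omega> \<in> space ?S. meet_time t \<omega> (fst ij) (snd ij) \<le> c} = meet_box {(fst ij, snd ij, c)}"
          unfolding sp by (auto simp: meet_box_def)
        also have "\<dots> \<in> meet_boxes"
          unfolding meet_boxes_def using True by (intro CollectI exI[of _ "{(fst ij, snd ij, c)}"]) auto
        finally show "{\<omega> \<in> space ?S. meet_time t \<omega> (fst ij) (snd ij) \<le> c} \<in> sets ?S"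
          unfolding st by (rule sigma_sets.Basic)
      qed
      then show ?thesis using True by (simp add: genealogy_def)
    qed (auto simp: genealogy_def)
  qed (auto simp: PiE_def extensional_def)
  from measurable_sets[OF this]
  have "sets gen_alg \<subseteq> sets ?S" unfolding genealogy_algebra_def
    by (auto simp: sets_vimage_algebra2[of "genealogy t k"] space_PiM sp)
  then show ?thesis by (simp only: st)
qed

lemma meet_boxes_sets: "A \<in> meet_boxes \<Longrightarrow> A \<in> sets MM"
proof -
  assume "A \<in> meet_boxes"
  then obtain Q where Q: "A = meet_box Q" "finite Q" by (auto simp: meet_boxes_def)
  have "Measurable.pred MM (\<lambda>\<omega>. \<forall>q\<in>Q. meet_time t \<omega> (fst q) (fst (snd q)) \<le> snd (snd q))"
    by (rule pred_intros_finite(3)[OF Q(2)]) measurable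
  then have "{\<omega> \<in> space MM. \<forall>q\<in>Q. meet_time t \<omega> (fst q) (fst (snd q)) \<le> snd (snd q)} \<in> sets MM" by (simp only: pred_def)
  then show ?thesis by (simp add: Q(1) meet_box_def case_prod_beta)
qed

lemma gen_alg_eqI:
  fixes f h :: "omega \<Rightarrow> real"
  assumes [measurable]: "f \<in> borel_measurable MM" "h \<in> borel_measurable MM"
    and f: "AE \<omega> in MM. 0 \<le> f \<omega> \<and> f \<omega> \<le> 1" and h: "AE \<omega> in MM. 0 \<le> h \<omega> \<and> h \<omega> \<le> 1"
    and eq: "\<And>A. A \<in> meet_boxes \<Longrightarrow> (\<integral>\<omega>. indicator A \<omega> * f \<omega> \<partial>MM) = (\<integral>\<omega>. indicator A \<omega> * h \<omega> \<partial>MM)"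
    and D: "D \<in> sets gen_alg"
  shows "(\<integral>\<omega>. indicator D \<omega> * f \<omega> \<partial>MM) = (\<integral>\<omega>. indicator D \<omega> * h \<omega> \<partial>MM)"
proof -
  have int: "integrable MM (\<lambda>\<omega>. indicator A \<omega> * u \<omega>)"
    if "A \<in> sets MM" "u \<in> borel_measurable MM" "AE \<omega> in MM. 0 \<le> u \<omega> \<and> u \<omega> \<le> 1" for A and u :: "omega \<Rightarrow> real"
  proof (rule MM.integrable_const_bound[of _ 1])
    show "AE \<omega> in MM. norm (indicator A \<omega> * u \<omega>) \<le> 1"
      using that(3) by eventually_elim (auto simp: indicator_def)
  qed (use that in measurable)
  have "D \<in> sets MM \<and> (\<integral>\<omega>. indicator D \<omega> * f \<omega> \<partial>MM) = (\<integral>\<omega>. indicator D \<omega> * h \<omega> \<partial>MM)"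
    using Int_stable_meet_boxes meet_boxes_Pow subsetD[OF sets_gen_alg_boxes D]
  proof (induction rule: sigma_sets_induct_disjoint)
    case (basic A)
    then show ?case using eq meet_boxes_sets by blast
  next
    case (compl A)
    have UN: "UNIV \<in> meet_boxes" unfolding meet_boxes_def by (auto simp: meet_box_def intro!: exI[of _ "{}"])
    have c: "(\<integral>\<omega>. indicator (UNIV - A) \<omega> * u \<omega> \<partial>MM) = (\<integral>\<omega>. indicator UNIV \<omega> * u \<omega> \<partial>MM) - (\<integral>\<omega>. indicator A \<omega> * u \<omega> \<partial>MM)"
      if "u \<in> borel_measurable MM" "AE \<omega> in MM. 0 \<le> u \<omega> \<and> u \<omega> \<le> 1" for u :: "omega \<Rightarrow> real"
    proof -
      have "(\<integral>\<omega>. indicator (UNIV - A) \<omega> * u \<omega> \<partial>MM) = (\<integral>\<omega>. indicator UNIV \<omega> * u \<omega> - indicator A \<omega> * u \<omega> \<partial>MM)"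
        by (intro Bochner_Integration.integral_cong) (auto simp: indicator_def)
      also have "\<dots> = (\<integral>\<omega>. indicator UNIV \<omega> * u \<omega> \<partial>MM) - (\<integral>\<omega>. indicator A \<omega> * u \<omega> \<partial>MM)"
        by (rule Bochner_Integration.integral_diff[OF int[OF meet_boxes_sets[OF UN] that] int[OF _ that]]) (use compl in auto)
      finally show ?thesis .
    qed
    have "UNIV - A \<in> sets MM" using compl sets.compl_sets[of A MM] by simp
    then show ?case using c[OF assms(1) f] c[OF assms(2) h] compl eq[OF UN] by simp
  next
    case (union A)
    have [measurable]: "A i \<in> sets MM" for i using union by auto
    have u: "(\<lambda>i. \<integral>\<omega>. indicator (A i) \<omega> * u \<omega> \<partial>MM) sums (\<integral>\<omega>. indicator (\<Union>i. A i) \<omega> * u \<omega> \<partial>MM)"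
      if u [measurable]: "u \<in> borel_measurable MM" and ub: "AE \<omega> in MM. 0 \<le> u \<omega> \<and> u \<omega> \<le> 1" for u :: "omega \<Rightarrow> real"
    proof -
      have nn: "ennreal (\<integral>\<omega>. indicator B \<omega> * u \<omega> \<partial>MM) = emeasure (density MM (\<lambda>\<omega>. ennreal (u \<omega>))) B" if B [measurable]: "B \<in> sets MM" for B
      proof -
        have "ennreal (\<integral>\<omega>. indicator B \<omega> * u \<omega> \<partial>MM) = (\<integral>\<^sup>+\<omega>. ennreal (indicator B \<omega> * u \<omega>) \<partial>MM)"
          by (rule nn_integral_eq_integral[symmetric, OF int[OF B u ub]])
             (use ub in eventually_elim, auto simp: indicator_def)
        also have "\<dots> = (\<integral>\<^sup>+\<omega>. ennreal (u \<omega>) * indicator B \<omega> \<partial>MM)"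
          by (intro nn_integral_cong) (auto simp: indicator_def)
        finally show ?thesis by (simp add: emeasure_density)
      qed
      have pos: "0 \<le> (\<integral>\<omega>. indicator B \<omega> * u \<omega> \<partial>MM)" for B
        by (rule integral_nonneg_AE) (use ub in eventually_elim, auto simp: indicator_def)
      have "(\<lambda>i. emeasure (density MM (\<lambda>\<omega>. ennreal (u \<omega>))) (A i)) sums emeasure (density MM (\<lambda>\<omega>. ennreal (u \<omega>))) (\<Union>i. A i)"
        unfolding sums_iff using union(1) by (auto intro!: suminf_emeasure)
      then have "(\<lambda>i. ennreal (\<integral>\<omega>. indicator (A i) \<omega> * u \<omega> \<partial>MM)) sums ennreal (\<integral>\<omega>. indicator (\<Union>i. A i) \<omega> * u \<omega> \<partial>MM)"
        by (simp add: nn)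
      then show ?thesis by (subst (asm) sums_ennreal) (auto intro: pos)
    qed
    have "(\<Union>i. A i) \<in> sets MM" by measurable
    moreover have "(\<integral>\<omega>. indicator (A i) \<omega> * f \<omega> \<partial>MM) = (\<integral>\<omega>. indicator (A i) \<omega> * h \<omega> \<partial>MM)" for i using union by auto
    ultimately show ?case using u[OF assms(1) f] u[OF assms(2) h] by (simp add: sums_iff)
  qed (auto)
  then show ?thesis by simp
qed

lemma attach_lt_iff_separate:
  assumes g: "goodE (fst \<omega>)" and m: "meets \<omega>" and ne: "\<And>m. event_time (fst \<omega>) m \<noteq> a" and k1: "1 \<le> k"
  shows "attach t \<omega> (Suc k) < a \<longleftrightarrow> separate a (anc \<omega> a)"
proof -
  have "a \<le> attach t \<omega> (Suc k) \<longleftrightarrow> (\<exists>i\<in>{1..<Suc k}. a \<le> t i \<and> anc \<omega> a i = anc \<omega> a (Suc k))"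
    by (rule attach_ge_iff[OF g m _ ne]) (use k1 in auto)
  also have "\<dots> \<longleftrightarrow> \<not> separate a (anc \<omega> a)"
    unfolding separate_def by (force simp: smp_ge_def image_iff)
  finally show ?thesis by auto
qed

lemma gaps_match_lt:
  assumes k1: "1 \<le> k" and D: "D \<in> sets gen_alg"
  shows "(\<integral>\<omega>. indicator D \<omega> * of_bool (attach t \<omega> (Suc k) < a) \<partial>MM) = (\<integral>\<omega>. indicator D \<omega> * surv_lt \<omega> a \<partial>MM)"
proof (rule gen_alg_eqI[OF _ _ _ _ _ D])
  have [measurable]: "(\<lambda>\<omega>. attach t \<omega> (Suc k)) \<in> borel_measurable MM" using k1 by (intro measurable_attach) auto
  show fm: "(\<lambda>\<omega>. of_bool (attach t \<omega> (Suc k) < a) :: real) \<in> borel_measurable MM" by measurable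
  show "AE \<omega> in MM. 0 \<le> surv_lt \<omega> a \<and> surv_lt \<omega> a \<le> 1"
    using AE_good AE_meets by eventually_elim (use surv_lt_unit[OF _ _ k1] in auto)
  fix A assume A: "A \<in> meet_boxes"
  note [measurable] = meet_boxes_sets[OF A]
  from A obtain Q where Q: "A = meet_box Q" "finite Q" "Q \<subseteq> {1..k} \<times> {1..k} \<times> UNIV" by (auto simp: meet_boxes_def)
  define R where "R = {(i, j, c) \<in> Q. c < t i \<and> c < t j}"
  have "finite R" unfolding R_def by (rule finite_subset[OF _ Q(2)]) auto
  then have R: "test_ok R" using Q(3) by (auto simp: test_ok_def R_def)
  note [measurable] = measurable_apart[OF R]
  have AR: "\<omega> \<in> A \<longleftrightarrow> apart R \<omega>" if "good \<omega>" "meets \<omega>" for \<omega>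
  proof -
    have gE: "goodE (fst \<omega>)" using that by (simp add: good_def)
    have "meet_time t \<omega> i j \<le> c \<longleftrightarrow> (c < t i \<and> c < t j \<longrightarrow> anc \<omega> c i \<noteq> anc \<omega> c j)" if "(i, j, c) \<in> Q" for i j c
      using meet_gt_iff[OF gE \<open>meets \<omega>\<close>, of i j c] that Q(3) by (auto simp: not_less[symmetric])
    then show ?thesis unfolding Q(1) meet_box_def apart_def R_def by fast
  qed
  have ne: "AE \<omega> in MM. \<forall>m. event_time (fst \<omega>) m \<noteq> a" by (rule AE_MM_fst[OF AE_no_event])
  have "(\<integral>\<omega>. indicator A \<omega> * of_bool (attach t \<omega> (Suc k) < a) \<partial>MM) = (\<integral>\<omega>. (of_bool (apart R \<omega> \<and> separate a (anc \<omega> a)) :: real) \<partial>MM)"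
  proof (rule integral_cong_AE)
    show "AE \<omega> in MM. indicator A \<omega> * of_bool (attach t \<omega> (Suc k) < a) = (of_bool (apart R \<omega> \<and> separate a (anc \<omega> a)) :: real)"
      using AE_good AE_meets ne
    proof eventually_elim
      case (elim \<omega>)
      have "goodE (fst \<omega>)" using elim by (simp add: good_def)
      from attach_lt_iff_separate[OF this elim(2) _ k1] elim(3)
      have "attach t \<omega> (Suc k) < a \<longleftrightarrow> separate a (anc \<omega> a)" by blast
      then show ?case using AR[OF elim(1,2)] by (auto simp: indicator_def)
    qed
  qed measurable
  also have "\<dots> = (\<integral>\<omega>. of_bool (apart R \<omega>) * surv_lt \<omega> a \<partial>MM)" by (rule separate_prob_eq[OF R k1])
  also have "\<dots> = (\<integral>\<omega>. indicator A \<omega> * surv_lt \<omega> a \<partial>MM)"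
  proof (rule integral_cong_AE)
    show "AE \<omega> in MM. of_bool (apart R \<omega>) * surv_lt \<omega> a = indicator A \<omega> * surv_lt \<omega> a"
      using AE_good AE_meets by eventually_elim (use AR in \<open>auto simp: indicator_def\<close>)
  qed measurable
  finally show "(\<integral>\<omega>. indicator A \<omega> * of_bool (attach t \<omega> (Suc k) < a) \<partial>MM) = (\<integral>\<omega>. indicator A \<omega> * surv_lt \<omega> a \<partial>MM)" .
qed auto

lemma inverse_Suc_less: "0 < d \<Longrightarrow> \<forall>\<^sub>F m in sequentially. inverse (real (Suc m)) < d"
  using order_tendstoD(2)[OF LIMSEQ_inverse_real_of_nat] by auto

lemma surv_lt_tendsto: "(\<lambda>m. surv_lt \<omega> (a + inverse (real (Suc m)))) \<longlonglongrightarrow> surv_le \<omega> a"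
proof -
  have lim: "(\<lambda>m. a + inverse (real (Suc m))) \<longlonglongrightarrow> a + 0"
    by (intro tendsto_add tendsto_const LIMSEQ_inverse_real_of_nat)
  have "(\<lambda>m. exp (- (rate * lin_integral \<omega> (a + inverse (real (Suc m)))))) \<longlonglongrightarrow> exp (- (rate * lin_integral \<omega> (a + 0)))"
    unfolding lin_integral_def by (intro tendsto_intros lim)
  moreover have "(\<lambda>m. \<Prod>i\<in>{1..k}. if a + inverse (real (Suc m)) \<le> t i then live_factor \<omega> i else 1)
      \<longlonglongrightarrow> (\<Prod>i\<in>{1..k}. if a < t i then live_factor \<omega> i else 1)"
  proof (intro tendsto_prod tendsto_eventually)
    fix i
    show "\<forall>\<^sub>F m in sequentially. (if a + inverse (real (Suc m)) \<le> t i then live_factor \<omega> i else 1) = (if a < t i then live_factor \<omega> i else 1)"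
    proof (cases "a < t i")
      case True
      then have "\<forall>\<^sub>F m in sequentially. inverse (real (Suc m)) < t i - a" by (intro inverse_Suc_less) simp
      then show ?thesis by eventually_elim (use True in auto)
    next
      case False
      have "0 < inverse (real (Suc m))" for m by simp
      then have "\<not> a + inverse (real (Suc m)) \<le> t i" for m using False by (smt (verit))
      then show ?thesis using False by simp
    qed
  qed
  ultimately show ?thesis unfolding surv_lt_def surv_le_def by (intro tendsto_mult) simp_all
qed

lemma gaps_match_le:
  assumes k1: "1 \<le> k" and D: "D \<in> sets gen_alg"
  shows "(\<integral>\<omega>. indicator D \<omega> * of_bool (attach t \<omega> (Suc k) \<le> a) \<partial>MM) = (\<integral>\<omega>. indicator D \<omega> * surv_le \<omega> a \<partial>MM)"
proof -
  have [measurable]: "(\<lambda>\<omega>. attach t \<omega> (Suc k)) \<in> borel_measurable MM" using k1 by (intro measurable_attach) auto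
  have b1: "(\<lambda>\<omega>. of_bool (attach t \<omega> (Suc k) < c) :: real) \<in> borel_measurable MM" for c by measurable
  have b2: "(\<lambda>\<omega>. of_bool (attach t \<omega> (Suc k) \<le> a) :: real) \<in> borel_measurable MM" by measurable
  have D': "D \<in> sets MM" using subalgebra_gen_alg D by (auto simp: subalgebra_def)
  let ?a = "\<lambda>m. a + inverse (real (Suc m))"
  have l: "(\<lambda>m. \<integral>\<omega>. indicator D \<omega> * (of_bool (attach t \<omega> (Suc k) < ?a m) :: real) \<partial>MM) \<longlonglongrightarrow> (\<integral>\<omega>. indicator D \<omega> * of_bool (attach t \<omega> (Suc k) \<le> a) \<partial>MM)"
  proof (rule integral_dominated_convergence[where w = "\<lambda>_. 1"])
    show "AE \<omega> in MM. (\<lambda>m. indicator D \<omega> * of_bool (attach t \<omega> (Suc k) < ?a m)) \<longlonglongrightarrow> (indicator D \<omega> * of_bool (attach t \<omega> (Suc k) \<le> a) :: real)"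
    proof (intro AE_I2 tendsto_mult tendsto_const tendsto_eventually)
      fix \<omega> :: omega
      show "\<forall>\<^sub>F m in sequentially. of_bool (attach t \<omega> (Suc k) < ?a m) = (of_bool (attach t \<omega> (Suc k) \<le> a) :: real)"
      proof (cases "attach t \<omega> (Suc k) \<le> a")
        case True
        have "attach t \<omega> (Suc k) < ?a m" for m
          by (rule le_less_trans[OF True]) simp
        then show ?thesis using True by simp
      next
        case False
        then have "\<forall>\<^sub>F m in sequentially. inverse (real (Suc m)) < attach t \<omega> (Suc k) - a" by (intro inverse_Suc_less) simp
        then show ?thesis by eventually_elim (use False in auto)
      qed
    qed
    show "AE \<omega> in MM. norm (indicator D \<omega> * of_bool (attach t \<omega> (Suc k) < ?a m) :: real) \<le> 1" for m
      by (auto simp: indicator_def)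
  qed (intro borel_measurable_times borel_measurable_indicator D' b1 b2 | simp)+
  have r: "(\<lambda>m. \<integral>\<omega>. indicator D \<omega> * surv_lt \<omega> (?a m) \<partial>MM) \<longlonglongrightarrow> (\<integral>\<omega>. indicator D \<omega> * surv_le \<omega> a \<partial>MM)"
  proof (rule integral_dominated_convergence[where w = "\<lambda>_. 1"])
    show "AE \<omega> in MM. (\<lambda>m. indicator D \<omega> * surv_lt \<omega> (?a m)) \<longlonglongrightarrow> indicator D \<omega> * surv_le \<omega> a"
      by (intro AE_I2 tendsto_mult tendsto_const surv_lt_tendsto)
    show "AE \<omega> in MM. norm (indicator D \<omega> * surv_lt \<omega> (?a m)) \<le> 1" for m
      using AE_good AE_meets by eventually_elim (use surv_lt_unit[OF _ _ k1] in \<open>auto simp: indicator_def\<close>)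
  qed (intro borel_measurable_times borel_measurable_indicator D' measurable_surv_lt measurable_surv_le | simp)+
  from l[unfolded gaps_match_lt[OF k1 D]] r show ?thesis by (rule LIMSEQ_unique)
qed

section \<open>The conditional law\<close>

lemma measurable_dens_pair:
  assumes "\<And>j. j \<in> {2..k} \<Longrightarrow> (\<lambda>\<omega>. attach t \<omega> j) \<in> borel_measurable N"
  shows "(\<lambda>z. dens (fst z) (snd z)) \<in> borel_measurable (N \<Otimes>\<^sub>M borel)"
  unfolding dens_def using measurable_surv(1,3)[OF assms] by measurable

lemma measurable_dens: "dens \<omega> \<in> borel_measurable borel"
proof -
  have "(\<lambda>z. dens (fst z) (snd z)) \<in> borel_measurable (count_space UNIV \<Otimes>\<^sub>M borel)"
    by (rule measurable_dens_pair) simp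
  from measurable_compose[OF measurable_Pair1'[of \<omega> "count_space UNIV" borel] this] show ?thesis by simp
qed

lemma measurable_attach_law:
  assumes a: "\<And>j. j \<in> {2..k} \<Longrightarrow> (\<lambda>\<omega>. attach t \<omega> j) \<in> borel_measurable N" and S: "S \<in> sets borel"
  shows "(\<lambda>\<omega>. attach_law \<omega> S) \<in> borel_measurable N"
proof -
  have "(\<lambda>z. dens (fst z) (snd z)) \<in> borel_measurable (N \<Otimes>\<^sub>M lborel)"
    using measurable_dens_pair[OF a] by (simp cong: measurable_cong_sets sets_pair_measure_cong)
  then have "(\<lambda>(\<omega>, x). ennreal (dens \<omega> x) * indicator S x) \<in> borel_measurable (N \<Otimes>\<^sub>M lborel)"
    using S unfolding case_prod_beta by measurable
  then have 1: "(\<lambda>\<omega>. \<integral>\<^sup>+x. ennreal (dens \<omega> x) * indicator S x \<partial>lborel) \<in> borel_measurable N"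
    by (rule lborel.borel_measurable_nn_integral)
  have 2: "(\<lambda>\<omega>. mass \<omega> i) \<in> borel_measurable N" if "i \<in> {1..k}" for i
  proof -
    note [measurable] = measurable_surv(4)[OF a that] measurable_section[OF measurable_surv(1)[OF a], of "t i"]
      measurable_section[OF measurable_surv(3)[OF a], of "t i"]
    show ?thesis unfolding mass_def by measurable
  qed
  show ?thesis unfolding attach_law_def
    by (intro borel_measurable_add 1 borel_measurable_sum borel_measurable_times_ennreal measurable_compose[OF 2 measurable_ennreal] borel_measurable_const)
qed

lemma attach_law_UNIV:
  assumes g: "good \<omega>" and m: "meets \<omega>" and k1: "1 \<le> k"
  shows "attach_law \<omega> UNIV = 1"
proof -
  have gE: "goodE (fst \<omega>)" using g by (simp add: good_def)
  have tk: "t i \<le> t k" if "i \<in> {1..k}" for i using that t_less[of i k] by (cases "i = k") auto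
  have J0: "smp_gt x = {}" if "t k \<le> x" for x using tk that by (force simp: smp_gt_def)
  then have lin0: "lin_count \<omega> x = 0" if "t k \<le> x" for x using that by (simp add: lin_count_eq_card[OF gE m])
  have "attach_law \<omega> UNIV = attach_law \<omega> {..t k}"
    unfolding attach_law_def
  proof (rule arg_cong2[where f = "(+)"])
    show "(\<integral>\<^sup>+x. ennreal (dens \<omega> x) * indicator UNIV x \<partial>lborel) = (\<integral>\<^sup>+x. ennreal (dens \<omega> x) * indicator {..t k} x \<partial>lborel)"
      by (intro nn_integral_cong) (use lin0 in \<open>auto simp: indicator_def dens_def\<close>)
    show "(\<Sum>i\<in>{1..k}. ennreal (mass \<omega> i) * indicator UNIV (t i)) = (\<Sum>i\<in>{1..k}. ennreal (mass \<omega> i) * indicator {..t k} (t i))"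
      by (intro sum.cong refl) (use tk in \<open>auto simp: indicator_def\<close>)
  qed
  also have "\<dots> = ennreal (surv_le \<omega> (t k))" by (rule attach_law_atMost[OF assms])
  also have "surv_le \<omega> (t k) = 1"
  proof -
    have "(\<Sum>i\<in>{1..k}. max 0 (t i - t k)) = 0" by (intro sum.neutral) (use tk in auto)
    moreover have "(\<Sum>j\<in>{2..k}. max 0 (attach t \<omega> j - t k)) = 0"
    proof (intro sum.neutral ballI)
      fix j assume j: "j \<in> {2..k}"
      then have "attach t \<omega> j < t j" by (intro attach_less(2)[OF gE m]) auto
      moreover have "t j \<le> t k" using j by (intro tk) auto
      ultimately show "max 0 (attach t \<omega> j - t k) = 0" by simp
    qed
    moreover have "(\<Prod>i\<in>{1..k}. if t k < t i then live_factor \<omega> i else 1) = 1"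
      by (intro prod.neutral) (use tk in force)
    ultimately show ?thesis by (simp add: surv_le_def lin_integral_def)
  qed
  finally show ?thesis by simp
qed

lemma attach_law_Union:
  assumes "disjoint_family A" "\<And>m::nat. A m \<in> sets borel"
  shows "attach_law \<omega> (\<Union>m. A m) = (\<Sum>m. attach_law \<omega> (A m))"
proof -
  have "(\<Sum>m. attach_law \<omega> (A m)) = (\<Sum>m. \<integral>\<^sup>+x. ennreal (dens \<omega> x) * indicator (A m) x \<partial>lborel)
      + (\<Sum>m. \<Sum>i\<in>{1..k}. ennreal (mass \<omega> i) * indicator (A m) (t i))"
    unfolding attach_law_def by (rule suminf_add[symmetric]) (auto intro: summableI)
  also have "(\<Sum>m. \<integral>\<^sup>+x. ennreal (dens \<omega> x) * indicator (A m) x \<partial>lborel)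
     = (\<integral>\<^sup>+x. (\<Sum>m. ennreal (dens \<omega> x) * indicator (A m) x) \<partial>lborel)"
  proof (rule nn_integral_suminf[symmetric])
    have "dens \<omega> \<in> borel_measurable lborel" using measurable_dens[of \<omega>] by simp
    then show "(\<lambda>x. ennreal (dens \<omega> x) * indicator (A m) x) \<in> borel_measurable lborel" for m
      by (intro borel_measurable_times_ennreal borel_measurable_indicator measurable_compose[OF _ measurable_ennreal])
         (simp_all add: assms(2))
  qed
  also have "\<dots> = (\<integral>\<^sup>+x. ennreal (dens \<omega> x) * indicator (\<Union>m. A m) x \<partial>lborel)"
    by (simp add: ennreal_suminf_cmult suminf_indicator[OF assms(1)])
  also have "(\<Sum>m. \<Sum>i\<in>{1..k}. ennreal (mass \<omega> i) * indicator (A m) (t i))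
     = (\<Sum>i\<in>{1..k}. \<Sum>m. ennreal (mass \<omega> i) * indicator (A m) (t i))"
    by (rule suminf_sum) (auto intro: summableI)
  also have "\<dots> = (\<Sum>i\<in>{1..k}. ennreal (mass \<omega> i) * indicator (\<Union>m. A m) (t i))"
    by (simp add: ennreal_suminf_cmult suminf_indicator[OF assms(1)])
  finally show ?thesis by (simp add: attach_law_def)
qed

lemma attach_law_compl: "S \<in> sets borel \<Longrightarrow> attach_law \<omega> (UNIV - S) + attach_law \<omega> S = attach_law \<omega> UNIV"
proof -
  assume S: "S \<in> sets borel"
  note [measurable] = measurable_dens[of \<omega>] S
  have "attach_law \<omega> UNIV = (\<integral>\<^sup>+x. ennreal (dens \<omega> x) * indicator (UNIV - S) x + ennreal (dens \<omega> x) * indicator S x \<partial>lborel)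
     + (\<Sum>i\<in>{1..k}. ennreal (mass \<omega> i) * indicator (UNIV - S) (t i) + ennreal (mass \<omega> i) * indicator S (t i))"
    unfolding attach_law_def
    by (intro arg_cong2[where f = "(+)"] nn_integral_cong sum.cong refl) (auto simp: indicator_def)
  also have "\<dots> = attach_law \<omega> (UNIV - S) + attach_law \<omega> S"
    unfolding attach_law_def by (subst nn_integral_add) (auto simp: sum.distrib ac_simps)
  finally show ?thesis ..
qed

lemma gaps_match_attach_law:
  assumes k1: "1 \<le> k" and D: "D \<in> sets gen_alg" and S: "S \<in> sets borel"
  shows "(\<integral>\<^sup>+\<omega>. attach_law \<omega> S * indicator D \<omega> \<partial>MM) = (\<integral>\<^sup>+\<omega>. indicator S (attach t \<omega> (Suc k)) * indicator D \<omega> \<partial>MM)"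
proof -
  have am [measurable]: "(\<lambda>\<omega>. attach t \<omega> (Suc k)) \<in> borel_measurable MM" using k1 by (intro measurable_attach) auto
  have D' [measurable]: "D \<in> sets MM" using subalgebra_gen_alg D by (auto simp: subalgebra_def)
  have km: "(\<lambda>\<omega>. attach_law \<omega> S * indicator D \<omega>) \<in> borel_measurable MM" if "S \<in> sets borel" for S
    using measurable_attach_law[OF measurable_attach_le that] D' by measurable
  have im: "(\<lambda>\<omega>. indicator S (attach t \<omega> (Suc k)) * indicator D \<omega> :: ennreal) \<in> borel_measurable MM" if [measurable]: "S \<in> sets borel" for S
    by measurable
  let ?k = "\<lambda>S. \<integral>\<^sup>+\<omega>. attach_law \<omega> S * indicator D \<omega> \<partial>MM"
  let ?i = "\<lambda>S. \<integral>\<^sup>+\<omega>. indicator S (attach t \<omega> (Suc k)) * indicator D \<omega> \<partial>MM"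
  have bs: "sets borel = sigma_sets UNIV (range (\<lambda>a. {..a::real}))" by (subst borel_eq_atMost) simp
  have ist: "Int_stable (range (\<lambda>a. {..a::real}))"
  proof (rule Int_stableI)
    fix A B :: "real set" assume "A \<in> range (\<lambda>a. {..a})" "B \<in> range (\<lambda>a. {..a})"
    then obtain a b where "A = {..a}" "B = {..b}" by auto
    then have "A \<inter> B = {..min a b}" by auto
    then show "A \<inter> B \<in> range (\<lambda>a. {..a})" by blast
  qed
  have sub: "range (\<lambda>a. {..a::real}) \<subseteq> Pow UNIV" by simp
  show ?thesis using ist sub S[unfolded bs]
  proof (induction rule: sigma_sets_induct_disjoint)
    case (basic A)
    then obtain a where A: "A = {..a}" by auto
    have "?k A = (\<integral>\<^sup>+\<omega>. ennreal (indicator D \<omega> * surv_le \<omega> a) \<partial>MM)"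
    proof (rule nn_integral_cong_AE)
      show "AE \<omega> in MM. attach_law \<omega> A * indicator D \<omega> = ennreal (indicator D \<omega> * surv_le \<omega> a)"
        using AE_good AE_meets
        by eventually_elim (use attach_law_atMost[OF _ _ k1] in \<open>auto simp: A indicator_def\<close>)
    qed
    also have "\<dots> = ennreal (\<integral>\<omega>. indicator D \<omega> * surv_le \<omega> a \<partial>MM)"
    proof (rule nn_integral_eq_integral)
      show "AE \<omega> in MM. 0 \<le> indicator D \<omega> * surv_le \<omega> a"
        using AE_good AE_meets by eventually_elim (use surv_le_unit[OF _ _ k1] in auto)
      show "integrable MM (\<lambda>\<omega>. indicator D \<omega> * surv_le \<omega> a)"
      proof (rule MM.integrable_const_bound[of _ 1])
        show "AE \<omega> in MM. norm (indicator D \<omega> * surv_le \<omega> a) \<le> 1"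
          using AE_good AE_meets by eventually_elim (use surv_le_unit[OF _ _ k1] in \<open>auto simp: indicator_def\<close>)
      qed measurable
    qed
    also have "\<dots> = ennreal (\<integral>\<omega>. indicator D \<omega> * of_bool (attach t \<omega> (Suc k) \<le> a) \<partial>MM)"
      by (simp only: gaps_match_le[OF k1 D])
    also have "\<dots> = (\<integral>\<^sup>+\<omega>. ennreal (indicator D \<omega> * of_bool (attach t \<omega> (Suc k) \<le> a)) \<partial>MM)"
    proof (rule nn_integral_eq_integral[symmetric])
      have [measurable]: "(\<lambda>\<omega>. of_bool (attach t \<omega> (Suc k) \<le> a) :: real) \<in> borel_measurable MM" by measurable
      show "integrable MM (\<lambda>\<omega>. indicator D \<omega> * of_bool (attach t \<omega> (Suc k) \<le> a) :: real)"
        by (rule MM.integrable_const_bound[of _ 1]) (auto simp: indicator_def)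
    qed simp
    also have "\<dots> = ?i A" by (intro nn_integral_cong) (auto simp: A indicator_def)
    finally show ?case .
  next
    case empty
    show ?case by (simp add: attach_law_def)
  next
    case (compl A)
    then have A: "A \<in> sets borel" by (simp add: bs)
    have cA: "UNIV - A \<in> sets borel" using A by auto
    have "?k (UNIV - A) + ?k A = (\<integral>\<^sup>+\<omega>. (attach_law \<omega> (UNIV - A) + attach_law \<omega> A) * indicator D \<omega> \<partial>MM)"
      unfolding distrib_right by (rule nn_integral_add[symmetric]) (use km A cA in auto)
    also have "\<dots> = (\<integral>\<^sup>+\<omega>. indicator D \<omega> \<partial>MM)"
    proof (rule nn_integral_cong_AE)
      show "AE \<omega> in MM. (attach_law \<omega> (UNIV - A) + attach_law \<omega> A) * indicator D \<omega> = indicator D \<omega>"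
        using AE_good AE_meets by eventually_elim (simp add: attach_law_compl[OF A] attach_law_UNIV[OF _ _ k1])
    qed
    also have "\<dots> = (\<integral>\<^sup>+\<omega>. indicator (UNIV - A) (attach t \<omega> (Suc k)) * indicator D \<omega> + indicator A (attach t \<omega> (Suc k)) * indicator D \<omega> \<partial>MM)"
      by (intro nn_integral_cong) (auto simp: indicator_def)
    also have "\<dots> = ?i (UNIV - A) + ?i A"
      by (rule nn_integral_add) (use im A cA in auto)
    finally have eq: "?k (UNIV - A) + ?k A = ?i (UNIV - A) + ?i A" .
    have "?i A \<le> (\<integral>\<^sup>+\<omega>. 1 \<partial>MM)" by (intro nn_integral_mono) (auto simp: indicator_def)
    also have "\<dots> = 1" using MM.emeasure_space_1 by simp
    finally have "?i A \<noteq> \<top>" using ennreal_one_less_top by (metis neq_top_trans ennreal_one_neq_top)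
    then show ?case using eq compl by (simp add: ennreal_add_left_cancel add.commute)
  next
    case (union A)
    then have A: "A m \<in> sets borel" for m by (simp add: bs subset_eq)
    have "?k (\<Union>m. A m) = (\<integral>\<^sup>+\<omega>. (\<Sum>m. attach_law \<omega> (A m) * indicator D \<omega>) \<partial>MM)"
      using attach_law_Union[OF union(1) A] by simp
    also have "\<dots> = (\<Sum>m. ?k (A m))" by (rule nn_integral_suminf[OF km[OF A]])
    also have "\<dots> = (\<Sum>m. ?i (A m))" using union by simp
    also have "\<dots> = (\<integral>\<^sup>+\<omega>. (\<Sum>m. indicator (A m) (attach t \<omega> (Suc k)) * indicator D \<omega>) \<partial>MM)"
      by (rule nn_integral_suminf[OF im[OF A], symmetric])
    also have "\<dots> = ?i (\<Union>m. A m)" using suminf_indicator[OF union(1)] by simp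
    finally show ?case .
  qed
qed

lemma attach_law_formula:
  assumes g: "good \<omega>" and m: "meets \<omega>" and k1: "1 \<le> k" and S: "S \<in> sets borel"
  shows "enn2real (attach_law \<omega> S)
    = (LINT x:S|lborel. prob_le n mu t k \<omega> x * mu * lineages t k \<omega> x / real (n choose 2))
      + (\<Sum>x\<in>live t k \<omega> \<inter> S. prob_le n mu t k \<omega> x / (real n - lineages t k \<omega> x))"
proof -
  have gE: "goodE (fst \<omega>)" using g by (simp add: good_def)
  note [measurable] = measurable_dens[of \<omega>] S
  have d: "prob_le n mu t k \<omega> x * mu * lineages t k \<omega> x / real (n choose 2) = dens \<omega> x" for x
    unfolding prob_eq_surv[OF g m] lineages_eq_lin_count[OF g m] dens_def rate_choose[symmetric] by simp
  have d0: "0 \<le> dens \<omega> x" for x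
    using surv_le_unit[OF g m k1, of x] rate_pos by (simp add: dens_def lin_count_eq_card[OF gE m])
  have m0: "0 \<le> mass \<omega> i" if "i \<in> {1..k}" for i
    using surv_le_unit[OF g m k1, of "t i"] live_lin_count_less[OF g m that] by (auto simp: mass_def)
  have le: "(\<integral>\<^sup>+x. ennreal (dens \<omega> x) * indicator S x \<partial>lborel) \<le> attach_law \<omega> UNIV"
    unfolding attach_law_def by (rule add_increasing2) (auto intro!: nn_integral_mono simp: indicator_def)
  then have fin: "(\<integral>\<^sup>+x. ennreal (dens \<omega> x) * indicator S x \<partial>lborel) < \<top>"
    unfolding attach_law_UNIV[OF g m k1] by (rule order.strict_trans1) simp
  have "(LINT x:S|lborel. dens \<omega> x) = enn2real (\<integral>\<^sup>+x. ennreal (indicator S x *\<^sub>R dens \<omega> x) \<partial>lborel)"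
    unfolding set_lebesgue_integral_def by (rule integral_eq_nn_integral) (use d0 in auto)
  also have "(\<integral>\<^sup>+x. ennreal (indicator S x *\<^sub>R dens \<omega> x) \<partial>lborel) = (\<integral>\<^sup>+x. ennreal (dens \<omega> x) * indicator S x \<partial>lborel)"
    by (intro nn_integral_cong) (auto simp: indicator_def)
  finally have 1: "(LINT x:S|lborel. dens \<omega> x) = enn2real (\<integral>\<^sup>+x. ennreal (dens \<omega> x) * indicator S x \<partial>lborel)" .
  have "live t k \<omega> \<inter> S = t ` {i \<in> {1..k}. \<not> dead t k \<omega> i \<and> t i \<in> S}" by (auto simp: live_eq)
  then have "(\<Sum>x\<in>live t k \<omega> \<inter> S. surv_le \<omega> x / (real n - lin_count \<omega> x))
     = (\<Sum>i\<in>{i \<in> {1..k}. \<not> dead t k \<omega> i \<and> t i \<in> S}. surv_le \<omega> (t i) / (real n - lin_count \<omega> (t i)))"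
    by (simp only:) (subst sum.reindex, auto intro: inj_on_subset[OF t_inj])
  also have "\<dots> = (\<Sum>i\<in>{1..k}. if \<not> dead t k \<omega> i \<and> t i \<in> S then surv_le \<omega> (t i) / (real n - lin_count \<omega> (t i)) else 0)"
    by (rule sum.inter_filter) simp
  also have "\<dots> = (\<Sum>i\<in>{1..k}. mass \<omega> i * indicator S (t i))"
    by (rule sum.cong) (auto simp: mass_def indicator_def)
  finally have 2: "(\<Sum>x\<in>live t k \<omega> \<inter> S. surv_le \<omega> x / (real n - lin_count \<omega> x)) = (\<Sum>i\<in>{1..k}. mass \<omega> i * indicator S (t i))" .
  have "(\<Sum>i\<in>{1..k}. ennreal (mass \<omega> i) * indicator S (t i)) = (\<Sum>i\<in>{1..k}. ennreal (mass \<omega> i * indicator S (t i)))"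
    by (intro sum.cong refl) (auto simp: indicator_def)
  also have "\<dots> = ennreal (\<Sum>i\<in>{1..k}. mass \<omega> i * indicator S (t i))"
    by (rule sum_ennreal) (use m0 in auto)
  finally have 3: "(\<Sum>i\<in>{1..k}. ennreal (mass \<omega> i) * indicator S (t i)) = ennreal (\<Sum>i\<in>{1..k}. mass \<omega> i * indicator S (t i))" .
  have "0 \<le> (\<Sum>i\<in>{1..k}. mass \<omega> i * indicator S (t i))" by (intro sum_nonneg mult_nonneg_nonneg m0) auto
  then have "enn2real (attach_law \<omega> S) = (LINT x:S|lborel. dens \<omega> x) + (\<Sum>i\<in>{1..k}. mass \<omega> i * indicator S (t i))"
    unfolding attach_law_def 3 1 by (subst enn2real_plus[OF fin]) auto
  moreover have "(LINT x:S|lborel. prob_le n mu t k \<omega> x * mu * lineages t k \<omega> x / real (n choose 2)) = (LINT x:S|lborel. dens \<omega> x)"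
    by (simp only: d)
  moreover have "(\<Sum>x\<in>live t k \<omega> \<inter> S. prob_le n mu t k \<omega> x / (real n - lineages t k \<omega> x)) = (\<Sum>i\<in>{1..k}. mass \<omega> i * indicator S (t i))"
    unfolding prob_eq_surv[OF g m] lineages_eq_lin_count[OF g m] by (rule 2)
  ultimately show ?thesis by (simp only:)
qed

sublocale gen_alg: finite_measure_subalgebra MM gen_alg
  by unfold_locales (rule subalgebra_gen_alg)

lemma gaps_match_exp_lt:
  assumes k1: "1 \<le> k"
  shows "AE \<omega> in MM. real_cond_exp MM gen_alg (indicator {\<omega> \<in> space MM. attach t \<omega> (Suc k) < a}) \<omega> = prob_lt n mu t k \<omega> a"
proof -
  have am [measurable]: "(\<lambda>\<omega>. attach t \<omega> (Suc k)) \<in> borel_measurable MM" using k1 by (intro measurable_attach) auto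
  have ev: "{\<omega> \<in> space MM. attach t \<omega> (Suc k) < a} \<in> sets MM" by measurable
  have "AE \<omega> in MM. real_cond_exp MM gen_alg (indicator {\<omega> \<in> space MM. attach t \<omega> (Suc k) < a}) \<omega> = surv_lt \<omega> a"
  proof (rule gen_alg.real_cond_exp_charact)
    show "(\<integral>\<omega>\<in>D. indicator {\<omega> \<in> space MM. attach t \<omega> (Suc k) < a} \<omega> \<partial>MM) = (\<integral>\<omega>\<in>D. surv_lt \<omega> a \<partial>MM)"
      if D: "D \<in> sets gen_alg" for D
      using gaps_match_lt[OF k1 D, of a] by (simp add: set_lebesgue_integral_def indicator_def of_bool_def)
    show "integrable MM (indicator {\<omega> \<in> space MM. attach t \<omega> (Suc k) < a} :: _ \<Rightarrow> real)"
      by (rule MM.integrable_const_bound[of _ 1]) (use ev in auto)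
    show "integrable MM (\<lambda>\<omega>. surv_lt \<omega> a)"
    proof (rule MM.integrable_const_bound[of _ 1])
      show "AE \<omega> in MM. norm (surv_lt \<omega> a) \<le> 1"
        using AE_good AE_meets by eventually_elim (use surv_lt_unit[OF _ _ k1] in auto)
    qed measurable
    show "(\<lambda>\<omega>. surv_lt \<omega> a) \<in> borel_measurable gen_alg"
      by (rule measurable_section[OF measurable_surv(2)[OF measurable_attach_gen_alg]])
  qed
  with AE_good AE_meets show ?thesis by eventually_elim (simp add: prob_eq_surv)
qed

lemma gaps_match_exp_attach_law:
  assumes k1: "1 \<le> k" and S [measurable]: "S \<in> sets borel"
  shows "AE \<omega> in MM. real_cond_exp MM gen_alg (indicator {\<omega> \<in> space MM. attach t \<omega> (Suc k) \<in> S}) \<omega> = enn2real (attach_law \<omega> S)"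
proof (rule gen_alg.real_cond_exp_charact)
  have am [measurable]: "(\<lambda>\<omega>. attach t \<omega> (Suc k)) \<in> borel_measurable MM" using k1 by (intro measurable_attach) auto
  have ev: "{\<omega> \<in> space MM. attach t \<omega> (Suc k) \<in> S} \<in> sets MM" by measurable
  have km [measurable]: "(\<lambda>\<omega>. attach_law \<omega> S) \<in> borel_measurable MM" by (rule measurable_attach_law[OF measurable_attach_le S])
  have k1': "AE \<omega> in MM. attach_law \<omega> S \<le> 1"
    using AE_good AE_meets
  proof eventually_elim
    case (elim \<omega>)
    have "attach_law \<omega> S \<le> attach_law \<omega> (UNIV - S) + attach_law \<omega> S" by (simp add: add_increasing)
    then show ?case by (simp add: attach_law_compl[OF S] attach_law_UNIV[OF elim k1])
  qed
  then have kfin: "AE \<omega> in MM. attach_law \<omega> S < \<top>" by eventually_elim (metis ennreal_one_less_top order.strict_trans1)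
  show "integrable MM (indicator {\<omega> \<in> space MM. attach t \<omega> (Suc k) \<in> S} :: _ \<Rightarrow> real)"
    by (rule MM.integrable_const_bound[of _ 1]) (use ev in auto)
  show "integrable MM (\<lambda>\<omega>. enn2real (attach_law \<omega> S))"
  proof (rule MM.integrable_const_bound[of _ 1])
    show "AE \<omega> in MM. norm (enn2real (attach_law \<omega> S)) \<le> 1"
      using k1' by eventually_elim (auto dest: enn2real_mono)
  qed measurable
  show "(\<lambda>\<omega>. enn2real (attach_law \<omega> S)) \<in> borel_measurable gen_alg"
    using measurable_attach_law[OF measurable_attach_gen_alg S] by measurable
  fix D assume D: "D \<in> sets gen_alg"
  have D' [measurable]: "D \<in> sets MM" using subalgebra_gen_alg D by (auto simp: subalgebra_def)
  have "(\<integral>\<omega>\<in>D. indicator {\<omega> \<in> space MM. attach t \<omega> (Suc k) \<in> S} \<omega> \<partial>MM)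
      = enn2real (\<integral>\<^sup>+\<omega>. ennreal (indicator D \<omega> *\<^sub>R indicator {\<omega> \<in> space MM. attach t \<omega> (Suc k) \<in> S} \<omega>) \<partial>MM)"
    unfolding set_lebesgue_integral_def
    by (rule integral_eq_nn_integral) (use ev in \<open>auto simp: indicator_def\<close>)
  also have "(\<integral>\<^sup>+\<omega>. ennreal (indicator D \<omega> *\<^sub>R indicator {\<omega> \<in> space MM. attach t \<omega> (Suc k) \<in> S} \<omega>) \<partial>MM)
     = (\<integral>\<^sup>+\<omega>. indicator S (attach t \<omega> (Suc k)) * indicator D \<omega> \<partial>MM)"
    by (intro nn_integral_cong) (auto simp: indicator_def)
  also have "\<dots> = (\<integral>\<^sup>+\<omega>. attach_law \<omega> S * indicator D \<omega> \<partial>MM)" by (rule gaps_match_attach_law[OF k1 D S, symmetric])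
  also have "\<dots> = (\<integral>\<^sup>+\<omega>. ennreal (indicator D \<omega> *\<^sub>R enn2real (attach_law \<omega> S)) \<partial>MM)"
    by (rule nn_integral_cong_AE) (use kfin in eventually_elim, auto simp: indicator_def)
  also have "enn2real \<dots> = (\<integral>\<omega>\<in>D. enn2real (attach_law \<omega> S) \<partial>MM)"
    unfolding set_lebesgue_integral_def by (rule integral_eq_nn_integral[symmetric]) auto
  finally show "(\<integral>\<omega>\<in>D. indicator {\<omega> \<in> space MM. attach t \<omega> (Suc k) \<in> S} \<omega> \<partial>MM) = (\<integral>\<omega>\<in>D. enn2real (attach_law \<omega> S) \<partial>MM)" .
qed

lemma gaps_match_exp_set:
  assumes k1: "1 \<le> k" and S: "S \<in> sets borel"
  shows "AE \<omega> in MM. real_cond_exp MM gen_alg (indicator {\<omega> \<in> space MM. attach t \<omega> (Suc k) \<in> S}) \<omega>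
    = (LINT x:S|lborel. prob_le n mu t k \<omega> x * mu * lineages t k \<omega> x / real (n choose 2))
      + (\<Sum>x\<in>live t k \<omega> \<inter> S. prob_le n mu t k \<omega> x / (real n - lineages t k \<omega> x))"
  using AE_good AE_meets gaps_match_exp_attach_law[OF k1 S] by eventually_elim (simp add: attach_law_formula[OF _ _ k1 S])

lemma gaps_match_exp_le:
  assumes k1: "1 \<le> k"
  shows "AE \<omega> in MM. real_cond_exp MM gen_alg (indicator {\<omega> \<in> space MM. attach t \<omega> (Suc k) \<le> a}) \<omega> = prob_le n mu t k \<omega> a"
proof -
  have "AE \<omega> in MM. real_cond_exp MM gen_alg (indicator {\<omega> \<in> space MM. attach t \<omega> (Suc k) \<in> {..a}}) \<omega> = enn2real (attach_law \<omega> {..a})"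
    by (rule gaps_match_exp_attach_law[OF k1]) simp
  with AE_good AE_meets show ?thesis
  proof eventually_elim
    case (elim \<omega>)
    then show ?case using attach_law_atMost[OF elim(1,2) k1, of a] surv_le_unit[OF elim(1,2) k1, of a] prob_eq_surv(2)[OF elim(1,2), of a]
      by simp
  qed
qed

lemma gaps_match_exp_eq:
  assumes k1: "1 \<le> k"
  shows "AE \<omega> in MM. real_cond_exp MM gen_alg (indicator {\<omega> \<in> space MM. attach t \<omega> (Suc k) = a}) \<omega>
    = (if a \<in> live t k \<omega> then prob_le n mu t k \<omega> a / (real n - lineages t k \<omega> a) else 0)"
proof -
  have "AE \<omega> in MM. real_cond_exp MM gen_alg (indicator {\<omega> \<in> space MM. attach t \<omega> (Suc k) \<in> {a}}) \<omega>
    = (LINT x:{a}|lborel. prob_le n mu t k \<omega> x * mu * lineages t k \<omega> x / real (n choose 2))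
      + (\<Sum>x\<in>live t k \<omega> \<inter> {a}. prob_le n mu t k \<omega> x / (real n - lineages t k \<omega> x))"
    by (rule gaps_match_exp_set[OF k1]) simp
  then show ?thesis
  proof eventually_elim
    case (elim \<omega>)
    have "(LINT x:{a}|lborel. prob_le n mu t k \<omega> x * mu * lineages t k \<omega> x / real (n choose 2)) = 0"
      unfolding set_lebesgue_integral_def
    proof (rule integral_eq_zero_AE)
      have "AE x in lborel. x \<noteq> a" by (rule AE_lborel_singleton)
      then show "AE x in lborel. indicator {a} x *\<^sub>R (prob_le n mu t k \<omega> x * mu * lineages t k \<omega> x / real (n choose 2)) = 0"
        by eventually_elim simp
    qed
    then show ?case using elim by simp
  qed
qed

end

theorem theorem3:
  fixes n :: nat and mu :: real and t :: "nat \<Rightarrow> real" and k :: nat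
  assumes n2: "n \<ge> 2" and mu_pos: "mu > 0"
    and t_incr: "\<And>i. 1 \<le> i \<Longrightarrow> t i < t (Suc i)"
    and k1: "k \<ge> 1"
  defines "M \<equiv> smgp_space n mu"
    and "F \<equiv> genealogy_algebra n mu t k"
  shows
    "(\<forall>a::real. AE \<omega> in M.
        real_cond_exp M F (indicator {\<omega> \<in> space M. attach t \<omega> (Suc k) < a}) \<omega>
          = prob_lt n mu t k \<omega> a)
     \<and> (\<forall>a::real. AE \<omega> in M.
        real_cond_exp M F (indicator {\<omega> \<in> space M. attach t \<omega> (Suc k) \<le> a}) \<omega>
          = prob_le n mu t k \<omega> a)
     \<and> (\<forall>a::real. AE \<omega> in M.
        real_cond_exp M F (indicator {\<omega> \<in> space M. attach t \<omega> (Suc k) = a}) \<omega>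
          = (if a \<in> live t k \<omega>
             then prob_le n mu t k \<omega> a / (real n - lineages t k \<omega> a) else 0))
     \<and> (\<forall>S \<in> sets borel. AE \<omega> in M.
        real_cond_exp M F (indicator {\<omega> \<in> space M. attach t \<omega> (Suc k) \<in> S}) \<omega>
          = (LINT x:S|lborel. prob_le n mu t k \<omega> x * mu * lineages t k \<omega> x / real (n choose 2))
            + (\<Sum>x\<in>live t k \<omega> \<inter> S. prob_le n mu t k \<omega> x / (real n - lineages t k \<omega> x)))"
proof -
  interpret smgp n mu t k by unfold_locales (fact n2 mu_pos t_incr)+
  show ?thesis unfolding M_def F_def
    using gaps_match_exp_lt[OF k1] gaps_match_exp_le[OF k1] gaps_match_exp_eq[OF k1] gaps_match_exp_set[OF k1] by blast
qed

end
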